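(* Let $(\phi_h,\mathbf{j}_h,\mu_h,\boldsymbol{\sigma}_h)$ be a solution of the mixed DG semi-discretization (DG-CH) of the Cahn–Hilliard equation described in the context, with forcing term $S$. Then the following hold. (1) (Mass conservation up to forcing.) Total mass is conserved up to the forcing term: $$\frac{d}{dt}\int_\Omega \phi_h\,dx=\int_\Omega S\,dx .$$ (2) (Strongly consistent energy evolution, up to forcing.) Define the discrete total energy $$H_{DG}(\phi_h)=\int_\Omega\Big(F(\phi_h)+\frac{\epsilon^2}{2}\,|\boldsymbol{\sigma}_h(\phi_h)|^2\Big)dx ,$$ where $\boldsymbol{\sigma}_h(\phi_h)$ is the discrete weak gradient of $\phi_h$ defined in the context. Then the rate of change in time of $H_{DG}$ is strongly consistent. That is, the discrete solution satisfies $$\frac{d}{dt}H_{DG}(\phi_h)=-\Big\|\tfrac{1}{\sqrt{d(\phi_h)}}\,\mathbf{j}_h\Big\|_{L^2(\Omega)}^2+\langle\mu_h,S\rangle ,$$ and every sufficiently smooth exact solution $(\phi,\mu)$ of the continuous problem (CH) in the context satisfies the same law, with $\mathbf{j}=-d(\phi)\nabla\mu$ in place of $\mathbf{j}_h$, $\boldsymbol{\sigma}=\nabla\phi$ in place of $\boldsymbol{\sigma}_h(\phi_h)$, and $\phi,\mu$ in place of $\phi_h,\mu_h$. Explicitly, $$\frac{d}{dt}\int_\Omega\Big(F(\phi)+\frac{\epsilon^2}{2}|\nabla\phi|^2\Big)dx=-\Big\|\tfrac{1}{\sqrt{d(\phi)}}\,\mathbf{j}\Big\|_{L^2(\Omega)}^2+\langle\mu,S\rangle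 .$$
   Context: Setting. $\Omega$ is a bounded (polygonal or polyhedral, Lipschitz) domain with outward unit normal $\mathbf{n}$ on $\partial\Omega$, equipped with a finite element mesh. $\langle\cdot,\cdot\rangle$ denotes the $L^2(\Omega)$ inner product of scalar or vector fields. $\epsilon>0$ is a constant. The diffusion coefficient is a positive function $d(\phi)>0$, assumed continuous in its argument. $S$ is a given forcing term, $S(t)\in L^2(\Omega)$. The potential is $F(\phi)=\frac14(1-\phi^2)^2$, so that $F'(\phi)=\phi^3-\phi$. Continuous problem (CH). $$\frac{\partial\phi}{\partial t}-\nabla\cdot(d(\phi)\nabla\mu)=S,\qquad \mu=F'(\phi)-\epsilon^2\Delta\phi\quad\text{in }\Omega,$$ with homogeneous Neumann boundary conditions $\mathbf{n}\cdot\nabla\phi=0$ and $\mathbf{n}\cdot\nabla\mu=0$ on $\partial\Omega$. Discrete spaces. $\mathbb{V}_{H(\mathrm{div})}\subset H(\mathrm{div};\Omega)$ and $\mathbb{V}_{DG}\subset L^2(\Omega)$ are finite-dimensional compatible finite element spaces of piecewise polynomials on the mesh (the last two spaces of a discrete de Rham complex). In particular $\nabla\cdot$ maps $\mathbb{V}_{H(\mathrm{div})}$ into $\mathbb{V}_{DG}$, elements of $\mathbb{V}_{H(\mathrm{div})}$ have continuous normal components across interior mesh facets, and $\mathbb{V}_{DG}$ is a discontinuous Galerkin space (no inter-element continuity) that contains the constants. $\mathring{\mathbb{V}}_{H(\mathrm{div})}$ is the subspace of those $\mathbf{w}\in\mathbb{V}_{H(\mathrm{div})}$ with $\mathbf{w}\cdot\mathbf{n}=0$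 on $\partial\Omega$. Semi-discretization (DG-CH). Continuous in time, find $(\phi_h,\mathbf{j}_h,\mu_h,\boldsymbol{\sigma}_h)\in(\mathbb{V}_{DG},\mathring{\mathbb{V}}_{H(\mathrm{div})},\mathbb{V}_{DG},\mathring{\mathbb{V}}_{H(\mathrm{div})})$, with $\phi_h$ continuously differentiable in time, such that at each time $$\Big\langle\psi,\tfrac{\partial\phi_h}{\partial t}+\nabla\cdot\mathbf{j}_h\Big\rangle=\langle\psi,S\rangle\quad\forall\psi\in\mathbb{V}_{DG},$$ $$\Big\langle\tfrac{1}{d(\phi_h)}\mathbf{v},\mathbf{j}_h\Big\rangle-\langle\nabla\cdot\mathbf{v},\mu_h\rangle=0\quad\forall\mathbf{v}\in\mathring{\mathbb{V}}_{H(\mathrm{div})},$$ $$\langle\psi,\mu_h-\phi_h^3+\phi_h+\epsilon^2\nabla\cdot\boldsymbol{\sigma}_h\rangle=0\quad\forall\psi\in\mathbb{V}_{DG},$$ $$\langle\mathbf{v},\boldsymbol{\sigma}_h\rangle+\langle\nabla\cdot\mathbf{v},\phi_h\rangle=0\quad\forall\mathbf{v}\in\mathring{\mathbb{V}}_{H(\mathrm{div})}.$$ Discrete weak gradient. For $\psi\in\mathbb{V}_{DG}$, $\boldsymbol{\sigma}_h(\psi)\in\mathring{\mathbb{V}}_{H(\mathrm{div})}$ is the unique element with $\langle\mathbf{v},\boldsymbol{\sigma}_h(\psi)\rangle=-\langle\nabla\cdot\mathbf{v},\psi\rangle$ for all $\mathbf{v}\in\mathring{\mathbb{V}}_{H(\mathrm{div})}$.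 Thus in (DG-CH), $\boldsymbol{\sigma}_h=\boldsymbol{\sigma}_h(\phi_h)$. Strong consistency. A discrete equation or property is called strongly consistent if the exact solution of the underlying non-discretized equation also satisfies that discrete equation or property. *)

theory Defs
  imports "HOL-Analysis.Analysis"
begin

section \<open>The domain and the mesh\<close>

text \<open>Near each boundary point the domain is, in coordinates with vertical axis \<open>e\<close>,
  the region strictly below the graph of a Lipschitz function on the hyperplane orthogonal
  to \<open>e\<close>.\<close>

definition lipschitz_boundary :: "'a::euclidean_space set \<Rightarrow> bool" where
  "lipschitz_boundary \<Omega> \<longleftrightarrow>
     (\<forall>x\<in>frontier \<Omega>. \<exists>e r L. \<exists>g :: 'a \<Rightarrow> real.
        norm e = 1 \<and> r > 0 \<and> L-lipschitz_on UNIV g \<and>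
        (\<forall>y\<in>ball x r. y \<in> \<Omega> \<longleftrightarrow> y \<bullet> e < g (y - (y \<bullet> e) *\<^sub>R e)))"

definition bounded_lipschitz_domain :: "'a::euclidean_space set \<Rightarrow> bool" where
  "bounded_lipschitz_domain \<Omega> \<longleftrightarrow>
     open \<Omega> \<and> connected \<Omega> \<and> \<Omega> \<noteq> {} \<and> bounded \<Omega> \<and> lipschitz_boundary \<Omega>"

text \<open>A conforming (face-to-face) mesh of convex polytopes.  Distinct cells automatically have
  disjoint interiors.  A bounded Lipschitz domain with such a mesh is polygonal or polyhedral.\<close>

definition conforming_mesh :: "'a::euclidean_space set \<Rightarrow> 'a set set \<Rightarrow> bool" where
  "conforming_mesh \<Omega> \<T> \<longleftrightarrow>
     finite \<T> \<and> (\<forall>K\<in>\<T>. polytope K \<and> interior K \<noteq> {}) \<and> \<Union>\<T> = closure \<Omega> \<and>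
     (\<forall>K\<in>\<T>. \<forall>K'\<in>\<T>. (K \<inter> K') face_of K \<and> (K \<inter> K') face_of K')"

text \<open>On a polyhedral domain the outward normal exists exactly at the boundary points near which
  the domain is an open half-ball; these are almost all boundary points.\<close>

definition outward_unit_normal :: "'a::euclidean_space set \<Rightarrow> 'a \<Rightarrow> 'a \<Rightarrow> bool" where
  "outward_unit_normal \<Omega> x \<nu> \<longleftrightarrow>
     norm \<nu> = 1 \<and> (\<exists>r>0. \<forall>y\<in>ball x r. y \<in> \<Omega> \<longleftrightarrow> (y - x) \<bullet> \<nu> < 0)"

text \<open>The boundary value of \<open>w\<close> on \<open>G\<close> is its limit from inside \<open>A\<close>, and its component along the
  outward normal vanishes wherever that normal exists.\<close>

definition zero_normal_trace ::
    "'a::euclidean_space set \<Rightarrow> 'a set \<Rightarrow> 'a set \<Rightarrow> ('a \<Rightarrow> 'a) \<Rightarrow> bool" where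
  "zero_normal_trace \<Omega> A G w \<longleftrightarrow>
     (\<forall>x\<in>G. \<forall>\<nu>. outward_unit_normal \<Omega> x \<nu> \<longrightarrow> ((\<lambda>y. w y \<bullet> \<nu>) \<longlongrightarrow> 0) (at x within A))"


section \<open>Differential operators and square integrable functions\<close>

definition gradient :: "('a::euclidean_space \<Rightarrow> real) \<Rightarrow> 'a \<Rightarrow> 'a" where
  "gradient f x = (\<Sum>b\<in>Basis. frechet_derivative f (at x) b *\<^sub>R b)"

definition divergence :: "('a::euclidean_space \<Rightarrow> 'a) \<Rightarrow> 'a \<Rightarrow> real" where
  "divergence w x = (\<Sum>b\<in>Basis. frechet_derivative w (at x) b \<bullet> b)"

definition laplacian :: "('a::euclidean_space \<Rightarrow> real) \<Rightarrow> 'a \<Rightarrow> real" where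
  "laplacian f = divergence (gradient f)"

definition square_integrable ::
    "'a::euclidean_space set \<Rightarrow> ('a \<Rightarrow> 'b::euclidean_space) \<Rightarrow> bool" where
  "square_integrable \<Omega> f \<longleftrightarrow>
     f \<in> borel_measurable (lebesgue_on \<Omega>) \<and> integrable (lebesgue_on \<Omega>) (\<lambda>x. (norm (f x))\<^sup>2)"

text \<open>The inner product of scalar fields (where \<open>\<bullet>\<close> is multiplication) or of vector fields.\<close>

definition l2_inner ::
    "'a::euclidean_space set \<Rightarrow> ('a \<Rightarrow> 'b::euclidean_space) \<Rightarrow> ('a \<Rightarrow> 'b) \<Rightarrow> real" where
  "l2_inner \<Omega> f g = integral\<^sup>L (lebesgue_on \<Omega>) (\<lambda>x. f x \<bullet> g x)"

definition l2_norm :: "'a::euclidean_space set \<Rightarrow> ('a \<Rightarrow> 'b::euclidean_space) \<Rightarrow> real" where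
  "l2_norm \<Omega> f = sqrt (l2_inner \<Omega> f f)"

text \<open>Continuously differentiable functions with compact support in \<open>\<Omega>\<close>; testing weak derivatives
  with these is the same, by density, as testing with smooth ones.\<close>

definition test_function :: "'a::euclidean_space set \<Rightarrow> ('a \<Rightarrow> real) \<Rightarrow> bool" where
  "test_function \<Omega> \<eta> \<longleftrightarrow>
     (\<forall>x. \<eta> differentiable (at x)) \<and> continuous_on UNIV (gradient \<eta>) \<and>
     (\<exists>C. compact C \<and> C \<subseteq> \<Omega> \<and> (\<forall>x. x \<notin> C \<longrightarrow> \<eta> x = 0))"

definition has_weak_div ::
    "'a::euclidean_space set \<Rightarrow> ('a \<Rightarrow> 'a) \<Rightarrow> ('a \<Rightarrow> real) \<Rightarrow> bool" where
  "has_weak_div \<Omega> w g \<longleftrightarrow> square_integrable \<Omega> g \<and>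
     (\<forall>\<eta>. test_function \<Omega> \<eta> \<longrightarrow> l2_inner \<Omega> w (gradient \<eta>) = - l2_inner \<Omega> g \<eta>)"

definition Hdiv :: "'a::euclidean_space set \<Rightarrow> ('a \<Rightarrow> 'a) set" where
  "Hdiv \<Omega> = {w. square_integrable \<Omega> w \<and> (\<exists>g. has_weak_div \<Omega> w g)}"

text \<open>The weak divergence is determined almost everywhere in \<open>\<Omega>\<close>; it is used only under integrals
  over \<open>\<Omega>\<close>.\<close>

definition weak_div :: "'a::euclidean_space set \<Rightarrow> ('a \<Rightarrow> 'a) \<Rightarrow> 'a \<Rightarrow> real" where
  "weak_div \<Omega> w = (SOME g. has_weak_div \<Omega> w g)"

definition time_deriv ::
    "real set \<Rightarrow> (real \<Rightarrow> 'a \<Rightarrow> 'b::real_normed_vector) \<Rightarrow> real \<Rightarrow> 'a \<Rightarrow> 'b" where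
  "time_deriv I u t x = vector_derivative (\<lambda>s. u s x) (at t within I)"


section \<open>Compatible finite element spaces\<close>

text \<open>Piecewise polynomials are identified up to null sets by giving them the value zero on the mesh
  skeleton and outside the mesh.  This choice of representatives makes almost everywhere equality
  the same as equality.\<close>

definition piecewise_polynomial ::
    "'a::euclidean_space set set \<Rightarrow> ('a \<Rightarrow> 'b::euclidean_space) \<Rightarrow> bool" where
  "piecewise_polynomial \<T> f \<longleftrightarrow>
     (\<forall>K\<in>\<T>. \<exists>p. polynomial_function p \<and> (\<forall>x\<in>interior K. f x = p x)) \<and>
     (\<forall>x. x \<notin> (\<Union>K\<in>\<T>. interior K) \<longrightarrow> f x = 0)"

text \<open>\<open>V\<close> is the linear span of a finite set of functions.\<close>

definition fin_dim_function_space :: "('a \<Rightarrow> 'b::real_vector) set \<Rightarrow> bool" where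
  "fin_dim_function_space V \<longleftrightarrow>
     (\<exists>B. finite B \<and> V = range (\<lambda>c x. \<Sum>b\<in>B. c b *\<^sub>R b x))"

text \<open>The last two conjuncts say that the scalar space contains the constants and that it imposes
  no coupling between cells.  Continuity of normal components across interior facets is part of
  membership in \<open>Hdiv \<Omega>\<close>.\<close>

definition compatible_fe_spaces ::
    "'a::euclidean_space set \<Rightarrow> 'a set set \<Rightarrow> ('a \<Rightarrow> real) set \<Rightarrow> ('a \<Rightarrow> 'a) set \<Rightarrow> bool" where
  "compatible_fe_spaces \<Omega> \<T> V_DG V_div \<longleftrightarrow>
     fin_dim_function_space V_DG \<and> fin_dim_function_space V_div \<and>
     (\<forall>\<psi>\<in>V_DG. piecewise_polynomial \<T> \<psi>) \<and> (\<forall>w\<in>V_div. piecewise_polynomial \<T> w) \<and>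
     V_div \<subseteq> Hdiv \<Omega> \<and>
     (\<forall>w\<in>V_div. \<exists>g\<in>V_DG. has_weak_div \<Omega> w g) \<and>
     (\<forall>c. (\<lambda>x. if x \<in> (\<Union>K\<in>\<T>. interior K) then c else 0) \<in> V_DG) \<and>
     (\<forall>\<psi>\<in>V_DG. \<forall>K\<in>\<T>. (\<lambda>x. if x \<in> interior K then \<psi> x else 0) \<in> V_DG)"

text \<open>The subspace with \<open>w \<cdot> n = 0\<close> on \<open>\<partial>\<Omega>\<close>.  On a boundary facet the trace has to be taken from the
  one cell that owns the facet: another cell touching the boundary only in a lower-dimensional face
  may well have a nonzero normal component there.\<close>

definition Vdiv0 ::
    "'a::euclidean_space set \<Rightarrow> 'a set set \<Rightarrow> ('a \<Rightarrow> 'a) set \<Rightarrow> ('a \<Rightarrow> 'a) set" where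
  "Vdiv0 \<Omega> \<T> V_div =
     {w \<in> V_div. \<forall>K\<in>\<T>. \<forall>G. G facet_of K \<and> G \<subseteq> frontier \<Omega> \<longrightarrow>
        zero_normal_trace \<Omega> (interior K) G w}"

definition weak_gradient ::
    "'a::euclidean_space set \<Rightarrow> 'a set set \<Rightarrow> ('a \<Rightarrow> 'a) set \<Rightarrow> ('a \<Rightarrow> real) \<Rightarrow> 'a \<Rightarrow> 'a" where
  "weak_gradient \<Omega> \<T> V_div \<psi> =
     (THE \<sigma>. \<sigma> \<in> Vdiv0 \<Omega> \<T> V_div \<and>
        (\<forall>v\<in>Vdiv0 \<Omega> \<T> V_div. l2_inner \<Omega> v \<sigma> = - l2_inner \<Omega> (weak_div \<Omega> v) \<psi>))"


section \<open>The Cahn--Hilliard equation and its semi-discretization\<close>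

definition potential :: "real \<Rightarrow> real" where
  "potential r = (1 - r\<^sup>2)\<^sup>2 / 4"

text \<open>For a curve in a finite-dimensional function space, continuous differentiability with respect
  to any norm is the same as pointwise continuous differentiability.\<close>

definition dg_ch_solution ::
    "real set \<Rightarrow> 'a::euclidean_space set \<Rightarrow> 'a set set \<Rightarrow> ('a \<Rightarrow> real) set \<Rightarrow> ('a \<Rightarrow> 'a) set \<Rightarrow>
     real \<Rightarrow> (real \<Rightarrow> real) \<Rightarrow> (real \<Rightarrow> 'a \<Rightarrow> real) \<Rightarrow>
     (real \<Rightarrow> 'a \<Rightarrow> real) \<Rightarrow> (real \<Rightarrow> 'a \<Rightarrow> 'a) \<Rightarrow> (real \<Rightarrow> 'a \<Rightarrow> real) \<Rightarrow> (real \<Rightarrow> 'a \<Rightarrow> 'a) \<Rightarrow> bool" where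
  "dg_ch_solution I \<Omega> \<T> V_DG V_div \<epsilon> d S \<phi> j \<mu> \<sigma> \<longleftrightarrow>
     (\<forall>x. (\<forall>t\<in>I. (\<lambda>s. \<phi> s x) differentiable (at t within I)) \<and>
          continuous_on I (\<lambda>t. time_deriv I \<phi> t x)) \<and>
     (\<forall>t\<in>I.
        \<phi> t \<in> V_DG \<and> j t \<in> Vdiv0 \<Omega> \<T> V_div \<and> \<mu> t \<in> V_DG \<and> \<sigma> t \<in> Vdiv0 \<Omega> \<T> V_div \<and>
        (\<forall>\<psi>\<in>V_DG.
           l2_inner \<Omega> \<psi> (\<lambda>x. time_deriv I \<phi> t x + weak_div \<Omega> (j t) x) = l2_inner \<Omega> \<psi> (S t)) \<and>
        (\<forall>v\<in>Vdiv0 \<Omega> \<T> V_div.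
           l2_inner \<Omega> (\<lambda>x. (1 / d (\<phi> t x)) *\<^sub>R v x) (j t) - l2_inner \<Omega> (weak_div \<Omega> v) (\<mu> t) = 0) \<and>
        (\<forall>\<psi>\<in>V_DG.
           l2_inner \<Omega> \<psi>
             (\<lambda>x. \<mu> t x - (\<phi> t x) ^ 3 + \<phi> t x + \<epsilon>\<^sup>2 * weak_div \<Omega> (\<sigma> t) x) = 0) \<and>
        (\<forall>v\<in>Vdiv0 \<Omega> \<T> V_div.
           l2_inner \<Omega> v (\<sigma> t) + l2_inner \<Omega> (weak_div \<Omega> v) (\<phi> t) = 0))"

text \<open>Continuously differentiable up to the boundary: on a bounded domain, uniform continuity of a
  function is the same as having a continuous extension to the closure.\<close>

definition C1_up_to_boundary ::
    "'a::euclidean_space set \<Rightarrow> ('a \<Rightarrow> 'b::euclidean_space) \<Rightarrow> bool" where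
  "C1_up_to_boundary \<Omega> f \<longleftrightarrow>
     (\<forall>x\<in>\<Omega>. f differentiable (at x)) \<and> uniformly_continuous_on \<Omega> f \<and>
     (\<forall>v. uniformly_continuous_on \<Omega> (\<lambda>x. frechet_derivative f (at x) v))"

text \<open>Likewise, \<open>u\<close> has a jointly continuous extension to \<open>I \<times> closure \<Omega>\<close>.\<close>

definition C0_spacetime ::
    "real set \<Rightarrow> 'a::euclidean_space set \<Rightarrow> (real \<Rightarrow> 'a \<Rightarrow> 'b::euclidean_space) \<Rightarrow> bool" where
  "C0_spacetime I \<Omega> u \<longleftrightarrow>
     (\<forall>J. compact J \<and> J \<subseteq> I \<longrightarrow> uniformly_continuous_on (J \<times> \<Omega>) (\<lambda>(t, x). u t x))"

definition ch_smooth ::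
    "real set \<Rightarrow> 'a::euclidean_space set \<Rightarrow> (real \<Rightarrow> real) \<Rightarrow>
     (real \<Rightarrow> 'a \<Rightarrow> real) \<Rightarrow> (real \<Rightarrow> 'a \<Rightarrow> real) \<Rightarrow> bool" where
  "ch_smooth I \<Omega> d \<phi> \<mu> \<longleftrightarrow>
     (\<forall>t\<in>I.
        C1_up_to_boundary \<Omega> (\<phi> t) \<and> C1_up_to_boundary \<Omega> (gradient (\<phi> t)) \<and>
        C1_up_to_boundary \<Omega> (\<mu> t) \<and>
        C1_up_to_boundary \<Omega> (\<lambda>x. d (\<phi> t x) *\<^sub>R gradient (\<mu> t) x) \<and>
        (\<forall>x\<in>\<Omega>. (\<lambda>s. \<phi> s x) differentiable (at t within I)) \<and>
        C1_up_to_boundary \<Omega> (time_deriv I \<phi> t)) \<and>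
     C0_spacetime I \<Omega> \<phi> \<and> C0_spacetime I \<Omega> (\<lambda>t. gradient (\<phi> t)) \<and>
     C0_spacetime I \<Omega> (time_deriv I \<phi>) \<and> C0_spacetime I \<Omega> (\<lambda>t. gradient (time_deriv I \<phi> t))"

text \<open>The forcing is only given as an element of the Lebesgue space at each time, so the first
  equation is required almost everywhere.\<close>

definition ch_solution ::
    "real set \<Rightarrow> 'a::euclidean_space set \<Rightarrow> real \<Rightarrow> (real \<Rightarrow> real) \<Rightarrow> (real \<Rightarrow> 'a \<Rightarrow> real) \<Rightarrow>
     (real \<Rightarrow> 'a \<Rightarrow> real) \<Rightarrow> (real \<Rightarrow> 'a \<Rightarrow> real) \<Rightarrow> bool" where
  "ch_solution I \<Omega> \<epsilon> d S \<phi> \<mu> \<longleftrightarrow>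
     (\<forall>t\<in>I.
        (AE x in lebesgue_on \<Omega>.
           time_deriv I \<phi> t x - divergence (\<lambda>y. d (\<phi> t y) *\<^sub>R gradient (\<mu> t) y) x = S t x) \<and>
        (\<forall>x\<in>\<Omega>. \<mu> t x = deriv potential (\<phi> t x) - \<epsilon>\<^sup>2 * laplacian (\<phi> t) x) \<and>
        zero_normal_trace \<Omega> \<Omega> (frontier \<Omega>) (gradient (\<phi> t)) \<and>
        zero_normal_trace \<Omega> \<Omega> (frontier \<Omega>) (gradient (\<mu> t)))"

definition energy ::
    "'a::euclidean_space set \<Rightarrow> real \<Rightarrow> ('a \<Rightarrow> real) \<Rightarrow> ('a \<Rightarrow> 'a) \<Rightarrow> real" where
  "energy \<Omega> \<epsilon> \<phi> \<sigma> =
     integral\<^sup>L (lebesgue_on \<Omega>) (\<lambda>x. potential (\<phi> x) + \<epsilon>\<^sup>2 / 2 * (norm (\<sigma> x))\<^sup>2)"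

definition energy_law ::
    "real set \<Rightarrow> 'a::euclidean_space set \<Rightarrow> real \<Rightarrow> (real \<Rightarrow> real) \<Rightarrow> (real \<Rightarrow> 'a \<Rightarrow> real) \<Rightarrow>
     (real \<Rightarrow> 'a \<Rightarrow> real) \<Rightarrow> (real \<Rightarrow> 'a \<Rightarrow> 'a) \<Rightarrow> (real \<Rightarrow> 'a \<Rightarrow> real) \<Rightarrow> (real \<Rightarrow> 'a \<Rightarrow> 'a) \<Rightarrow> bool" where
  "energy_law I \<Omega> \<epsilon> d S \<phi> j \<mu> \<sigma> \<longleftrightarrow>
     (\<forall>t\<in>I.
        ((\<lambda>s. energy \<Omega> \<epsilon> (\<phi> s) (\<sigma> s)) has_real_derivative
           - (l2_norm \<Omega> (\<lambda>x. (1 / sqrt (d (\<phi> t x))) *\<^sub>R j t x))\<^sup>2 + l2_inner \<Omega> (\<mu> t) (S t))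
          (at t within I))"

end

theory Submission
  imports Defs
begin

text \<open>
  All three claims are energy-type identities: an equation is tested with a suitable function, the
  results are combined, and one differentiates under the integral.  What needs work is that the
  boundary terms really vanish on a polyhedral Lipschitz domain.

  Write \<open>\<phi>'\<close> for the time derivative.  Testing the first semi-discrete equation with the constant \<open>1\<close>
  gives the balance of mass once the weak divergence of a discrete flux with vanishing normal trace is
  known to have integral zero.  For the energy, the coefficients of \<open>\<phi>\<^sub>h\<close> in a nodal basis are
  differentiable in time, and so are those of \<open>\<sigma>\<^sub>h\<close>, which depend linearly on \<open>\<phi>\<^sub>h\<close>; hence \<open>\<phi>'\<close> is an
  admissible test function and the weak gradient commutes with the time derivative.  Therefore
  \<open>dH/dt = \<langle>\<phi>\<^sup>3 - \<phi>, \<phi>'\<rangle> + \<epsilon>\<^sup>2 \<langle>\<sigma>, \<sigma>'\<rangle> = \<langle>\<phi>\<^sup>3 - \<phi> - \<epsilon>\<^sup>2 div \<sigma>, \<phi>'\<rangle> = \<langle>\<mu>, \<phi>'\<rangle>\<close>, and testing the first equation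
  with \<open>\<mu>\<close> and the second with \<open>j\<close> turns this into \<open>\<langle>\<mu>, S\<rangle> - \<langle>j / d(\<phi>), j\<rangle>\<close>
  (\<open>dg_ch_conservation_laws\<close>).  For a smooth exact solution the same chain of equalities holds, with
  two applications of Green's identity in place of the discrete duality and with a mixed derivative
  theorem in place of the differentiable coefficients (\<open>ch_energy_law\<close>).

  Both cases rest on one form of the divergence theorem (\<open>integral_weak_divergence_eq_0\<close>): if a bounded
  field is continuous up to the boundary of each cell, has a weak divergence \<open>g\<close>, and has zero normal
  trace on the boundary facets, then \<open>\<integral> g = 0\<close>.  Surface integrals are avoided as follows.  The facets
  of all cells lie on finitely many hyperplanes.  Multiply together cutoffs that vanish in layers of
  width \<open>1/k\<close> around these hyperplanes; inside the domain the product is a test function \<open>\<eta>\<^sub>k\<close>, and \<open>\<eta>\<^sub>k\<close>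
  tends to \<open>1\<close> almost everywhere, so \<open>\<integral> g = - lim \<integral> w \<bullet> \<nabla>\<eta>\<^sub>k\<close>.  The gradient is a sum over the
  hyperplanes, each term of size \<open>k\<close> in one layer and in the direction of its normal.  Stretching the layer by the factor \<open>k\<close> along the normal
  (\<open>integral_normal_scaling\<close>) and pairing the points on the two sides (\<open>layer_limit\<close>) shows that the
  limit sees only the jump of the normal component of \<open>w\<close>, extended by zero, across each hyperplane.
  Almost every point of a hyperplane lies on no other one.  At such a point each of the two sides is
  locally inside a single cell or outside the domain (\<open>mesh_local_cases\<close>), and the jump is zero: at the
  boundary by the trace condition, and in the interior because a weak divergence that is an integrable
  function excludes normal jumps (\<open>weak_div_normal_continuity\<close>).
\<close>

section \<open>Cutoffs and test functions\<close>

text \<open>The basic building block of the continuously differentiable cutoffs and bumps below.\<close>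

lemma DERIV_max_0_squared:
  "((\<lambda>u::real. (max 0 u)\<^sup>2) has_real_derivative 2 * max 0 x) (at x)"
proof -
  consider "x > 0" | "x < 0" | "x = 0" by linarith
  then show ?thesis
  proof cases
    case 1
    have "((\<lambda>u::real. u\<^sup>2) has_real_derivative 2 * x) (at x)"
      by (auto intro!: derivative_eq_intros)
    then have "((\<lambda>u::real. (max 0 u)\<^sup>2) has_real_derivative 2 * x) (at x)"
      by (rule has_field_derivative_transform_within_open[where S = "{0<..}"]) (use 1 in auto)
    with 1 show ?thesis by simp
  next
    case 2
    have "((\<lambda>u::real. 0) has_real_derivative 0) (at x)" by simp
    then have "((\<lambda>u::real. (max 0 u)\<^sup>2) has_real_derivative 0) (at x)"
      by (rule has_field_derivative_transform_within_open[where S = "{..<0}"]) (use 2 in auto)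
    with 2 show ?thesis by simp
  next
    case 3
    have "((\<lambda>h::real. (max 0 h)\<^sup>2 / h) \<longlongrightarrow> 0) (at 0)"
    proof (rule Lim_null_comparison)
      show "\<forall>\<^sub>F h in at 0. norm ((max 0 h)\<^sup>2 / h) \<le> \<bar>h::real\<bar>"
        by (auto simp: max_def power2_eq_square)
      show "((\<lambda>h::real. \<bar>h\<bar>) \<longlongrightarrow> 0) (at 0)"
        by (intro tendsto_rabs_zero tendsto_ident_at)
    qed
    with 3 show ?thesis by (simp add: DERIV_def)
  qed
qed

text \<open>The quotient \<open>p / (p + q)\<close> with \<open>p = max 0 (s\<^sup>2 - 1)\<^sup>2\<close> and \<open>q = max 0 (2 - s\<^sup>2)\<^sup>2\<close>; the
  denominator is positive because \<open>s\<^sup>2 > 1\<close> or \<open>s\<^sup>2 < 2\<close> for every \<open>s\<close>.  That the derivative is odd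
  is what later makes the two sides of a hyperplane cancel.\<close>

lemma C1_cutoff_exists:
  obtains \<zeta> \<zeta>' :: "real \<Rightarrow> real" where
    "\<And>s. (\<zeta> has_real_derivative \<zeta>' s) (at s)" "continuous_on UNIV \<zeta>'"
    "\<And>s. \<zeta>' (- s) = - \<zeta>' s" "\<And>s. \<bar>s\<bar> \<ge> 2 \<Longrightarrow> \<zeta>' s = 0"
    "\<And>s. \<bar>s\<bar> \<le> 1 \<Longrightarrow> \<zeta> s = 0" "\<And>s. \<bar>s\<bar> \<ge> 2 \<Longrightarrow> \<zeta> s = 1"
    "\<And>s. 0 \<le> \<zeta> s" "\<And>s. \<zeta> s \<le> 1"
proof
  define p p' q q' :: "real \<Rightarrow> real" where
    "p s = (max 0 (s\<^sup>2 - 1))\<^sup>2" and "p' s = 4 * s * max 0 (s\<^sup>2 - 1)" and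
    "q s = (max 0 (2 - s\<^sup>2))\<^sup>2" and "q' s = - 4 * s * max 0 (2 - s\<^sup>2)" for s
  define \<zeta> where "\<zeta> s = p s / (p s + q s)" for s
  define \<zeta>' where "\<zeta>' s = (p' s * q s - p s * q' s) / (p s + q s)\<^sup>2" for s
  have pq: "p s + q s > 0" for s
  proof (cases "s\<^sup>2 > 1")
    case True then have "p s > 0" unfolding p_def by simp
    then show ?thesis by (simp add: q_def add_pos_nonneg)
  next
    case False then have "q s > 0" unfolding q_def by simp
    then show ?thesis by (simp add: p_def add_nonneg_pos)
  qed
  have dp: "(p has_real_derivative p' s) (at s)" for s
  proof -
    have "((\<lambda>s. s\<^sup>2 - 1) has_real_derivative 2 * s) (at s)"
      by (auto intro!: derivative_eq_intros)
    from DERIV_chain2[OF DERIV_max_0_squared this] show ?thesis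
      unfolding p_def[abs_def] p'_def by (simp add: mult_ac)
  qed
  have dq: "(q has_real_derivative q' s) (at s)" for s
  proof -
    have "((\<lambda>s. 2 - s\<^sup>2) has_real_derivative - (2 * s)) (at s)"
      by (auto intro!: derivative_eq_intros)
    from DERIV_chain2[OF DERIV_max_0_squared this] show ?thesis
      unfolding q_def[abs_def] q'_def by (simp add: mult_ac)
  qed
  show "(\<zeta> has_real_derivative \<zeta>' s) (at s)" for s
    unfolding \<zeta>_def[abs_def] \<zeta>'_def
    using pq[of s] by (auto intro!: derivative_eq_intros dp dq simp: power2_eq_square algebra_simps)
  show "continuous_on UNIV \<zeta>'"
    unfolding \<zeta>'_def[abs_def] p_def[abs_def] q_def[abs_def] p'_def[abs_def] q'_def[abs_def]
    using pq[unfolded p_def q_def] by (intro continuous_intros) (simp add: less_imp_neq[symmetric])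
  show "\<zeta>' (- s) = - \<zeta>' s" for s
    by (simp add: \<zeta>'_def p_def q_def p'_def q'_def divide_simps)
  have sq: "\<bar>s\<bar> \<ge> 2 \<Longrightarrow> s\<^sup>2 \<ge> 4" "\<bar>s\<bar> \<le> 1 \<Longrightarrow> s\<^sup>2 \<le> 1" for s :: real
    using power_mono[of 2 "\<bar>s\<bar>" 2] power_mono[of "\<bar>s\<bar>" 1 2] by auto
  show "\<zeta>' s = 0" if "\<bar>s\<bar> \<ge> 2" for s
    using sq(1)[OF that] by (simp add: \<zeta>'_def q_def q'_def)
  show "\<zeta> s = 0" if "\<bar>s\<bar> \<le> 1" for s using sq(2)[OF that] by (simp add: \<zeta>_def p_def)
  show "\<zeta> s = 1" if "\<bar>s\<bar> \<ge> 2" for s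
    using sq(1)[OF that] pq[of s] by (simp add: \<zeta>_def q_def p_def)
  have pn: "p s \<ge> 0" "q s \<ge> 0" for s by (auto simp: p_def q_def)
  show "0 \<le> \<zeta> s" "\<zeta> s \<le> 1" for s using pn[of s] pq[of s] by (auto simp: \<zeta>_def)
qed

lemma inner_gradient:
  assumes "f differentiable (at x)"
  shows "gradient f x \<bullet> v = frechet_derivative f (at x) v"
proof -
  let ?F = "frechet_derivative f (at x)"
  have "linear ?F" using assms by (rule linear_frechet_derivative)
  have "gradient f x \<bullet> v = (\<Sum>b\<in>Basis. (v \<bullet> b) * ?F b)"
    unfolding gradient_def by (simp add: inner_sum_left inner_commute[of v] mult.commute)
  also have "\<dots> = ?F (\<Sum>b\<in>Basis. (v \<bullet> b) *\<^sub>R b)"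
    using \<open>linear ?F\<close> by (simp add: linear_sum linear_cmul)
  finally show ?thesis by (simp add: euclidean_representation)
qed

lemma has_derivative_gradient:
  assumes "f differentiable (at x)"
  shows "(f has_derivative (\<lambda>h. gradient f x \<bullet> h)) (at x)"
  using assms by (simp add: inner_gradient frechet_derivative_works[symmetric])

lemma gradient_eqI:
  assumes "(f has_derivative (\<lambda>h. G \<bullet> h)) (at x)"
  shows "gradient f x = G"
  using frechet_derivative_at[OF assms, symmetric]
  by (simp add: gradient_def euclidean_representation)

lemma gradient_eq_0_off_support:
  assumes "compact C" "\<And>x. x \<notin> C \<Longrightarrow> \<eta> x = 0" "x \<notin> C"
  shows "(\<eta> has_derivative (\<lambda>h. 0)) (at x)" "gradient \<eta> x = 0"
proof -
  have "((\<lambda>x. 0) has_derivative (\<lambda>h. 0)) (at x)" by simp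
  then show "(\<eta> has_derivative (\<lambda>h. 0)) (at x)"
    by (rule has_derivative_transform_within_open[where s = "- C"])
       (use assms in \<open>auto simp: open_Compl compact_imp_closed\<close>)
  then show "gradient \<eta> x = 0" by (intro gradient_eqI) simp
qed

text \<open>A function that is continuously differentiable in the open set and vanishes off a compact part
  of it is so everywhere, because the set and the complement of the compact part are both open and
  together cover the whole space.\<close>

lemma test_functionI:
  assumes D: "\<And>x. x \<in> \<Omega> \<Longrightarrow> (\<eta> has_derivative (\<lambda>h. G x \<bullet> h)) (at x)" and G: "continuous_on \<Omega> G"
    and \<Omega>: "open \<Omega>" and C: "compact C" "C \<subseteq> \<Omega>" "\<And>x. x \<notin> C \<Longrightarrow> \<eta> x = 0"
  shows "test_function \<Omega> \<eta>" "\<And>x. x \<in> \<Omega> \<Longrightarrow> gradient \<eta> x = G x"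
    "\<And>x. (\<eta> has_derivative (\<lambda>h. gradient \<eta> x \<bullet> h)) (at x)" "continuous_on UNIV (gradient \<eta>)"
proof -
  show gr: "gradient \<eta> x = G x" if "x \<in> \<Omega>" for x using D[OF that] by (rule gradient_eqI)
  have off: "(\<eta> has_derivative (\<lambda>h. 0)) (at x)" "gradient \<eta> x = 0" if "x \<notin> C" for x
    using gradient_eq_0_off_support[of C \<eta> x] C that by auto
  show der: "(\<eta> has_derivative (\<lambda>h. gradient \<eta> x \<bullet> h)) (at x)" for x
  proof (cases "x \<in> \<Omega>")
    case False
    then have "x \<notin> C" using C(2) by auto
    from off[OF this] show ?thesis by simp
  qed (use D gr in simp)
  have "continuous_on (\<Omega> \<union> - C) (gradient \<eta>)"
  proof (rule continuous_on_open_Un)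
    show "continuous_on \<Omega> (gradient \<eta>)"
      by (rule continuous_on_eq[OF G]) (simp add: gr)
    show "continuous_on (- C) (gradient \<eta>)"
      by (rule continuous_on_eq[OF continuous_on_const[of _ 0]]) (simp add: off(2))
  qed (use \<Omega> C in \<open>auto simp: open_Compl compact_imp_closed\<close>)
  moreover have "\<Omega> \<union> - C = UNIV" using C(2) by auto
  ultimately show "continuous_on UNIV (gradient \<eta>)" by simp
  moreover have "\<eta> differentiable (at x)" for x using der by (rule differentiableI)
  ultimately show "test_function \<Omega> \<eta>" unfolding test_function_def using C by auto
qed


section \<open>Scaling along a normal direction and thin layers\<close>

text \<open>The map fixes the hyperplane \<open>a \<bullet> x = c\<close> and scales the distance from it by \<open>r\<close>, so its
  determinant is \<open>r\<close>.  Translation invariance of Lebesgue measure is enough to see this.  Insert the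
  factor \<open>1 = \<integral> \<rho> (a \<bullet> x - c + \<tau>) d\<tau>\<close>, where \<open>\<rho>\<close> is the indicator of the unit interval, and exchange the
  integrals.  Then shift \<open>x\<close> by \<open>- \<tau> a\<close>, so that the variable \<open>\<tau>\<close> moves into \<open>f\<close> with the factor \<open>- r\<close>.
  A one-dimensional substitution yields \<open>1 / \<bar>r\<bar>\<close> times a quantity \<open>K\<close> that does not depend on \<open>r\<close>,
  and \<open>r = 1\<close> identifies \<open>K\<close>.\<close>

lemma nn_integral_normal_scaling:
  fixes a :: "'a::euclidean_space"
  assumes a: "norm a = 1" and r: "r \<noteq> 0" and f: "f \<in> borel_measurable borel"
  shows "(\<integral>\<^sup>+x. f (x + ((r - 1) * (a \<bullet> x - c)) *\<^sub>R a) \<partial>lborel)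
         = ennreal (1 / \<bar>r\<bar>) * (\<integral>\<^sup>+x. f x \<partial>lborel)"
proof -
  have aa: "a \<bullet> a = 1" using a by (simp add: dot_square_norm)
  note [measurable] = f
  let ?\<rho> = "indicator {0..1} :: real \<Rightarrow> ennreal"
  define K where "K = (\<integral>\<^sup>+x. ?\<rho> (a \<bullet> x - c) * (\<integral>\<^sup>+u. f (x + u *\<^sub>R a) \<partial>lborel) \<partial>lborel)"
  have key: "(\<integral>\<^sup>+x. f (x + ((r - 1) * (a \<bullet> x - c)) *\<^sub>R a) \<partial>lborel) = ennreal (1 / \<bar>r\<bar>) * K"
    if r: "r \<noteq> 0" for r
  proof -
    have one: "(\<integral>\<^sup>+\<tau>. ?\<rho> (v + \<tau>) \<partial>lborel) = 1" for v
      using nn_integral_real_affine[of ?\<rho> 1 v] by simp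
    have "(\<integral>\<^sup>+x. f (x + ((r - 1) * (a \<bullet> x - c)) *\<^sub>R a) \<partial>lborel)
        = (\<integral>\<^sup>+x. (\<integral>\<^sup>+\<tau>. f (x + ((r - 1) * (a \<bullet> x - c)) *\<^sub>R a) * ?\<rho> (a \<bullet> x - c + \<tau>) \<partial>lborel) \<partial>lborel)"
      by (subst nn_integral_cmult) (auto simp: one)
    also have "\<dots> = (\<integral>\<^sup>+\<tau>. (\<integral>\<^sup>+x. f (x + ((r - 1) * (a \<bullet> x - c)) *\<^sub>R a) * ?\<rho> (a \<bullet> x - c + \<tau>) \<partial>lborel) \<partial>lborel)"
      by (rule lborel_pair.Fubini'[symmetric]) measurable
    also have "\<dots> = (\<integral>\<^sup>+\<tau>. (\<integral>\<^sup>+x. f (x + ((r - 1) * (a \<bullet> x - c) - r * \<tau>) *\<^sub>R a) * ?\<rho> (a \<bullet> x - c) \<partial>lborel) \<partial>lborel)"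
    proof (rule nn_integral_cong)
      fix \<tau> :: real
      have "(\<integral>\<^sup>+x. f (x + ((r - 1) * (a \<bullet> x - c)) *\<^sub>R a) * ?\<rho> (a \<bullet> x - c + \<tau>) \<partial>lborel)
          = (\<integral>\<^sup>+x. f (x + ((r - 1) * (a \<bullet> x - c)) *\<^sub>R a) * ?\<rho> (a \<bullet> x - c + \<tau>) \<partial>distr lborel borel ((+) ((- \<tau>) *\<^sub>R a)))"
        by (simp add: lborel_distr_plus)
      also have "\<dots> = (\<integral>\<^sup>+x. f (((- \<tau>) *\<^sub>R a + x) + ((r - 1) * (a \<bullet> ((- \<tau>) *\<^sub>R a + x) - c)) *\<^sub>R a)
                      * ?\<rho> (a \<bullet> ((- \<tau>) *\<^sub>R a + x) - c + \<tau>) \<partial>lborel)"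
        by (subst nn_integral_distr) auto
      also have "\<dots> = (\<integral>\<^sup>+x. f (x + ((r - 1) * (a \<bullet> x - c) - r * \<tau>) *\<^sub>R a) * ?\<rho> (a \<bullet> x - c) \<partial>lborel)"
      proof (rule nn_integral_cong)
        fix x
        have 1: "(- \<tau>) *\<^sub>R a + x + ((r - 1) * (a \<bullet> ((- \<tau>) *\<^sub>R a + x) - c)) *\<^sub>R a
              = x + ((r - 1) * (a \<bullet> x - c) - r * \<tau>) *\<^sub>R a"
          by (simp add: inner_add_right aa algebra_simps)
        have 2: "a \<bullet> ((- \<tau>) *\<^sub>R a + x) - c + \<tau> = a \<bullet> x - c" by (simp add: inner_diff_right aa)
        show "f ((- \<tau>) *\<^sub>R a + x + ((r - 1) * (a \<bullet> ((- \<tau>) *\<^sub>R a + x) - c)) *\<^sub>R a)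
                * ?\<rho> (a \<bullet> ((- \<tau>) *\<^sub>R a + x) - c + \<tau>)
            = f (x + ((r - 1) * (a \<bullet> x - c) - r * \<tau>) *\<^sub>R a) * ?\<rho> (a \<bullet> x - c)"
          by (simp only: 1 2)
      qed
      finally show "(\<integral>\<^sup>+x. f (x + ((r - 1) * (a \<bullet> x - c)) *\<^sub>R a) * ?\<rho> (a \<bullet> x - c + \<tau>) \<partial>lborel)
          = (\<integral>\<^sup>+x. f (x + ((r - 1) * (a \<bullet> x - c) - r * \<tau>) *\<^sub>R a) * ?\<rho> (a \<bullet> x - c) \<partial>lborel)" .
    qed
    also have "\<dots> = (\<integral>\<^sup>+x. (\<integral>\<^sup>+\<tau>. f (x + ((r - 1) * (a \<bullet> x - c) - r * \<tau>) *\<^sub>R a) * ?\<rho> (a \<bullet> x - c) \<partial>lborel) \<partial>lborel)"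
      by (rule lborel_pair.Fubini') measurable
    also have "\<dots> = (\<integral>\<^sup>+x. ennreal (1 / \<bar>r\<bar>) * (?\<rho> (a \<bullet> x - c) * (\<integral>\<^sup>+u. f (x + u *\<^sub>R a) \<partial>lborel)) \<partial>lborel)"
    proof (rule nn_integral_cong)
      fix x
      have "(\<integral>\<^sup>+u. f (x + u *\<^sub>R a) \<partial>lborel)
          = ennreal \<bar>- r\<bar> * (\<integral>\<^sup>+\<tau>. f (x + ((r - 1) * (a \<bullet> x - c) + (- r) * \<tau>) *\<^sub>R a) \<partial>lborel)"
        by (rule nn_integral_real_affine) (use r in auto)
      then have "ennreal (1 / \<bar>r\<bar>) * (\<integral>\<^sup>+u. f (x + u *\<^sub>R a) \<partial>lborel)
          = (ennreal (1 / \<bar>r\<bar>) * ennreal \<bar>r\<bar>) * (\<integral>\<^sup>+\<tau>. f (x + ((r - 1) * (a \<bullet> x - c) - r * \<tau>) *\<^sub>R a) \<partial>lborel)"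
        by (simp add: mult.assoc)
      also have "ennreal (1 / \<bar>r\<bar>) * ennreal \<bar>r\<bar> = 1"
        using r by (simp add: ennreal_mult[symmetric])
      finally have 1: "(\<integral>\<^sup>+\<tau>. f (x + ((r - 1) * (a \<bullet> x - c) - r * \<tau>) *\<^sub>R a) \<partial>lborel)
          = ennreal (1 / \<bar>r\<bar>) * (\<integral>\<^sup>+u. f (x + u *\<^sub>R a) \<partial>lborel)" by simp
      have "(\<integral>\<^sup>+\<tau>. f (x + ((r - 1) * (a \<bullet> x - c) - r * \<tau>) *\<^sub>R a) * ?\<rho> (a \<bullet> x - c) \<partial>lborel)
          = (\<integral>\<^sup>+\<tau>. f (x + ((r - 1) * (a \<bullet> x - c) - r * \<tau>) *\<^sub>R a) \<partial>lborel) * ?\<rho> (a \<bullet> x - c)"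
        by (rule nn_integral_multc) measurable
      then show "(\<integral>\<^sup>+\<tau>. f (x + ((r - 1) * (a \<bullet> x - c) - r * \<tau>) *\<^sub>R a) * ?\<rho> (a \<bullet> x - c) \<partial>lborel)
          = ennreal (1 / \<bar>r\<bar>) * (?\<rho> (a \<bullet> x - c) * (\<integral>\<^sup>+u. f (x + u *\<^sub>R a) \<partial>lborel))"
        unfolding 1 by (simp only: mult_ac)
    qed
    also have "\<dots> = ennreal (1 / \<bar>r\<bar>) * K"
      unfolding K_def by (rule nn_integral_cmult) measurable
    finally show ?thesis .
  qed
  have "(\<integral>\<^sup>+x. f x \<partial>lborel) = K" using key[of 1] by simp
  with key[OF r] show ?thesis by simp
qed

lemma integral_normal_scaling:
  fixes a :: "'a::euclidean_space" and f :: "'a \<Rightarrow> real"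
  assumes a: "norm a = 1" and r: "r \<noteq> 0" and f: "f \<in> borel_measurable borel"
  shows "(\<integral>x. f (x + ((r - 1) * (a \<bullet> x - c)) *\<^sub>R a) \<partial>lborel) = (1 / \<bar>r\<bar>) * (\<integral>x. f x \<partial>lborel)"
proof -
  let ?M = "\<lambda>x. x + ((r - 1) * (a \<bullet> x - c)) *\<^sub>R a"
  have M: "?M \<in> borel_measurable borel" by measurable
  have eq: "distr lborel borel ?M = density lborel (\<lambda>x. ennreal (1 / \<bar>r\<bar>))"
  proof (rule measure_eqI)
    fix A assume "A \<in> sets (distr lborel borel ?M)"
    then have A: "A \<in> sets borel" by simp
    have "emeasure (distr lborel borel ?M) A = (\<integral>\<^sup>+x. indicator A x \<partial>distr lborel borel ?M)"
      using A by simp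
    also have "\<dots> = (\<integral>\<^sup>+x. indicator A (?M x) \<partial>lborel)"
      by (rule nn_integral_distr) (use M A in auto)
    also have "\<dots> = ennreal (1 / \<bar>r\<bar>) * (\<integral>\<^sup>+x. indicator A x \<partial>lborel)"
      by (rule nn_integral_normal_scaling[OF a r]) (use A in auto)
    finally show "emeasure (distr lborel borel ?M) A
        = emeasure (density lborel (\<lambda>x. ennreal (1 / \<bar>r\<bar>))) A"
      using A by (simp add: emeasure_density_const)
  qed simp
  have "(\<integral>x. f (?M x) \<partial>lborel) = (\<integral>x. f x \<partial>distr lborel borel ?M)"
    by (rule integral_distr[symmetric]) (use M f in auto)
  also have "\<dots> = (\<integral>x. (1 / \<bar>r\<bar>) *\<^sub>R f x \<partial>lborel)"
    unfolding eq by (rule integral_density) (use f in auto)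
  finally show ?thesis by simp
qed

lemma integrable_cball_indicator:
  "integrable lborel (\<lambda>x. (C::real) * indicator (cball (0::'a::euclidean_space) R) x)"
proof (rule integrable_mult_right, rule integrable_real_indicator)
  show "emeasure lborel (cball (0::'a) R) < \<infinity>" by (rule emeasure_bounded_finite) simp
qed simp

lemma integrable_bounded_support:
  fixes f :: "'a::euclidean_space \<Rightarrow> real"
  assumes "f \<in> borel_measurable borel" "\<And>x. \<bar>f x\<bar> \<le> C" "\<And>x. norm x > R \<Longrightarrow> f x = 0"
  shows "integrable lborel f"
proof (rule Bochner_Integration.integrable_bound)
  show "integrable lborel (\<lambda>x. C * indicator (cball 0 R) x)"
    by (rule integrable_cball_indicator)
  show "AE x in lborel. norm (f x) \<le> norm (C * indicator (cball 0 R) x)"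
  proof (intro AE_I2)
    fix x
    have "\<bar>f x\<bar> \<le> \<bar>C\<bar>" using assms(2)[of x] by linarith
    then show "norm (f x) \<le> norm (C * indicator (cball 0 R) x)"
      using assms(3)[of x] by (cases "norm x > R") auto
  qed
  show "f \<in> borel_measurable lborel" using assms(1) by simp
qed

lemma continuous_compact_support_bounded:
  fixes f :: "'a::euclidean_space \<Rightarrow> 'b::real_normed_vector"
  assumes "continuous_on UNIV f" "compact C" "\<And>x. x \<notin> C \<Longrightarrow> f x = 0"
  obtains M where "M \<ge> 0" "\<And>x. norm (f x) \<le> M"
proof -
  have "bounded (f ` C)"
    by (intro compact_imp_bounded compact_continuous_image continuous_on_subset[OF assms(1)] assms(2)) simp
  then obtain M where "\<forall>x\<in>C. norm (f x) \<le> M" by (auto simp: bounded_iff)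
  then have "norm (f x) \<le> max 0 M" for x using assms(3)[of x] by (cases "x \<in> C") auto
  with that[of "max 0 M"] show thesis by auto
qed

text \<open>By translation invariance the difference quotients of \<open>f\<close> in direction \<open>v\<close> have integral zero;
  they are bounded and supported in a fixed ball, and converge to the directional derivative.\<close>

lemma integral_derivative_eq_0:
  fixes f :: "'a::euclidean_space \<Rightarrow> real"
  assumes D: "\<And>x. (f has_derivative (\<lambda>h. G x \<bullet> h)) (at x)" and G: "continuous_on UNIV G"
    and C: "compact C" "\<And>x. x \<notin> C \<Longrightarrow> f x = 0"
  shows "(\<integral>x. G x \<bullet> v \<partial>lborel) = 0"
proof -
  have G0: "G x = 0" if "x \<notin> C" for x
    using gradient_eq_0_off_support(2)[of C f x] C that gradient_eqI[OF D] by simp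
  obtain M where M: "M \<ge> 0" "\<And>x. norm (G x) \<le> M"
    using continuous_compact_support_bounded[OF G C(1) G0] by blast
  have cf: "continuous_on UNIV f"
    using has_derivative_continuous[OF D] by (simp add: continuous_at_imp_continuous_on)
  obtain Mf where Mf: "\<And>x. norm (f x) \<le> Mf"
    using continuous_compact_support_bounded[OF cf C] by blast
  obtain R where R: "\<And>x. norm x > R \<Longrightarrow> x \<notin> C"
    using compact_imp_bounded[OF C(1)] by (auto simp: bounded_iff) (metis not_le)
  have bf: "f \<in> borel_measurable borel" using cf by (rule borel_measurable_continuous_onI)
  have fint: "integrable lborel f"
    by (rule integrable_bounded_support[OF bf]) (use Mf R C in auto)
  have lip: "\<bar>f (x + h) - f x\<bar> \<le> M * norm h" for x h
  proof -
    have on: "onorm (\<lambda>h. G y \<bullet> h) \<le> M" for y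
    proof (rule onorm_bound)
      fix h
      have "norm (G y \<bullet> h) \<le> norm (G y) * norm h" by (simp add: Cauchy_Schwarz_ineq2)
      also have "\<dots> \<le> M * norm h" using M(2) by (rule mult_right_mono) simp
      finally show "norm (G y \<bullet> h) \<le> M * norm h" .
    qed (rule M(1))
    have "norm (f (x + h) - f x) \<le> M * norm (x + h - x)"
      by (rule differentiable_bound[OF convex_UNIV, of f "\<lambda>x h. G x \<bullet> h"]) (use D on in auto)
    then show ?thesis by simp
  qed
  define q where "q k x = real (Suc k) * (f (inverse (real (Suc k)) *\<^sub>R v + x) - f x)" for k x
  have q0: "(\<integral>x. q k x \<partial>lborel) = 0" for k
  proof -
    let ?v = "inverse (real (Suc k)) *\<^sub>R v"
    have 1: "(\<integral>x. f (?v + x) \<partial>lborel) = (\<integral>x. f x \<partial>lborel)"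
      using integral_distr[of "(+) ?v" lborel borel f] bf by (simp add: lborel_distr_plus)
    have 2: "integrable lborel (\<lambda>x. f (?v + x))"
      using integrable_distr[of "(+) ?v" lborel borel f] bf fint by (simp add: lborel_distr_plus)
    show ?thesis unfolding q_def using 1 2 fint by simp
  qed
  have "(\<lambda>k. \<integral>x. q k x \<partial>lborel) \<longlonglongrightarrow> (\<integral>x. G x \<bullet> v \<partial>lborel)"
  proof (rule integral_dominated_convergence)
    show "(\<lambda>x. G x \<bullet> v) \<in> borel_measurable lborel"
      using G by (auto intro!: borel_measurable_continuous_onI continuous_intros)
    show "q k \<in> borel_measurable lborel" for k
      unfolding q_def using bf by measurable
    show "integrable lborel (\<lambda>x. (M * norm v) * indicator (cball 0 (R + norm v)) x)"
      by (rule integrable_cball_indicator)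
    show "AE x in lborel. (\<lambda>k. q k x) \<longlonglongrightarrow> G x \<bullet> v"
    proof (intro AE_I2)
      fix x
      have "((\<lambda>t. f (x + t *\<^sub>R v)) has_real_derivative G x \<bullet> v) (at 0)"
      proof -
        have "((\<lambda>t::real. x + t *\<^sub>R v) has_derivative (\<lambda>t. t *\<^sub>R v)) (at 0)"
          by (auto intro!: derivative_eq_intros)
        from diff_chain_at[OF this, of f "\<lambda>h. G x \<bullet> h"] D[of x]
        show ?thesis by (simp add: o_def has_field_derivative_def mult.commute[of _ "G x \<bullet> v"] mult_commute_abs)
      qed
      then have "((\<lambda>h. (f (x + h *\<^sub>R v) - f x) / h) \<longlongrightarrow> G x \<bullet> v) (at 0)"
        by (simp add: DERIV_def)
      moreover have "filterlim (\<lambda>k. inverse (real (Suc k))) (at 0) sequentially"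
        unfolding filterlim_at using LIMSEQ_inverse_real_of_nat by auto
      ultimately have "(\<lambda>k. (f (x + inverse (real (Suc k)) *\<^sub>R v) - f x) / inverse (real (Suc k))) \<longlonglongrightarrow> G x \<bullet> v"
        by (rule filterlim_compose)
      then show "(\<lambda>k. q k x) \<longlonglongrightarrow> G x \<bullet> v"
        by (simp add: q_def add.commute divide_inverse mult.commute)
    qed
    show "AE x in lborel. norm (q k x) \<le> (M * norm v) * indicator (cball 0 (R + norm v)) x" for k
    proof (intro AE_I2)
      fix x
      let ?v = "inverse (real (Suc k)) *\<^sub>R v"
      have "\<bar>f (?v + x) - f x\<bar> \<le> M * norm ?v" using lip[of x ?v] by (simp add: add.commute)
      then have "real (Suc k) * \<bar>f (?v + x) - f x\<bar> \<le> real (Suc k) * (M * norm ?v)"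
        by (intro mult_left_mono) auto
      moreover have "norm ?v = norm v / real (Suc k)" by (simp add: divide_inverse)
      then have "real (Suc k) * (M * norm ?v) = M * norm v" by (simp del: of_nat_Suc)
      ultimately have 1: "\<bar>q k x\<bar> \<le> M * norm v" by (simp only: q_def abs_mult abs_of_nat)
      have "q k x = 0" if "norm x > R + norm v"
      proof -
        have "norm ?v \<le> norm v" by (simp add: mult_left_le_one_le inverse_le_1_iff)
        then have "norm (?v + x) > R"
          using that norm_triangle_ineq2[of x "- ?v"] by (simp add: add.commute)
        moreover have "norm x > R" using that norm_ge_zero[of v] by linarith
        ultimately show ?thesis using R C by (simp add: q_def)
      qed
      with 1 show "norm (q k x) \<le> (M * norm v) * indicator (cball 0 (R + norm v)) x"
        by (auto simp: indicator_def)
    qed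
  qed
  then show ?thesis using q0 LIMSEQ_unique[OF _ tendsto_const] by (simp add: q0)
qed

text \<open>Scaling by \<open>1/k\<close> and by \<open>- 1/k\<close> both blow up the layer around the hyperplane to unit width.  As \<open>\<theta>\<close>
  is odd, the average of the two representations contains only the difference of the values of \<open>f k\<close>
  at two points that are mirror images and approach the same point of the hyperplane.\<close>

lemma layer_limit:
  fixes a :: "'a::euclidean_space" and f :: "nat \<Rightarrow> 'a \<Rightarrow> real"
  defines "M \<equiv> \<lambda>r c x. x + ((r - 1) * (a \<bullet> x - c)) *\<^sub>R a"
  assumes a: "norm a = 1"
    and \<theta>: "continuous_on UNIV \<theta>" "\<And>s. \<theta> (- s) = - \<theta> s" "\<And>s. \<bar>s\<bar> \<ge> 2 \<Longrightarrow> \<theta> s = (0::real)"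
    and f: "\<And>k. f k \<in> borel_measurable borel" "\<And>k x. \<bar>f k x\<bar> \<le> B" "\<And>k x. norm x > R \<Longrightarrow> f k x = 0"
    and D: "D \<in> borel_measurable borel"
    and lim: "AE x in lborel. (\<lambda>k. (f k (M (inverse (real (Suc k))) c x)
                - f k (M (- inverse (real (Suc k))) c x)) * \<theta> (a \<bullet> x - c)) \<longlonglongrightarrow> D x"
  shows "(\<lambda>k. real (Suc k) * (\<integral>x. f k x * \<theta> (real (Suc k) * (a \<bullet> x - c)) \<partial>lborel))
           \<longlonglongrightarrow> 1/2 * (\<integral>x. D x \<partial>lborel)"
proof -
  have aa: "a \<bullet> a = 1" using a by (simp add: dot_square_norm)
  have sM: "a \<bullet> M r c x - c = r * (a \<bullet> x - c)" for r x
    by (simp add: M_def inner_add_right aa algebra_simps)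
  have M_meas [measurable]: "M r c \<in> borel_measurable borel" for r
    unfolding M_def by measurable
  have \<theta>_meas [measurable]: "\<theta> \<in> borel_measurable borel"
    using \<theta>(1) by (rule borel_measurable_continuous_onI)
  note f(1)[measurable]
  obtain T where T: "T \<ge> 0" "\<And>s. norm (\<theta> s) \<le> T"
    by (rule continuous_compact_support_bounded[OF \<theta>(1) compact_Icc[of "-2" 2]]) (use \<theta>(3) in auto)
  have B: "B \<ge> 0" using f(2)[of 0 0] by simp
  have supp: "f k (M r c x) * \<theta> (a \<bullet> x - c) = 0" if r: "\<bar>r\<bar> \<le> 1" and x: "norm x > R + 4" for k r x
  proof (cases "\<bar>a \<bullet> x - c\<bar> \<ge> 2")
    case False
    have "x = M r c x - ((r - 1) * (a \<bullet> x - c)) *\<^sub>R a" by (simp add: M_def)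
    then have "norm x \<le> norm (M r c x) + \<bar>r - 1\<bar> * \<bar>a \<bullet> x - c\<bar>"
      using norm_triangle_ineq4[of "M r c x" "((r - 1) * (a \<bullet> x - c)) *\<^sub>R a"] a by (simp add: abs_mult)
    moreover have "\<bar>r - 1\<bar> * \<bar>a \<bullet> x - c\<bar> \<le> 2 * 2"
      by (rule mult_mono) (use False r in auto)
    ultimately have "norm (M r c x) > R" using x by linarith
    then show ?thesis using f(3) by simp
  qed (use \<theta>(3) in simp)
  have bnd: "\<bar>f k (M r c x) * \<theta> (a \<bullet> x - c)\<bar> \<le> B * T" for k r x
    unfolding abs_mult using f(2) T(2) B by (intro mult_mono) auto
  have int: "integrable lborel (\<lambda>x. f k (M r c x) * \<theta> (a \<bullet> x - c))" if "\<bar>r\<bar> \<le> 1" for k r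
    by (rule integrable_bounded_support[OF _ bnd supp[OF that]]) measurable
  define h where "h k x = (f k (M (inverse (real (Suc k))) c x)
                - f k (M (- inverse (real (Suc k))) c x)) * \<theta> (a \<bullet> x - c)" for k x
  have scaled: "real (Suc k) * (\<integral>x. f k x * \<theta> (real (Suc k) * (a \<bullet> x - c)) \<partial>lborel) = 1/2 * (\<integral>x. h k x \<partial>lborel)" for k
  proof -
    let ?r = "inverse (real (Suc k))"
    have r: "\<bar>?r\<bar> \<le> 1" by (simp add: inverse_le_1_iff)
    let ?g = "\<lambda>x. f k x * \<theta> (real (Suc k) * (a \<bullet> x - c))"
    have "(\<integral>x. ?g (M ?r c x) \<partial>lborel) = real (Suc k) * (\<integral>x. ?g x \<partial>lborel)"
      using integral_normal_scaling[OF a, of ?r ?g c] unfolding M_def by (simp add: divide_inverse)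
    moreover have "?g (M ?r c x) = f k (M ?r c x) * \<theta> (a \<bullet> x - c)" for x
    proof -
      have "real (Suc k) * (a \<bullet> M ?r c x - c) = a \<bullet> x - c" by (simp add: sM field_simps)
      then show ?thesis by simp
    qed
    ultimately have 1: "(\<integral>x. f k (M ?r c x) * \<theta> (a \<bullet> x - c) \<partial>lborel) = real (Suc k) * (\<integral>x. ?g x \<partial>lborel)"
      by (simp only:)
    have "(\<integral>x. ?g (M (- ?r) c x) \<partial>lborel) = real (Suc k) * (\<integral>x. ?g x \<partial>lborel)"
      using integral_normal_scaling[OF a, of "- ?r" ?g c] unfolding M_def by (simp add: divide_inverse)
    moreover have "?g (M (- ?r) c x) = - (f k (M (- ?r) c x) * \<theta> (a \<bullet> x - c))" for x
    proof -
      have "real (Suc k) * (a \<bullet> M (- ?r) c x - c) = - (a \<bullet> x - c)" by (simp add: sM field_simps)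
      then show ?thesis by (simp only: \<theta>(2))
    qed
    ultimately have 2: "- (\<integral>x. f k (M (- ?r) c x) * \<theta> (a \<bullet> x - c) \<partial>lborel) = real (Suc k) * (\<integral>x. ?g x \<partial>lborel)"
      by simp
    have "(\<integral>x. h k x \<partial>lborel) = (\<integral>x. f k (M ?r c x) * \<theta> (a \<bullet> x - c) \<partial>lborel)
        - (\<integral>x. f k (M (- ?r) c x) * \<theta> (a \<bullet> x - c) \<partial>lborel)"
      unfolding h_def left_diff_distrib using int r by (intro Bochner_Integration.integral_diff) auto
    with 1 2 show ?thesis by simp
  qed
  have "(\<lambda>k. \<integral>x. h k x \<partial>lborel) \<longlonglongrightarrow> (\<integral>x. D x \<partial>lborel)"
  proof (rule integral_dominated_convergence)
    show "integrable lborel (\<lambda>x. (2 * (B * T)) * indicator (cball 0 (R + 4)) x)"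
      by (rule integrable_cball_indicator)
    show "AE x in lborel. (\<lambda>k. h k x) \<longlonglongrightarrow> D x" using lim unfolding h_def .
    show "AE x in lborel. norm (h k x) \<le> (2 * (B * T)) * indicator (cball 0 (R + 4)) x" for k
    proof (intro AE_I2)
      fix x
      let ?r = "inverse (real (Suc k))"
      have r: "\<bar>?r\<bar> \<le> 1" "\<bar>- ?r\<bar> \<le> 1" by (simp_all add: inverse_le_1_iff)
      have "\<bar>h k x\<bar> \<le> 2 * (B * T)"
        using bnd[of k ?r x] bnd[of k "- ?r" x] unfolding h_def left_diff_distrib by linarith
      moreover have "h k x = 0" if "norm x > R + 4"
        using supp[OF r(1) that] supp[OF r(2) that] unfolding h_def left_diff_distrib by (simp only: diff_self)
      ultimately show "norm (h k x) \<le> (2 * (B * T)) * indicator (cball 0 (R + 4)) x"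
        by (auto simp: indicator_def)
    qed
    show "h k \<in> borel_measurable lborel" for k unfolding h_def by measurable
  qed (use D in auto)
  then have "(\<lambda>k. 1/2 * (\<integral>x. h k x \<partial>lborel)) \<longlonglongrightarrow> 1/2 * (\<integral>x. D x \<partial>lborel)"
    by (rule tendsto_mult_left)
  then show ?thesis unfolding scaled .
qed


section \<open>Divergence theorem relative to finitely many hyperplanes\<close>

lemma integral_lebesgue_on_eq_lborel:
  fixes f :: "'a::euclidean_space \<Rightarrow> real"
  assumes "open \<Omega>" "(\<lambda>x. if x \<in> \<Omega> then f x else 0) \<in> borel_measurable borel"
  shows "integral\<^sup>L (lebesgue_on \<Omega>) f = (\<integral>x. (if x \<in> \<Omega> then f x else 0) \<partial>lborel)"
proof -
  have "integral\<^sup>L (lebesgue_on \<Omega>) f = integral\<^sup>L lebesgue (\<lambda>x. indicator \<Omega> x *\<^sub>R f x)"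
    by (rule integral_restrict_space) (use assms(1) in simp)
  also have "(\<lambda>x. indicator \<Omega> x *\<^sub>R f x) = (\<lambda>x. if x \<in> \<Omega> then f x else 0)"
    by (auto simp: indicator_def)
  also have "integral\<^sup>L lebesgue \<dots> = (\<integral>x. (if x \<in> \<Omega> then f x else 0) \<partial>lborel)"
    by (rule integral_completion) (use assms(2) in simp)
  finally show ?thesis .
qed

lemma AE_notin_hyperplane:
  fixes a :: "'a::euclidean_space"
  assumes "a \<noteq> 0 \<or> c \<noteq> 0"
  shows "AE x in lborel. a \<bullet> x \<noteq> c"
proof -
  have "{x. a \<bullet> x = c} \<in> null_sets lebesgue"
    using negligible_hyperplane[OF assms] by (simp add: negligible_iff_null_sets)
  then have "{x. a \<bullet> x = c} \<in> null_sets lborel"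
    by (rule null_sets_completion_iff[THEN iffD1, rotated]) (simp add: closed_hyperplane)
  then show ?thesis by (rule AE_I'[where P = "\<lambda>x. a \<bullet> x \<noteq> c"]) auto
qed

text \<open>The points whose projection to the first hyperplane lies on the second one form a hyperplane,
  or are absent when the two hyperplanes are parallel.  So in a layer integral the intersections of
  hyperplanes, which contain all edges and corners of the mesh, can be ignored.\<close>

lemma AE_projection_notin_hyperplane:
  fixes a a' :: "'a::euclidean_space"
  assumes "norm a = 1" "norm a' = 1" "{x. a \<bullet> x = c} \<noteq> {x. a' \<bullet> x = c'}"
  shows "AE x in lborel. a' \<bullet> (x - (a \<bullet> x - c) *\<^sub>R a) \<noteq> c'"
proof -
  have aa: "a \<bullet> a = 1" "a' \<bullet> a' = 1" using assms(1,2) by (simp_all add: dot_square_norm)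
  define b where "b = a' - (a' \<bullet> a) *\<^sub>R a"
  have "b \<noteq> 0 \<or> c' - c * (a' \<bullet> a) \<noteq> 0"
  proof (rule ccontr)
    assume "\<not> ?thesis"
    then have b: "a' = (a' \<bullet> a) *\<^sub>R a" and c: "c' = c * (a' \<bullet> a)" by (auto simp: b_def)
    have n0: "a' \<bullet> a \<noteq> 0" 
    proof
      assume "a' \<bullet> a = 0"
      with b have "a' = 0" by simp
      with aa(2) show False by simp
    qed
    define l where "l = a' \<bullet> a"
    have "a' = l *\<^sub>R a" "l \<noteq> 0" "c' = l * c" using b c n0 by (simp_all add: l_def)
    then have "{x. a \<bullet> x = c} = {x. a' \<bullet> x = c'}" by simp
    with assms(3) show False by simp
  qed
  from AE_notin_hyperplane[OF this] show ?thesis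
  proof (rule AE_mp, intro AE_I2 impI)
    fix x assume "b \<bullet> x \<noteq> c' - c * (a' \<bullet> a)"
    then show "a' \<bullet> (x - (a \<bullet> x - c) *\<^sub>R a) \<noteq> c'"
      by (simp add: b_def inner_diff_left inner_diff_right algebra_simps)
  qed
qed

lemma sequentially_inverse_Suc:
  "(\<lambda>k. inverse (real (Suc k))) \<longlonglongrightarrow> 0" "filterlim (\<lambda>k. real (Suc k)) at_top sequentially"
  using LIMSEQ_inverse_real_of_nat filterlim_compose[OF filterlim_real_sequentially filterlim_Suc]
  by (auto simp: o_def)

text \<open>The weak divergence is tested with products of cutoffs, one for each hyperplane.  In the
  gradient of the product each hyperplane contributes one term, which tends to zero by \<open>layer_limit\<close>
  because the normal component, extended by zero, does not jump.\<close>

lemma integral_divergence_eq_0_hyperplanes: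
  fixes \<Omega> :: "'a::euclidean_space set" and N :: "('a \<times> real) set"
  assumes \<Omega>: "open \<Omega>" "bounded \<Omega>"
    and N: "finite N" "\<And>a c. (a, c) \<in> N \<Longrightarrow> norm a = 1"
    and dist: "\<And>a c a' c'. (a, c) \<in> N \<Longrightarrow> (a', c') \<in> N \<Longrightarrow> {x. a \<bullet> x = c} = {x. a' \<bullet> x = c'} \<Longrightarrow> (a, c) = (a', c')"
    and fr: "frontier \<Omega> \<subseteq> (\<Union>(a, c)\<in>N. {x. a \<bullet> x = c})"
    and w: "(\<lambda>x. if x \<in> \<Omega> then w x else 0) \<in> borel_measurable borel" "bounded (w ` \<Omega>)"
    and g: "integrable (lebesgue_on \<Omega>) g"
    and wd: "\<And>\<eta>. test_function \<Omega> \<eta> \<Longrightarrow> l2_inner \<Omega> w (gradient \<eta>) = - l2_inner \<Omega> g \<eta>"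
    and jump: "\<And>a c y. (a, c) \<in> N \<Longrightarrow> a \<bullet> y = c \<Longrightarrow> (\<And>a' c'. (a', c') \<in> N - {(a, c)} \<Longrightarrow> a' \<bullet> y \<noteq> c') \<Longrightarrow>
        ((\<lambda>t. (if y + t *\<^sub>R a \<in> \<Omega> then w (y + t *\<^sub>R a) \<bullet> a else 0)
            - (if y - t *\<^sub>R a \<in> \<Omega> then w (y - t *\<^sub>R a) \<bullet> a else 0)) \<longlongrightarrow> 0) (at_right 0)"
  shows "integral\<^sup>L (lebesgue_on \<Omega>) g = 0"
proof -
  obtain \<zeta> \<zeta>' :: "real \<Rightarrow> real" where \<zeta>:
    "\<And>s. (\<zeta> has_real_derivative \<zeta>' s) (at s)" "continuous_on UNIV \<zeta>'"
    "\<And>s. \<zeta>' (- s) = - \<zeta>' s" "\<And>s. \<bar>s\<bar> \<ge> 2 \<Longrightarrow> \<zeta>' s = 0"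
    "\<And>s. \<bar>s\<bar> \<le> 1 \<Longrightarrow> \<zeta> s = 0" "\<And>s. \<bar>s\<bar> \<ge> 2 \<Longrightarrow> \<zeta> s = 1"
    "\<And>s. 0 \<le> \<zeta> s" "\<And>s. \<zeta> s \<le> 1"
    by (rule C1_cutoff_exists, rule that)
  define s where "s p x = fst p \<bullet> x - snd p" for p and x :: 'a
  have c\<zeta>: "continuous_on UNIV \<zeta>"
    using DERIV_isCont[OF \<zeta>(1)] by (simp add: continuous_at_imp_continuous_on)
  have c\<zeta>s: "continuous_on A (\<lambda>x. \<zeta> (r * s p x))" "continuous_on A (\<lambda>x. \<zeta>' (r * s p x))" for A r p
    unfolding s_def by (rule continuous_on_compose2[OF c\<zeta>] continuous_on_compose2[OF \<zeta>(2)],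
        auto intro!: continuous_intros)+
  define Z where "Z k P x = (\<Prod>q\<in>P. \<zeta> (real (Suc k) * s q x))" for k P x
  have cZ: "continuous_on A (Z k P)" for A k P
    unfolding Z_def by (intro continuous_on_prod c\<zeta>s)
  have Z01: "0 \<le> Z k P x" "Z k P x \<le> 1" for k P x
    unfolding Z_def using \<zeta>(7,8) by (auto intro!: prod_nonneg prod_le_1)
  have Z1: "\<forall>\<^sub>F k in sequentially. Z k P (X k) = 1"
    if "finite P" "X \<longlonglongrightarrow> y" "\<And>q. q \<in> P \<Longrightarrow> s q y \<noteq> 0" for P X y
  proof -
    have "\<forall>\<^sub>F k in sequentially. \<forall>q\<in>P. \<zeta> (real (Suc k) * s q (X k)) = 1"
    proof (rule eventually_ball_finite[OF that(1)], rule ballI)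
      fix q assume "q \<in> P"
      have "(\<lambda>k. \<bar>s q (X k)\<bar>) \<longlonglongrightarrow> \<bar>s q y\<bar>"
        unfolding s_def by (intro tendsto_intros that(2))
      from filterlim_tendsto_pos_mult_at_top[OF this _ sequentially_inverse_Suc(2)] that(3)[OF \<open>q \<in> P\<close>]
      have "filterlim (\<lambda>k. \<bar>s q (X k)\<bar> * real (Suc k)) at_top sequentially" by simp
      then have "\<forall>\<^sub>F k in sequentially. 2 \<le> \<bar>s q (X k)\<bar> * real (Suc k)"
        by (simp add: filterlim_at_top)
      then show "\<forall>\<^sub>F k in sequentially. \<zeta> (real (Suc k) * s q (X k)) = 1"
        by eventually_elim (rule \<zeta>(6), simp add: abs_mult mult.commute)
    qed
    then show ?thesis by eventually_elim (simp add: Z_def)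
  qed
  \<comment> \<open>Near the boundary some cutoff vanishes, so extension by zero from the domain
    keeps the product smooth.\<close>
  define \<eta> where "\<eta> k x = (if x \<in> \<Omega> then Z k N x else 0)" for k x
  define G where "G k x = (\<Sum>p\<in>N. (real (Suc k) * \<zeta>' (real (Suc k) * s p x) * Z k (N - {p}) x) *\<^sub>R fst p)" for k x
  have \<eta>: "test_function \<Omega> (\<eta> k)" "\<And>x. x \<in> \<Omega> \<Longrightarrow> gradient (\<eta> k) x = G k x" for k
  proof -
    let ?C = "closure \<Omega> \<inter> (\<Inter>p\<in>N. {x. 1 \<le> \<bar>real (Suc k) * s p x\<bar>})"
    have "closed (\<Inter>p\<in>N. {x. 1 \<le> \<bar>real (Suc k) * s p x\<bar>})"
      unfolding s_def by (intro closed_INT ballI closed_Collect_le continuous_intros)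
    then have "compact ?C"
      using \<Omega>(2) by (intro compact_Int_closed) (auto simp: compact_closure)
    moreover have "?C \<subseteq> \<Omega>"
    proof
      fix x assume x: "x \<in> ?C"
      show "x \<in> \<Omega>"
      proof (rule ccontr)
        assume "x \<notin> \<Omega>"
        with x have "x \<in> frontier \<Omega>" using \<Omega>(1) by (simp add: frontier_def interior_open)
        then obtain a c where "(a, c) \<in> N" "a \<bullet> x = c" using fr by auto
        with x show False by (force simp: s_def)
      qed
    qed
    moreover have "\<eta> k x = 0" if x: "x \<notin> ?C" for x
    proof (cases "x \<in> \<Omega>")
      case True
      then have "x \<in> closure \<Omega>" using closure_subset by auto
      with x obtain p where p: "p \<in> N" "\<bar>real (Suc k) * s p x\<bar> < 1" by (auto simp: not_le)
      then have "\<zeta> (real (Suc k) * s p x) = 0" by (intro \<zeta>(5)) simp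
      then have "Z k N x = 0" unfolding Z_def using p(1) N(1) by (simp add: prod_zero_iff) blast
      then show ?thesis by (simp add: \<eta>_def)
    qed (simp add: \<eta>_def)
    moreover have "(\<eta> k has_derivative (\<lambda>h. G k x \<bullet> h)) (at x)" if x: "x \<in> \<Omega>" for x
    proof -
      have 1: "((\<lambda>x. \<zeta> (real (Suc k) * s p x)) has_derivative
          (\<lambda>h. (real (Suc k) * \<zeta>' (real (Suc k) * s p x)) * (fst p \<bullet> h))) (at x)" for p
      proof -
        have "((\<lambda>x. real (Suc k) * s p x) has_derivative (\<lambda>h. real (Suc k) * (fst p \<bullet> h))) (at x)"
          unfolding s_def by (auto intro!: derivative_eq_intros simp del: of_nat_Suc)
        from diff_chain_at[OF this, of \<zeta>, OF \<zeta>(1)[unfolded has_field_derivative_def]]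
        show ?thesis by (simp add: o_def mult_ac)
      qed
      have "(Z k N has_derivative (\<lambda>h. \<Sum>p\<in>N. (real (Suc k) * \<zeta>' (real (Suc k) * s p x)) * (fst p \<bullet> h)
            * (\<Prod>q\<in>N - {p}. \<zeta> (real (Suc k) * s q x)))) (at x)"
        unfolding Z_def[abs_def] by (rule has_derivative_prod) (rule 1)
      then have "(Z k N has_derivative (\<lambda>h. G k x \<bullet> h)) (at x)"
        unfolding G_def Z_def inner_sum_left inner_scaleR_left by (simp only: mult_ac)
      then show ?thesis
        by (rule has_derivative_transform_within_open[where s = \<Omega>]) (use x \<Omega> in \<open>auto simp: \<eta>_def\<close>)
    qed
    moreover have "continuous_on \<Omega> (G k)"
      unfolding G_def by (intro continuous_intros c\<zeta>s cZ)
    ultimately show "test_function \<Omega> (\<eta> k)" "\<And>x. x \<in> \<Omega> \<Longrightarrow> gradient (\<eta> k) x = G k x"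
      using test_functionI[of \<Omega> "\<eta> k" "G k" ?C] \<Omega>(1) by blast+
  qed
  define f where "f p x = (if x \<in> \<Omega> then w x \<bullet> fst p else 0)" for p :: "'a \<times> real" and x
  define fZ where "fZ p k x = f p x * Z k (N - {p}) x" for p k x
  obtain W where W: "\<And>x. x \<in> \<Omega> \<Longrightarrow> norm (w x) \<le> W"
    using w(2) by (auto simp: bounded_iff)
  obtain R where R: "\<And>x. x \<in> \<Omega> \<Longrightarrow> norm x \<le> R" using \<Omega>(2) by (auto simp: bounded_iff)
  have f_meas: "f p \<in> borel_measurable borel" for p
  proof -
    have "(\<lambda>x. (if x \<in> \<Omega> then w x else 0) \<bullet> fst p) \<in> borel_measurable borel"
      using w(1) by measurable
    then show ?thesis by (rule measurable_cong[THEN iffD1, rotated]) (auto simp: f_def)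
  qed
  have fZ_meas: "fZ p k \<in> borel_measurable borel" for p k
    unfolding fZ_def[abs_def]
    by (rule borel_measurable_times[OF f_meas borel_measurable_continuous_onI[OF cZ]])
  have fZ_bound: "\<bar>fZ p k x\<bar> \<le> \<bar>W\<bar>" if "p \<in> N" for p k x
  proof -
    have "norm (fst p) = 1" using N(2)[of "fst p" "snd p"] that by simp
    then have "\<bar>f p x\<bar> \<le> \<bar>W\<bar>"
      using Cauchy_Schwarz_ineq2[of "w x" "fst p"] W[of x] by (auto simp: f_def)
    moreover have "\<bar>Z k (N - {p}) x\<bar> \<le> 1" using Z01[of k "N - {p}" x] by simp
    ultimately show ?thesis unfolding fZ_def abs_mult
      using mult_mono[of "\<bar>f p x\<bar>" "\<bar>W\<bar>" "\<bar>Z k (N - {p}) x\<bar>" 1] by simp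
  qed
  have fZ_supp: "fZ p k x = 0" if "norm x > R" for p k x
    using R[of x] that by (auto simp: fZ_def f_def)
  obtain T where T: "T \<ge> 0" "\<And>s. norm (\<zeta>' s) \<le> T"
    by (rule continuous_compact_support_bounded[OF \<zeta>(2) compact_Icc[of "-2" 2]]) (use \<zeta>(4) in auto)
  have layer: "(\<lambda>k. real (Suc k) * (\<integral>x. fZ p k x * \<zeta>' (real (Suc k) * s p x) \<partial>lborel)) \<longlonglongrightarrow> 0"
    if p: "p \<in> N" for p
  proof -
    obtain a c where ac: "p = (a, c)" by (cases p)
    have a: "norm a = 1" using N(2) p ac by simp
    have aa: "a \<bullet> a = 1" using a by (simp add: dot_square_norm)
    have "AE x in lborel. \<forall>q\<in>N - {p}. s q (x - (a \<bullet> x - c) *\<^sub>R a) \<noteq> 0"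
    proof (rule AE_finite_allI)
      fix q assume q: "q \<in> N - {p}"
      have "norm (fst q) = 1" using N(2)[of "fst q" "snd q"] q by simp
      moreover have "{x. a \<bullet> x = c} \<noteq> {x. fst q \<bullet> x = snd q}"
        using dist[of a c "fst q" "snd q"] p q ac by auto
      ultimately have "AE x in lborel. fst q \<bullet> (x - (a \<bullet> x - c) *\<^sub>R a) \<noteq> snd q"
        by (intro AE_projection_notin_hyperplane a)
      then show "AE x in lborel. s q (x - (a \<bullet> x - c) *\<^sub>R a) \<noteq> 0" by (simp add: s_def)
    qed (use N(1) in simp)
    moreover have "AE x in lborel. a \<bullet> x \<noteq> c" by (rule AE_notin_hyperplane) (use a in auto)
    ultimately have "AE x in lborel. (\<lambda>k. (fZ p k (x + ((inverse (real (Suc k)) - 1) * (a \<bullet> x - c)) *\<^sub>R a)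
        - fZ p k (x + ((- inverse (real (Suc k)) - 1) * (a \<bullet> x - c)) *\<^sub>R a)) * \<zeta>' (a \<bullet> x - c)) \<longlonglongrightarrow> 0"
    proof eventually_elim
      fix x assume q: "\<forall>q\<in>N - {p}. s q (x - (a \<bullet> x - c) *\<^sub>R a) \<noteq> 0" and "a \<bullet> x \<noteq> c"
      \<comment> \<open>The scaled points are \<open>y + t a\<close> and \<open>y - t a\<close>
        with \<open>t = \<sigma> / k\<close>, where \<open>\<sigma>\<close> may have either sign.\<close>
      define y where "y = x - (a \<bullet> x - c) *\<^sub>R a"
      define \<sigma> where "\<sigma> = a \<bullet> x - c"
      have \<sigma>: "\<sigma> \<noteq> 0" using \<open>a \<bullet> x \<noteq> c\<close> by (simp add: \<sigma>_def)
      have ay: "a \<bullet> y = c" by (simp add: y_def inner_diff_right aa)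
      have M: "x + ((r - 1) * (a \<bullet> x - c)) *\<^sub>R a = y + (r * \<sigma>) *\<^sub>R a" for r
        by (simp add: y_def \<sigma>_def algebra_simps)
      define F where "F t = f p (y + t *\<^sub>R a) - f p (y - t *\<^sub>R a)" for t
      have q': "a' \<bullet> y \<noteq> c'" if "(a', c') \<in> N - {(a, c)}" for a' c'
        using q[unfolded s_def ac, rule_format, OF that] by (simp add: y_def)
      have "(F \<longlongrightarrow> 0) (at_right 0)"
        using jump[OF p[unfolded ac] ay q'] unfolding F_def f_def ac fst_conv .
      moreover from this have "((\<lambda>t. - F t) \<longlongrightarrow> 0) (at_right 0)" using tendsto_minus by fastforce
      then have "(F \<longlongrightarrow> 0) (at_left 0)"
        by (simp add: filterlim_at_left_to_right F_def)
      ultimately have F: "(F \<longlongrightarrow> 0) (at 0)" by (simp add: filterlim_at_split)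
      have lim0: "(\<lambda>k. r * inverse (real (Suc k))) \<longlonglongrightarrow> 0" for r
        using tendsto_mult_left[OF sequentially_inverse_Suc(1), of r] by simp
      have "filterlim (\<lambda>k. \<sigma> * inverse (real (Suc k))) (at 0) sequentially"
        unfolding filterlim_at using lim0[of \<sigma>] \<sigma> by auto
      from filterlim_compose[OF F this]
      have 1: "(\<lambda>k. F (\<sigma> * inverse (real (Suc k))) * \<zeta>' \<sigma>) \<longlonglongrightarrow> 0"
        by (rule tendsto_mult_left_zero)
      have lim: "(\<lambda>k. y + (r * inverse (real (Suc k))) *\<^sub>R a) \<longlonglongrightarrow> y" for r
        using tendsto_add[OF tendsto_const[of y] tendsto_scaleR[OF lim0[of r] tendsto_const[of a]]] by simp
      have ev: "\<forall>\<^sub>F k in sequentially. Z k (N - {p}) (y + (r * inverse (real (Suc k))) *\<^sub>R a) = 1" for r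
        by (rule Z1[OF _ lim]) (use N(1) q y_def in auto)
      from ev[of \<sigma>] ev[of "- \<sigma>"]
      have "\<forall>\<^sub>F k in sequentially. F (\<sigma> * inverse (real (Suc k))) * \<zeta>' \<sigma>
          = (fZ p k (y + (inverse (real (Suc k)) * \<sigma>) *\<^sub>R a) - fZ p k (y + (- inverse (real (Suc k)) * \<sigma>) *\<^sub>R a)) * \<zeta>' \<sigma>"
        by eventually_elim (simp add: F_def fZ_def mult.commute)
      from Lim_transform_eventually[OF 1 this]
      show "(\<lambda>k. (fZ p k (x + ((inverse (real (Suc k)) - 1) * (a \<bullet> x - c)) *\<^sub>R a)
        - fZ p k (x + ((- inverse (real (Suc k)) - 1) * (a \<bullet> x - c)) *\<^sub>R a)) * \<zeta>' (a \<bullet> x - c)) \<longlonglongrightarrow> 0"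
        unfolding M \<sigma>_def .
    qed
    from layer_limit[OF a \<zeta>(2,3,4) fZ_meas fZ_bound[OF p] fZ_supp _ this]
    show ?thesis by (simp add: s_def ac)
  qed
  have "l2_inner \<Omega> w (gradient (\<eta> k))
      = (\<Sum>p\<in>N. real (Suc k) * (\<integral>x. fZ p k x * \<zeta>' (real (Suc k) * s p x) \<partial>lborel))" for k
  proof -
    have meas: "(\<lambda>x. fZ p k x * \<zeta>' (real (Suc k) * s p x)) \<in> borel_measurable borel" for p
      by (rule borel_measurable_times[OF fZ_meas borel_measurable_continuous_onI[OF c\<zeta>s(2)]])
    have int: "integrable lborel (\<lambda>x. fZ p k x * \<zeta>' (real (Suc k) * s p x))" if "p \<in> N" for p
    proof (rule integrable_bounded_support[OF meas, where R = R])
      show "\<bar>fZ p k x * \<zeta>' (real (Suc k) * s p x)\<bar> \<le> \<bar>W\<bar> * T" for x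
        unfolding abs_mult using fZ_bound[OF that] T by (intro mult_mono) auto
    qed (use fZ_supp in simp)
    have eq: "(if x \<in> \<Omega> then w x \<bullet> gradient (\<eta> k) x else 0)
        = (\<Sum>p\<in>N. real (Suc k) * (fZ p k x * \<zeta>' (real (Suc k) * s p x)))" for x
      using \<eta>(2)[of x k] by (auto simp: G_def inner_sum_right fZ_def f_def mult_ac)
    have "l2_inner \<Omega> w (gradient (\<eta> k)) = (\<integral>x. (if x \<in> \<Omega> then w x \<bullet> gradient (\<eta> k) x else 0) \<partial>lborel)"
      unfolding l2_inner_def
      by (rule integral_lebesgue_on_eq_lborel[OF \<Omega>(1)]) (use meas in \<open>simp add: eq del: of_nat_Suc\<close>)
    also have "\<dots> = (\<Sum>p\<in>N. real (Suc k) * (\<integral>x. fZ p k x * \<zeta>' (real (Suc k) * s p x) \<partial>lborel))"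
      unfolding eq using int by (subst Bochner_Integration.integral_sum) auto
    finally show ?thesis .
  qed
  moreover have "(\<lambda>k. \<Sum>p\<in>N. real (Suc k) * (\<integral>x. fZ p k x * \<zeta>' (real (Suc k) * s p x) \<partial>lborel)) \<longlonglongrightarrow> (\<Sum>p\<in>N. 0)"
    by (rule tendsto_sum) (rule layer)
  ultimately have 1: "(\<lambda>k. - l2_inner \<Omega> g (\<eta> k)) \<longlonglongrightarrow> 0" using wd[OF \<eta>(1)] by simp
  have "(\<lambda>k. l2_inner \<Omega> g (\<eta> k)) \<longlonglongrightarrow> integral\<^sup>L (lebesgue_on \<Omega>) g"
    unfolding l2_inner_def
  proof (rule integral_dominated_convergence)
    show "integrable (lebesgue_on \<Omega>) (\<lambda>x. norm (g x))" using g by simp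
    show "AE x in lebesgue_on \<Omega>. (\<lambda>k. g x \<bullet> \<eta> k x) \<longlonglongrightarrow> g x"
    proof -
      have "AE x in lborel. \<forall>q\<in>N. s q x \<noteq> 0"
      proof (rule AE_finite_allI[OF N(1)])
        fix q assume "q \<in> N"
        then have "fst q \<noteq> 0" using N(2)[of "fst q" "snd q"] by auto
        then show "AE x in lborel. s q x \<noteq> 0"
          using AE_notin_hyperplane[of "fst q" "snd q"] by (simp add: s_def)
      qed
      then have "AE x in lebesgue. x \<in> \<Omega> \<longrightarrow> (\<forall>q\<in>N. s q x \<noteq> 0)"
        by (rule AE_mp[OF AE_completion]) auto
      then have "AE x in lebesgue_on \<Omega>. \<forall>q\<in>N. s q x \<noteq> 0"
        using \<Omega>(1) by (simp add: AE_restrict_space_iff)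
      moreover have "AE x in lebesgue_on \<Omega>. x \<in> \<Omega>" by (rule AE_I2) simp
      ultimately show ?thesis
      proof eventually_elim
        fix x assume x: "\<forall>q\<in>N. s q x \<noteq> 0" "x \<in> \<Omega>"
        have "\<forall>\<^sub>F k in sequentially. Z k N x = 1"
          by (rule Z1[OF N(1) tendsto_const]) (use x in auto)
        then have "\<forall>\<^sub>F k in sequentially. g x = g x \<bullet> \<eta> k x"
          by eventually_elim (use x in \<open>simp add: \<eta>_def\<close>)
        from Lim_transform_eventually[OF tendsto_const this]
        show "(\<lambda>k. g x \<bullet> \<eta> k x) \<longlonglongrightarrow> g x" .
      qed
    qed
    show "AE x in lebesgue_on \<Omega>. norm (g x \<bullet> \<eta> k x) \<le> norm (g x)" for k
      using Z01[of k N] by (intro AE_I2) (auto simp: \<eta>_def abs_mult mult_left_le)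
    have "\<eta> k \<in> borel_measurable (lebesgue_on \<Omega>)" for k
    proof -
      have "Z k N \<in> borel_measurable (lebesgue_on \<Omega>)"
        using cZ \<Omega>(1) by (intro continuous_imp_measurable_on_sets_lebesgue) auto
      then show ?thesis by (rule measurable_cong[THEN iffD1, rotated]) (simp add: \<eta>_def)
    qed
    with g show "(\<lambda>x. g x \<bullet> \<eta> k x) \<in> borel_measurable (lebesgue_on \<Omega>)" for k
      by (intro borel_measurable_inner) auto
  qed (use g in simp)
  from tendsto_minus[OF this] 1 show ?thesis using LIMSEQ_unique by fastforce
qed

text \<open>If the jump \<open>J y\<close> were nonzero, test with a bump \<open>\<psi>\<close> around \<open>y\<close> times the profile
  \<open>\<theta> (k (a \<bullet> x - c))\<close>, which concentrates on the hyperplane.  The integral of \<open>w \<bullet> \<nabla>\<eta>\<close> tends to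
  half the integral of \<open>\<psi> J\<close> times \<open>sgn (s) \<theta>' (s) \<le> 0\<close>, which has a constant sign and is not identically
  zero, while the integral of \<open>g \<eta>\<close> tends to zero because the support shrinks to a null set.\<close>

lemma weak_div_normal_continuity:
  fixes \<Omega> :: "'a::euclidean_space set"
  assumes \<Omega>: "open \<Omega>"
    and w: "(\<lambda>x. if x \<in> \<Omega> then w x else 0) \<in> borel_measurable borel" "bounded (w ` \<Omega>)"
    and g: "integrable (lebesgue_on \<Omega>) g"
    and wd: "\<And>\<eta>. test_function \<Omega> \<eta> \<Longrightarrow> l2_inner \<Omega> w (gradient \<eta>) = - l2_inner \<Omega> g \<eta>"
    and r: "r > 0" "ball y r \<subseteq> \<Omega>" and a: "norm a = 1" "a \<bullet> y = c"
    and p: "continuous_on UNIV p" "\<And>x. x \<in> ball y r \<Longrightarrow> a \<bullet> x > c \<Longrightarrow> w x = p x"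
    and q: "continuous_on UNIV q" "\<And>x. x \<in> ball y r \<Longrightarrow> a \<bullet> x < c \<Longrightarrow> w x = q x"
  shows "p y \<bullet> a = q y \<bullet> a"
proof (rule ccontr)
  assume neq: "p y \<bullet> a \<noteq> q y \<bullet> a"
  have aa: "a \<bullet> a = 1" using a by (simp add: dot_square_norm)
  define J where "J x = p x \<bullet> a - q x \<bullet> a" for x
  define \<sigma> where "\<sigma> = sgn (J y)"
  have J: "continuous_on UNIV J" unfolding J_def using p(1) q(1) by (intro continuous_intros)
  have "open {x. 0 < \<sigma> * J x}" by (intro open_Collect_less continuous_intros J)
  moreover have "\<sigma> * J y > 0" using neq by (simp add: \<sigma>_def J_def sgn_if)
  ultimately obtain e where e: "e > 0" "\<And>x. dist x y < e \<Longrightarrow> \<sigma> * J x > 0"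
    by (auto simp: open_dist)
  define \<delta> where "\<delta> = min r e / 2"
  have \<delta>: "\<delta> > 0" "\<delta> < r" "\<delta> < e" using r e by (auto simp: \<delta>_def)
  define \<psi> where "\<psi> x = (max 0 (\<delta>\<^sup>2 - (x - y) \<bullet> (x - y)))\<^sup>2" for x
  define \<psi>' where "\<psi>' x = (- 4 * max 0 (\<delta>\<^sup>2 - (x - y) \<bullet> (x - y))) *\<^sub>R (x - y)" for x
  define \<theta> :: "real \<Rightarrow> real" where "\<theta> s = (max 0 (1 - s\<^sup>2))\<^sup>2" for s
  define \<theta>' :: "real \<Rightarrow> real" where "\<theta>' s = - 4 * s * max 0 (1 - s\<^sup>2)" for s
  have \<psi>_off: "\<psi> x = 0" if "x \<notin> ball y \<delta>" for x
  proof -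
    have "\<delta> \<le> norm (x - y)" using that by (simp add: dist_norm norm_minus_commute)
    then have "\<delta>\<^sup>2 \<le> (norm (x - y))\<^sup>2" using \<delta>(1) by (intro power_mono) auto
    then show ?thesis by (simp add: \<psi>_def power2_norm_eq_inner)
  qed
  have \<psi>'_off: "\<psi>' x = 0" if "x \<notin> ball y \<delta>" for x
    using \<psi>_off[OF that] by (simp add: \<psi>_def \<psi>'_def)
  have \<psi>y: "\<psi> y > 0" using \<delta>(1) by (simp add: \<psi>_def)
  have c\<psi>: "continuous_on UNIV \<psi>" "continuous_on UNIV \<psi>'"
    unfolding \<psi>_def \<psi>'_def by (intro continuous_intros)+
  have c\<theta>: "continuous_on UNIV \<theta>" "continuous_on UNIV \<theta>'"
    unfolding \<theta>_def \<theta>'_def by (intro continuous_intros)+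
  have d\<psi>: "(\<psi> has_derivative (\<lambda>h. \<psi>' x \<bullet> h)) (at x)" for x
  proof -
    have "((\<lambda>x. \<delta>\<^sup>2 - (x - y) \<bullet> (x - y)) has_derivative (\<lambda>h. - (2 * ((x - y) \<bullet> h)))) (at x)"
      by (auto intro!: derivative_eq_intros simp: inner_commute)
    from diff_chain_at[OF this DERIV_max_0_squared[unfolded has_field_derivative_def]]
    show ?thesis unfolding \<psi>_def[abs_def] \<psi>'_def by (simp add: o_def mult_ac)
  qed
  have d\<theta>: "(\<theta> has_real_derivative \<theta>' s) (at s)" for s
  proof -
    have "((\<lambda>s. 1 - s\<^sup>2) has_real_derivative - (2 * s)) (at s)"
      by (auto intro!: derivative_eq_intros)
    from DERIV_chain2[OF DERIV_max_0_squared this] show ?thesis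
      unfolding \<theta>_def[abs_def] \<theta>'_def by (simp add: mult_ac)
  qed
  define s where "s x = a \<bullet> x - c" for x
  have cs: "continuous_on UNIV (\<lambda>x. \<theta> (k * s x))" "continuous_on UNIV (\<lambda>x. \<theta>' (k * s x))" for k
    unfolding s_def by (rule continuous_on_compose2[OF c\<theta>(1)] continuous_on_compose2[OF c\<theta>(2)],
        auto intro!: continuous_intros)+
  define \<eta> where "\<eta> k x = \<psi> x * \<theta> (real (Suc k) * s x)" for k x
  define G where "G k x = \<theta> (real (Suc k) * s x) *\<^sub>R \<psi>' x
      + (real (Suc k) * (\<psi> x * \<theta>' (real (Suc k) * s x))) *\<^sub>R a" for k x
  have sub: "cball y \<delta> \<subseteq> \<Omega>" using r(2) \<delta>(2) by (force simp: subset_iff)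
  have c\<eta>: "continuous_on UNIV (\<eta> k)" for k
    unfolding \<eta>_def by (intro continuous_intros c\<psi> cs)
  have \<eta>: "test_function \<Omega> (\<eta> k)" "\<And>x. x \<in> \<Omega> \<Longrightarrow> gradient (\<eta> k) x = G k x" for k
  proof -
    have "(\<eta> k has_derivative (\<lambda>h. G k x \<bullet> h)) (at x)" for x
    proof -
      have "((\<lambda>x. real (Suc k) * s x) has_derivative (\<lambda>h. real (Suc k) * (a \<bullet> h))) (at x)"
        unfolding s_def by (auto intro!: derivative_eq_intros simp del: of_nat_Suc)
      from diff_chain_at[OF this d\<theta>[unfolded has_field_derivative_def]]
      have "((\<lambda>x. \<theta> (real (Suc k) * s x)) has_derivative
          (\<lambda>h. \<theta>' (real (Suc k) * s x) * (real (Suc k) * (a \<bullet> h)))) (at x)" by (simp add: o_def)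
      from has_derivative_mult[OF d\<psi>[of x] this] show ?thesis
        unfolding \<eta>_def[abs_def] G_def inner_add_left inner_scaleR_left by (simp only: mult_ac add_ac)
    qed
    moreover have "continuous_on UNIV (G k)"
      unfolding G_def by (intro continuous_intros c\<psi> cs)
    ultimately show "test_function \<Omega> (\<eta> k)" "\<And>x. x \<in> \<Omega> \<Longrightarrow> gradient (\<eta> k) x = G k x"
      using test_functionI[of \<Omega> "\<eta> k" "G k" "cball y \<delta>"] \<Omega> sub \<psi>_off
      by (auto simp: \<eta>_def continuous_on_subset not_le)
  qed
  define f where "f x = (if x \<in> \<Omega> then w x \<bullet> a else 0) * \<psi> x" for x
  define A where "A x = (if x \<in> \<Omega> then w x \<bullet> \<psi>' x else 0)" for x
  obtain W where W: "\<And>x. x \<in> \<Omega> \<Longrightarrow> norm (w x) \<le> W"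
    using w(2) by (auto simp: bounded_iff)
  define R where "R = norm y + \<delta>"
  have R: "x \<notin> ball y \<delta>" if "norm x > R" for x
    using norm_triangle_ineq2[of x y] that by (simp add: R_def dist_norm norm_minus_commute)
  obtain P where P: "P \<ge> 0" "\<And>x. norm (\<psi> x) \<le> P"
    by (rule continuous_compact_support_bounded[OF c\<psi>(1) compact_cball[of y \<delta>]]) (use \<psi>_off in auto)
  obtain P' where P': "P' \<ge> 0" "\<And>x. norm (\<psi>' x) \<le> P'"
    by (rule continuous_compact_support_bounded[OF c\<psi>(2) compact_cball[of y \<delta>]]) (use \<psi>'_off in auto)
  have f_meas: "f \<in> borel_measurable borel"
  proof -
    have "(\<lambda>x. ((if x \<in> \<Omega> then w x else 0) \<bullet> a) * \<psi> x) \<in> borel_measurable borel"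
      using w(1) borel_measurable_continuous_onI[OF c\<psi>(1)] by measurable
    then show ?thesis by (rule measurable_cong[THEN iffD1, rotated]) (auto simp: f_def)
  qed
  have A_meas: "A \<in> borel_measurable borel"
  proof -
    have "(\<lambda>x. (if x \<in> \<Omega> then w x else 0) \<bullet> \<psi>' x) \<in> borel_measurable borel"
      using w(1) borel_measurable_continuous_onI[OF c\<psi>(2)] by measurable
    then show ?thesis by (rule measurable_cong[THEN iffD1, rotated]) (auto simp: A_def)
  qed
  have f_bound: "\<bar>f x\<bar> \<le> \<bar>W\<bar> * P" for x
  proof -
    have "\<bar>if x \<in> \<Omega> then w x \<bullet> a else 0\<bar> \<le> \<bar>W\<bar>"
      using Cauchy_Schwarz_ineq2[of "w x" a] W[of x] a(1) by auto
    then show ?thesis unfolding f_def abs_mult using P(2)[of x] by (intro mult_mono) auto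
  qed
  have A_bound: "\<bar>A x\<bar> \<le> \<bar>W\<bar> * P'" for x
  proof (cases "x \<in> \<Omega>")
    case True
    have "\<bar>A x\<bar> \<le> norm (w x) * norm (\<psi>' x)"
      using True Cauchy_Schwarz_ineq2[of "w x" "\<psi>' x"] by (simp add: A_def)
    also have "\<dots> \<le> \<bar>W\<bar> * P'" using W[OF True] P'(2)[of x] by (intro mult_mono) auto
    finally show ?thesis .
  qed (use P' in \<open>simp add: A_def\<close>)
  have f_supp: "f x = 0" if "norm x > R" for x using \<psi>_off[OF R[OF that]] by (simp add: f_def)
  have A_supp: "A x = 0" if "norm x > R" for x using \<psi>'_off[OF R[OF that]] by (simp add: A_def)
  have \<theta>01: "0 \<le> \<theta> t" "\<theta> t \<le> 1" for t
    unfolding \<theta>_def by (auto intro!: power_le_one)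
  have \<theta>_large: "\<theta> t = 0" "\<theta>' t = 0" if "\<bar>t\<bar> \<ge> 1" for t
  proof -
    have "t\<^sup>2 \<ge> 1" using power_mono[of 1 "\<bar>t\<bar>" 2] that by simp
    then show "\<theta> t = 0" "\<theta>' t = 0" by (simp_all add: \<theta>_def \<theta>'_def)
  qed
  obtain T where T: "T \<ge> 0" "\<And>t. norm (\<theta>' t) \<le> T"
    by (rule continuous_compact_support_bounded[OF c\<theta>(2) compact_Icc[of "-1" 1]]) (use \<theta>_large in auto)
  define D where "D x = (\<psi> (x - s x *\<^sub>R a) * J (x - s x *\<^sub>R a)) * (sgn (s x) * \<theta>' (s x))" for x
  have sgn\<theta>': "sgn t * \<theta>' t = - 4 * \<bar>t\<bar> * max 0 (1 - t\<^sup>2)" for t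
    by (simp add: \<theta>'_def sgn_if)
  have cD: "continuous_on UNIV D"
  proof -
    have "continuous_on UNIV (\<lambda>x. \<psi> (x - s x *\<^sub>R a))" "continuous_on UNIV (\<lambda>x. J (x - s x *\<^sub>R a))"
      by (rule continuous_on_compose2[OF c\<psi>(1)] continuous_on_compose2[OF J],
          auto simp: s_def intro!: continuous_intros)+
    then show ?thesis unfolding D_def sgn\<theta>' by (intro continuous_intros) (simp_all add: s_def continuous_intros)
  qed
  have off: "AE x in lborel. s x \<noteq> 0"
  proof -
    have "a \<noteq> 0" using a(1) by auto
    then show ?thesis using AE_notin_hyperplane[of a c] by (simp add: s_def)
  qed
  have "AE x in lborel. (\<lambda>k. (f (x + ((inverse (real (Suc k)) - 1) * (a \<bullet> x - c)) *\<^sub>R a)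
      - f (x + ((- inverse (real (Suc k)) - 1) * (a \<bullet> x - c)) *\<^sub>R a)) * \<theta>' (a \<bullet> x - c)) \<longlonglongrightarrow> D x"
    using off
  proof eventually_elim
    fix x assume sx: "s x \<noteq> 0"
    define z where "z = x - s x *\<^sub>R a"
    have az: "a \<bullet> z = c" by (simp add: z_def s_def inner_diff_right aa)
    have M: "x + ((t - 1) * s x) *\<^sub>R a = z + (t * s x) *\<^sub>R a" for t
      by (simp add: z_def s_def algebra_simps)
    \<comment> \<open>Off the small ball both sides vanish because of \<open>\<psi>\<close>, so
      the one-sided formulas for \<open>f\<close> hold globally.\<close>
    have fp: "f (z + t *\<^sub>R a) = \<psi> (z + t *\<^sub>R a) * (p (z + t *\<^sub>R a) \<bullet> a)" if "t > 0" for t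
    proof (cases "z + t *\<^sub>R a \<in> ball y \<delta>")
      case True
      then have "z + t *\<^sub>R a \<in> ball y r" using \<delta>(2) by auto
      moreover have "a \<bullet> (z + t *\<^sub>R a) > c" using that by (simp add: inner_add_right az aa)
      ultimately show ?thesis using p(2) r(2) by (auto simp: f_def)
    qed (simp add: f_def \<psi>_off)
    have fq: "f (z + t *\<^sub>R a) = \<psi> (z + t *\<^sub>R a) * (q (z + t *\<^sub>R a) \<bullet> a)" if "t < 0" for t
    proof (cases "z + t *\<^sub>R a \<in> ball y \<delta>")
      case True
      then have "z + t *\<^sub>R a \<in> ball y r" using \<delta>(2) by auto
      moreover have "a \<bullet> (z + t *\<^sub>R a) < c" using that by (simp add: inner_add_right az aa)
      ultimately show ?thesis using q(2) r(2) by (auto simp: f_def)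
    qed (simp add: f_def \<psi>_off)
    have lim: "(\<lambda>k. F (z + (t * inverse (real (Suc k))) *\<^sub>R a)) \<longlonglongrightarrow> F z"
      if "continuous_on UNIV F" for t and F :: "'a \<Rightarrow> real"
    proof -
      have "(\<lambda>k. z + (t * inverse (real (Suc k))) *\<^sub>R a) \<longlonglongrightarrow> z + (t * 0) *\<^sub>R a"
        by (intro tendsto_intros sequentially_inverse_Suc(1))
      then show ?thesis
        using that by (intro continuous_on_tendsto_compose[of UNIV F]) auto
    qed
    have cp: "continuous_on UNIV (\<lambda>z. \<psi> z * (p z \<bullet> a))" "continuous_on UNIV (\<lambda>z. \<psi> z * (q z \<bullet> a))"
      by (intro continuous_intros c\<psi> p(1), intro continuous_intros c\<psi> q(1))
    have pos: "(\<lambda>k. f (z + (t * inverse (real (Suc k))) *\<^sub>R a)) \<longlonglongrightarrow> \<psi> z * (p z \<bullet> a)" if "t > 0" for t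
      using lim[OF cp(1), of t] fp that by simp
    have neg: "(\<lambda>k. f (z + (t * inverse (real (Suc k))) *\<^sub>R a)) \<longlonglongrightarrow> \<psi> z * (q z \<bullet> a)" if "t < 0" for t
      using lim[OF cp(2), of t] fq that by (simp add: mult_neg_pos)
    have "(\<lambda>k. f (z + (s x * inverse (real (Suc k))) *\<^sub>R a) - f (z + (- s x * inverse (real (Suc k))) *\<^sub>R a))
        \<longlonglongrightarrow> sgn (s x) * (\<psi> z * J z)"
    proof (cases "s x > 0")
      case True
      from tendsto_diff[OF pos[of "s x"] neg[of "- s x"]] True
      show ?thesis by (simp add: J_def algebra_simps)
    next
      case False
      with sx have "s x < 0" by simp
      with tendsto_diff[OF neg[of "s x"] pos[of "- s x"]]
      show ?thesis by (simp add: J_def algebra_simps)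
    qed
    from tendsto_mult_right[OF this, of "\<theta>' (s x)"]
    show "(\<lambda>k. (f (x + ((inverse (real (Suc k)) - 1) * (a \<bullet> x - c)) *\<^sub>R a)
      - f (x + ((- inverse (real (Suc k)) - 1) * (a \<bullet> x - c)) *\<^sub>R a)) * \<theta>' (a \<bullet> x - c)) \<longlonglongrightarrow> D x"
      unfolding M D_def z_def[symmetric] s_def[symmetric] by (simp add: mult_ac)
  qed
  from layer_limit[OF a(1) c\<theta>(2) _ _ f_meas f_bound f_supp borel_measurable_continuous_onI[OF cD] this] \<theta>_large
  have lim_layer: "(\<lambda>k. real (Suc k) * (\<integral>x. f x * \<theta>' (real (Suc k) * s x) \<partial>lborel)) \<longlonglongrightarrow> 1/2 * (\<integral>x. D x \<partial>lborel)"
    by (simp add: s_def \<theta>'_def)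
  have ev0: "\<forall>\<^sub>F k in sequentially. \<theta> (real (Suc k) * s x) = 0" if "s x \<noteq> 0" for x
  proof -
    have "filterlim (\<lambda>k. \<bar>s x\<bar> * real (Suc k)) at_top sequentially"
      using filterlim_tendsto_pos_mult_at_top[OF tendsto_const _ sequentially_inverse_Suc(2), of "\<bar>s x\<bar>"] that by simp
    then have "\<forall>\<^sub>F k in sequentially. 1 \<le> \<bar>s x\<bar> * real (Suc k)" by (simp add: filterlim_at_top)
    then show ?thesis by eventually_elim (rule \<theta>_large(1), simp add: abs_mult mult.commute)
  qed
  have A\<theta>: "\<bar>A x * \<theta> (real (Suc k) * s x)\<bar> \<le> \<bar>W\<bar> * P'" for k x
    unfolding abs_mult using mult_mono[OF A_bound[of x], of "\<bar>\<theta> (real (Suc k) * s x)\<bar>" 1] \<theta>01[of "real (Suc k) * s x"] P' by simp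
  have A\<theta>_meas: "(\<lambda>x. A x * \<theta> (real (Suc k) * s x)) \<in> borel_measurable borel" for k
    by (rule borel_measurable_times[OF A_meas borel_measurable_continuous_onI[OF cs(1)]])
  have lim_A: "(\<lambda>k. \<integral>x. A x * \<theta> (real (Suc k) * s x) \<partial>lborel) \<longlonglongrightarrow> (\<integral>x. 0 \<partial>(lborel :: 'a measure))"
  proof (rule integral_dominated_convergence)
    show "integrable lborel (\<lambda>x. (\<bar>W\<bar> * P') * indicator (cball 0 R) x)" by (rule integrable_cball_indicator)
    show "AE x in lborel. (\<lambda>k. A x * \<theta> (real (Suc k) * s x)) \<longlonglongrightarrow> 0"
      using off
    proof eventually_elim
      fix x assume "s x \<noteq> 0"
      from ev0[OF this] have "\<forall>\<^sub>F k in sequentially. 0 = A x * \<theta> (real (Suc k) * s x)"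
        by eventually_elim simp
      from Lim_transform_eventually[OF tendsto_const this]
      show "(\<lambda>k. A x * \<theta> (real (Suc k) * s x)) \<longlonglongrightarrow> 0" .
    qed
    show "AE x in lborel. norm (A x * \<theta> (real (Suc k) * s x)) \<le> (\<bar>W\<bar> * P') * indicator (cball 0 R) x" for k
    proof (intro AE_I2)
      fix x show "norm (A x * \<theta> (real (Suc k) * s x)) \<le> (\<bar>W\<bar> * P') * indicator (cball 0 R) x"
        using A\<theta>[of x k] A_supp[of x] by (cases "norm x > R") (auto simp del: of_nat_Suc)
    qed
    show "(\<lambda>x. A x * \<theta> (real (Suc k) * s x)) \<in> borel_measurable lborel" for k using A\<theta>_meas by simp
  qed simp
  have split: "l2_inner \<Omega> w (gradient (\<eta> k)) = (\<integral>x. A x * \<theta> (real (Suc k) * s x) \<partial>lborel)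
      + real (Suc k) * (\<integral>x. f x * \<theta>' (real (Suc k) * s x) \<partial>lborel)" for k
  proof -
    have f\<theta>_meas: "(\<lambda>x. f x * \<theta>' (real (Suc k) * s x)) \<in> borel_measurable borel"
      by (rule borel_measurable_times[OF f_meas borel_measurable_continuous_onI[OF cs(2)]])
    have i1: "integrable lborel (\<lambda>x. A x * \<theta> (real (Suc k) * s x))"
      by (rule integrable_bounded_support[OF A\<theta>_meas A\<theta>, where R = R]) (simp add: A_supp)
    have i2: "integrable lborel (\<lambda>x. f x * \<theta>' (real (Suc k) * s x))"
    proof (rule integrable_bounded_support[OF f\<theta>_meas, where R = R])
      show "\<bar>f x * \<theta>' (real (Suc k) * s x)\<bar> \<le> (\<bar>W\<bar> * P) * T" for x
        unfolding abs_mult using f_bound T P by (intro mult_mono) auto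
    qed (simp add: f_supp)
    have eq: "(if x \<in> \<Omega> then w x \<bullet> gradient (\<eta> k) x else 0)
        = A x * \<theta> (real (Suc k) * s x) + real (Suc k) * (f x * \<theta>' (real (Suc k) * s x))" for x
      using \<eta>(2)[of x k] by (simp add: G_def A_def f_def inner_add_right mult_ac del: of_nat_Suc)
    have "l2_inner \<Omega> w (gradient (\<eta> k)) = (\<integral>x. (if x \<in> \<Omega> then w x \<bullet> gradient (\<eta> k) x else 0) \<partial>lborel)"
      unfolding l2_inner_def
      by (rule integral_lebesgue_on_eq_lborel[OF \<Omega>])
        (use A\<theta>_meas[of k] f\<theta>_meas in \<open>simp add: eq del: of_nat_Suc\<close>)
    also have "\<dots> = (\<integral>x. A x * \<theta> (real (Suc k) * s x) \<partial>lborel)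
      + real (Suc k) * (\<integral>x. f x * \<theta>' (real (Suc k) * s x) \<partial>lborel)"
      unfolding eq using i1 i2 by (simp del: of_nat_Suc)
    finally show ?thesis .
  qed
  have "(\<lambda>k. l2_inner \<Omega> w (gradient (\<eta> k))) \<longlonglongrightarrow> 0 + 1/2 * (\<integral>x. D x \<partial>lborel)"
    unfolding split using lim_A by (intro tendsto_add lim_layer) simp
  then have 1: "(\<lambda>k. - l2_inner \<Omega> g (\<eta> k)) \<longlonglongrightarrow> 1/2 * (\<integral>x. D x \<partial>lborel)"
    unfolding wd[OF \<eta>(1)] by simp
  have "(\<lambda>k. l2_inner \<Omega> g (\<eta> k)) \<longlonglongrightarrow> (\<integral>x. 0 \<partial>lebesgue_on \<Omega>)"
    unfolding l2_inner_def
  proof (rule integral_dominated_convergence)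
    show "integrable (lebesgue_on \<Omega>) (\<lambda>x. P * norm (g x))" using g by simp
    have "AE x in lebesgue. x \<in> \<Omega> \<longrightarrow> s x \<noteq> 0" by (rule AE_mp[OF AE_completion[OF off]]) auto
    then have "AE x in lebesgue_on \<Omega>. s x \<noteq> 0" using \<Omega> by (simp add: AE_restrict_space_iff)
    then show "AE x in lebesgue_on \<Omega>. (\<lambda>k. g x \<bullet> \<eta> k x) \<longlonglongrightarrow> 0"
    proof eventually_elim
      fix x assume "s x \<noteq> 0"
      from ev0[OF this] have "\<forall>\<^sub>F k in sequentially. 0 = g x \<bullet> \<eta> k x"
        by eventually_elim (simp add: \<eta>_def)
      from Lim_transform_eventually[OF tendsto_const this]
      show "(\<lambda>k. g x \<bullet> \<eta> k x) \<longlonglongrightarrow> 0" .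
    qed
    show "AE x in lebesgue_on \<Omega>. norm (g x \<bullet> \<eta> k x) \<le> P * norm (g x)" for k
    proof (intro AE_I2)
      fix x
      have "\<bar>\<eta> k x\<bar> \<le> P * 1"
        unfolding \<eta>_def abs_mult using P \<theta>01[of "real (Suc k) * s x"] by (intro mult_mono) auto
      then show "norm (g x \<bullet> \<eta> k x) \<le> P * norm (g x)"
        using mult_left_mono[of "\<bar>\<eta> k x\<bar>" P "\<bar>g x\<bar>"] by (simp add: abs_mult mult.commute)
    qed
    have "\<eta> k \<in> borel_measurable (lebesgue_on \<Omega>)" for k
      using \<Omega> by (intro continuous_imp_measurable_on_sets_lebesgue continuous_on_subset[OF c\<eta>]) auto
    with g show "(\<lambda>x. g x \<bullet> \<eta> k x) \<in> borel_measurable (lebesgue_on \<Omega>)" for k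
      by (intro borel_measurable_inner) auto
  qed simp
  then have "(\<lambda>k. - l2_inner \<Omega> g (\<eta> k)) \<longlonglongrightarrow> 0" using tendsto_minus by fastforce
  with 1 have intD: "(\<integral>x. D x \<partial>lborel) = 0" using LIMSEQ_unique by fastforce
  have D_sign: "- (\<sigma> * D x) \<ge> 0" for x
  proof (cases "x - s x *\<^sub>R a \<in> ball y \<delta>")
    case True
    then have "\<sigma> * J (x - s x *\<^sub>R a) > 0" using e(2)[of "x - s x *\<^sub>R a"] \<delta>(3) by (simp add: dist_commute)
    moreover have "\<psi> (x - s x *\<^sub>R a) \<ge> 0" by (simp add: \<psi>_def)
    moreover have "- (\<sigma> * D x) = (\<sigma> * J (x - s x *\<^sub>R a)) * \<psi> (x - s x *\<^sub>R a) * (4 * \<bar>s x\<bar> * max 0 (1 - (s x)\<^sup>2))"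
      by (simp add: D_def sgn\<theta>')
    ultimately show ?thesis by (simp add: mult_nonneg_nonneg)
  qed (simp add: D_def \<psi>_off)
  have D_supp: "D x = 0" if "norm x > R + 1" for x
  proof (cases "\<bar>s x\<bar> \<ge> 1")
    case False
    have "norm x \<le> norm (x - s x *\<^sub>R a) + \<bar>s x\<bar>"
      using norm_triangle_ineq[of "x - s x *\<^sub>R a" "s x *\<^sub>R a"] a(1) by simp
    then have "norm (x - s x *\<^sub>R a) > R" using False that by linarith
    then show ?thesis using \<psi>_off[OF R] by (simp add: D_def)
  qed (simp add: D_def \<theta>_large)
  obtain B where B: "\<And>x. norm (D x) \<le> B"
    by (rule continuous_compact_support_bounded[OF cD compact_cball[of 0 "R + 1"]]) (use D_supp in auto)
  have "integrable lborel D"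
    by (rule integrable_bounded_support[OF borel_measurable_continuous_onI[OF cD]]) (use B D_supp in auto)
  then have "AE x in lborel. - (\<sigma> * D x) = 0"
    using integral_nonneg_eq_0_iff_AE[of lborel "\<lambda>x. - (\<sigma> * D x)"] D_sign intD by simp
  moreover have "\<sigma> \<noteq> 0" using neq by (simp add: \<sigma>_def J_def sgn_if)
  ultimately have "AE x in lborel. D x = 0" by simp
  then have "{x. D x \<noteq> 0} \<in> null_sets lborel"
    using AE_iff_null[of lborel "\<lambda>x. D x = 0"] borel_measurable_continuous_onI[OF cD] by simp
  then have "negligible {x. D x \<noteq> 0}"
    by (simp add: negligible_iff_null_sets null_sets_completionI)
  moreover have "open {x. D x \<noteq> 0}" using cD by (intro open_Collect_neq continuous_intros)
  ultimately have "D x = 0" for x using open_not_negligible by blast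
  moreover have "D (y + (1/2) *\<^sub>R a) \<noteq> 0"
  proof -
    have "s (y + (1/2) *\<^sub>R a) = 1/2" by (simp add: s_def inner_add_right a(2) aa)
    then have "D (y + (1/2) *\<^sub>R a) = (\<psi> y * J y) * (sgn (1/2) * \<theta>' (1/2))"
      unfolding D_def by (simp only: add_diff_cancel_right')
    moreover have "\<theta>' (1/2) \<noteq> 0" by (simp add: \<theta>'_def power2_eq_square)
    ultimately show ?thesis using \<psi>y neq by (simp add: J_def)
  qed
  ultimately show False by blast
qed


section \<open>The mesh near a generic point of a facet hyperplane\<close>

text \<open>A point of the closure outside \<open>\<Omega>\<close> is on the boundary, where it can be moved in the graph
  direction into an open set that does not meet \<open>\<Omega>\<close>.  This excludes cracks, and it makes \<open>\<Omega>\<close> the interior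
  of the union of the cells.\<close>

lemma interior_closure_lipschitz_domain:
  assumes "bounded_lipschitz_domain \<Omega>"
  shows "interior (closure \<Omega>) = \<Omega>"
proof
  show "\<Omega> \<subseteq> interior (closure \<Omega>)"
    using assms by (intro interior_maximal closure_subset) (simp add: bounded_lipschitz_domain_def)
  show "interior (closure \<Omega>) \<subseteq> \<Omega>"
  proof
    fix x assume x: "x \<in> interior (closure \<Omega>)"
    show "x \<in> \<Omega>"
    proof (rule ccontr)
      assume nx: "x \<notin> \<Omega>"
      have "x \<in> frontier \<Omega>"
        using x nx interior_subset[of \<Omega>] interior_subset[of "closure \<Omega>"] by (auto simp: frontier_def)
      then obtain e r L and g :: "'a \<Rightarrow> real" where e: "norm e = 1" and r: "r > 0"
        and g: "L-lipschitz_on UNIV g"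
        and loc: "\<And>y. y \<in> ball x r \<Longrightarrow> y \<in> \<Omega> \<longleftrightarrow> y \<bullet> e < g (y - (y \<bullet> e) *\<^sub>R e)"
        using assms unfolding bounded_lipschitz_domain_def lipschitz_boundary_def by blast
      have ee: "e \<bullet> e = 1" using e by (simp add: dot_square_norm)
      have cg: "continuous_on UNIV g" using g by (rule lipschitz_on_continuous_on)
      define U where "U = ball x r \<inter> {y. g (y - (y \<bullet> e) *\<^sub>R e) < y \<bullet> e}"
      have "open {y. g (y - (y \<bullet> e) *\<^sub>R e) < y \<bullet> e}"
        by (intro open_Collect_less continuous_on_compose2[OF cg] continuous_intros) auto
      then have "open U" unfolding U_def by (intro open_Int) auto
      moreover have "U \<inter> \<Omega> = {}" using loc by (auto simp: U_def)
      ultimately have U: "U \<inter> closure \<Omega> = {}" by (simp add: open_Int_closure_eq_empty)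
      obtain s where s: "s > 0" "ball x s \<subseteq> closure \<Omega>"
        using x open_contains_ball[of "interior (closure \<Omega>)"] interior_subset by (meson open_interior order_trans)
      define t where "t = min r s / 2"
      have t: "t > 0" "t < r" "t < s" using r s by (auto simp: t_def)
      let ?y = "x + t *\<^sub>R e"
      have eq: "?y - (?y \<bullet> e) *\<^sub>R e = x - (x \<bullet> e) *\<^sub>R e"
        by (simp add: inner_add_left ee algebra_simps)
      have "g (x - (x \<bullet> e) *\<^sub>R e) \<le> x \<bullet> e" using loc[of x] nx r by (simp add: not_less)
      then have "g (?y - (?y \<bullet> e) *\<^sub>R e) < ?y \<bullet> e"
        unfolding eq using t by (simp add: inner_add_left ee)
      moreover have "?y \<in> ball x r" using t e by (simp add: dist_norm)
      ultimately have "?y \<in> U" unfolding U_def by blast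
      moreover have "?y \<in> closure \<Omega>" using s(2) t e by (auto simp: dist_norm subset_iff)
      ultimately show False using U by blast
    qed
  qed
qed

lemma hyperplane_unit_normal:
  fixes a :: "'a::euclidean_space"
  assumes "a \<noteq> 0"
  obtains a' c' where "norm a' = 1" "{x. a \<bullet> x = c} = {x. a' \<bullet> x = c'}"
proof
  show "norm (a /\<^sub>R norm a) = 1" using assms by simp
  show "{x. a \<bullet> x = c} = {x. (a /\<^sub>R norm a) \<bullet> x = c / norm a}"
    using assms by (auto simp: field_simps)
qed

lemma polytope_frontier_hyperplanes:
  assumes "polytope (K :: 'a::euclidean_space set)"
  obtains \<H> where "finite \<H>" "frontier K \<subseteq> \<Union>\<H>"
    "\<And>H. H \<in> \<H> \<Longrightarrow> \<exists>a c. norm a = 1 \<and> H = {x. a \<bullet> x = c}"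
proof -
  obtain F where F: "finite F" "K = \<Inter>F" "\<And>h. h \<in> F \<Longrightarrow> \<exists>a b. a \<noteq> 0 \<and> h = {x. a \<bullet> x \<le> b}"
    using polytope_imp_polyhedron[OF assms] unfolding polyhedron_def by metis
  have 1: "frontier K \<subseteq> \<Union>(frontier ` F)"
  proof
    fix x assume x: "x \<in> frontier K"
    have "closed K" using assms polytope_imp_closed by blast
    then have "x \<in> K" "x \<notin> interior K" using x by (auto simp: frontier_def)
    moreover have "(\<Inter>h\<in>F. interior h) \<subseteq> interior K"
      by (rule interior_maximal) (use F(1,2) interior_subset in \<open>auto intro!: open_INT\<close>)
    ultimately obtain h where "h \<in> F" "x \<in> h" "x \<notin> interior h" using F(2) by auto
    then show "x \<in> \<Union>(frontier ` F)" using closure_subset by (auto simp: frontier_def)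
  qed
  have 2: "\<exists>a c. norm a = 1 \<and> H = {x. a \<bullet> x = c}" if H: "H \<in> frontier ` F" for H
  proof -
    obtain a b where ab: "a \<noteq> 0" "H = frontier {x. a \<bullet> x \<le> b}" using F(3) H by blast
    then have "H = {x. a \<bullet> x = b}" by (simp add: frontier_halfspace_le)
    then show ?thesis using hyperplane_unit_normal[OF ab(1), of b] by metis
  qed
  show thesis by (rule that[OF _ 1 2]) (use F(1) in auto)
qed

text \<open>Normal vectors are chosen once for each hyperplane, so that distinct pairs of a normal and an
  offset describe distinct hyperplanes; if a hyperplane occurred twice, the cutoff for one copy would
  vanish near the other, and \<open>integral_divergence_eq_0_hyperplanes\<close> could not treat them separately.\<close>

lemma mesh_hyperplanes:
  fixes \<T> :: "'a::euclidean_space set set"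
  assumes "conforming_mesh \<Omega> \<T>"
  obtains N :: "('a \<times> real) set" where "finite N" "\<And>a c. (a, c) \<in> N \<Longrightarrow> norm a = 1"
    "\<And>a c a' c'. (a, c) \<in> N \<Longrightarrow> (a', c') \<in> N \<Longrightarrow> {x. a \<bullet> x = c} = {x. a' \<bullet> x = c'} \<Longrightarrow> (a, c) = (a', c')"
    "\<And>K. K \<in> \<T> \<Longrightarrow> frontier K \<subseteq> (\<Union>(a, c)\<in>N. {x. a \<bullet> x = c})"
proof -
  have "\<forall>K\<in>\<T>. \<exists>\<H>. finite \<H> \<and> frontier K \<subseteq> \<Union>\<H> \<and>
      (\<forall>H\<in>\<H>. \<exists>a c. norm a = 1 \<and> H = {x. a \<bullet> x = c})"
    using assms polytope_frontier_hyperplanes unfolding conforming_mesh_def by metis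
  then obtain \<H> where \<H>: "\<And>K. K \<in> \<T> \<Longrightarrow> finite (\<H> K)" "\<And>K. K \<in> \<T> \<Longrightarrow> frontier K \<subseteq> \<Union>(\<H> K)"
    "\<And>K H. K \<in> \<T> \<Longrightarrow> H \<in> \<H> K \<Longrightarrow> \<exists>a c. norm a = 1 \<and> H = {x. a \<bullet> x = c}" by metis
  define HH where "HH = (\<Union>K\<in>\<T>. \<H> K)"
  have "\<forall>H\<in>HH. \<exists>p. norm (fst p) = 1 \<and> H = {x. fst p \<bullet> x = snd p}"
    using \<H>(3) unfolding HH_def by fastforce
  then obtain n where n: "\<And>H. H \<in> HH \<Longrightarrow> norm (fst (n H)) = 1"
    "\<And>H. H \<in> HH \<Longrightarrow> {x. fst (n H) \<bullet> x = snd (n H)} = H" by metis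
  show thesis
  proof (rule that[of "n ` HH"])
    show "finite (n ` HH)" using assms \<H>(1) by (auto simp: HH_def conforming_mesh_def)
    show "norm a = 1" if "(a, c) \<in> n ` HH" for a c using that n(1) by (metis fst_conv imageE)
    show "(a, c) = (a', c')" if m: "(a, c) \<in> n ` HH" "(a', c') \<in> n ` HH" "{x. a \<bullet> x = c} = {x. a' \<bullet> x = c'}" for a c a' c'
    proof -
      obtain H where H1: "H \<in> HH" "(a, c) = n H" using m(1) by (elim imageE)
      obtain H' where H2: "H' \<in> HH" "(a', c') = n H'" using m(2) by (elim imageE)
      note H = H1 H2
      have "{x. a \<bullet> x = c} = H" "{x. a' \<bullet> x = c'} = H'"
        using n(2)[OF H(1)] n(2)[OF H(3)] by (simp_all add: H(2)[symmetric] H(4)[symmetric])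
      then show ?thesis using H m(3) by simp
    qed
    show "frontier K \<subseteq> (\<Union>(a, c)\<in>n ` HH. {x. a \<bullet> x = c})" if K: "K \<in> \<T>" for K
    proof
      fix x assume "x \<in> frontier K"
      then obtain H where H: "H \<in> HH" "x \<in> H" using \<H>(2)[OF K] K unfolding HH_def by blast
      then have "fst (n H) \<bullet> x = snd (n H)" using n(2)[OF H(1)] by blast
      then show "x \<in> (\<Union>(a, c)\<in>n ` HH. {x. a \<bullet> x = c})" using H(1) by (force simp: case_prod_beta)
    qed
  qed
qed

lemma mesh_interior_subset:
  assumes "bounded_lipschitz_domain \<Omega>" "conforming_mesh \<Omega> \<T>" "K \<in> \<T>"
  shows "interior K \<subseteq> \<Omega>" "K \<subseteq> closure \<Omega>" "\<Omega> \<subseteq> \<Union>\<T>"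
proof -
  show 1: "K \<subseteq> closure \<Omega>" using assms(2,3) by (auto simp: conforming_mesh_def)
  show "interior K \<subseteq> \<Omega>"
    using interior_mono[OF 1] interior_closure_lipschitz_domain[OF assms(1)] by simp
  show "\<Omega> \<subseteq> \<Union>\<T>" using assms(2) closure_subset by (auto simp: conforming_mesh_def)
qed

definition half_ball :: "'a::euclidean_space \<Rightarrow> real \<Rightarrow> 'a \<Rightarrow> 'a set" where
  "half_ball y r b = {x \<in> ball y r. 0 < (x - y) \<bullet> b}"

lemma half_ball_ray:
  assumes "norm b = 1" "0 < t" "t < r"
  shows "y + t *\<^sub>R b \<in> half_ball y r b"
  using assms by (simp add: half_ball_def dist_norm dot_square_norm)

lemma open_half_ball: "open (half_ball y r b)"
proof -
  have "half_ball y r b = ball y r \<inter> {x. 0 < (x - y) \<bullet> b}" by (auto simp: half_ball_def)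
  then show ?thesis by (auto intro!: open_Int open_Collect_less continuous_intros)
qed

lemma convex_half_ball: "convex (half_ball y r b)"
proof -
  have "half_ball y r b = ball y r \<inter> {x. b \<bullet> x > b \<bullet> y}"
    by (auto simp: half_ball_def inner_diff_left inner_commute[of b])
  then show ?thesis by (simp add: convex_Int convex_halfspace_gt)
qed

lemma open_meets_half_ball:
  assumes U: "open U" "z \<in> U" "z \<in> ball y r" "(z - y) \<bullet> b \<ge> 0" and b: "norm b = 1"
  shows "U \<inter> half_ball y r b \<noteq> {}"
proof -
  have "open (U \<inter> ball y r)" using U by (intro open_Int) auto
  then obtain e where e: "e > 0" "ball z e \<subseteq> U \<inter> ball y r" using U by (auto elim: openE)
  let ?x = "z + (e / 2) *\<^sub>R b"
  have "?x \<in> ball z e" using e b by (simp add: dist_norm)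
  moreover have "(?x - y) \<bullet> b > 0"
    using U(4) e b by (simp add: inner_add_left inner_diff_left dot_square_norm)
  moreover have "?x \<in> U \<inter> ball y r" using e(2) \<open>?x \<in> ball z e\<close> by blast
  ultimately have "?x \<in> U \<inter> half_ball y r b" unfolding half_ball_def by blast
  then show ?thesis by blast
qed

text \<open>The half ball is connected and does not meet the frontier of the cell.\<close>

lemma half_ball_in_or_out:
  assumes fr: "frontier K \<subseteq> (\<Union>(a, c)\<in>N. {x. a \<bullet> x = c})"
    and N: "\<And>a' c'. (a', c') \<in> N - {(a, c)} \<Longrightarrow> ball y r \<inter> {x. a' \<bullet> x = c'} = {}"
    and b: "b = a \<or> b = - a" "a \<bullet> y = c"
  shows "half_ball y r b \<subseteq> interior K \<or> half_ball y r b \<inter> K = {}"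
proof -
  have off: "half_ball y r b \<inter> frontier K = {}"
  proof (rule equals0I)
    fix x assume x: "x \<in> half_ball y r b \<inter> frontier K"
    then obtain a' c' where ac: "(a', c') \<in> N" "a' \<bullet> x = c'" using fr by auto
    have "(x - y) \<bullet> b \<noteq> 0" "x \<in> ball y r" using x by (auto simp: half_ball_def)
    moreover have "(a', c') = (a, c)"
    proof (rule ccontr)
      assume "(a', c') \<noteq> (a, c)"
      then have "ball y r \<inter> {x. a' \<bullet> x = c'} = {}" using N ac(1) by blast
      then show False using ac(2) \<open>x \<in> ball y r\<close> by blast
    qed
    ultimately show False using ac(2) b by (auto simp: inner_diff_left inner_diff_right inner_commute)
  qed
  have "half_ball y r b \<inter> K = {} \<or> half_ball y r b \<subseteq> K"
    using connected_Int_frontier[OF convex_connected[OF convex_half_ball], of y r b K] off by blast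
  then show ?thesis using interior_maximal[OF _ open_half_ball] by blast
qed

text \<open>The trace condition of the discrete space is imposed only on facets that lie entirely in the
  boundary, so a facet through a boundary point must be shown to be of this kind.  If some point of
  the facet were inside \<open>\<Omega>\<close>, a second cell would contain a point of the relative interior of the facet,
  hence the whole facet because the mesh is face-to-face, and thus \<open>y\<close>.  Near \<open>y\<close> there is room only
  for the first cell, so both cells have a common interior point and coincide.\<close>

lemma boundary_facet_of_cell:
  fixes \<Omega> :: "'a::euclidean_space set"
  assumes \<Omega>: "bounded_lipschitz_domain \<Omega>" and mesh: "conforming_mesh \<Omega> \<T>"
    and K: "K \<in> \<T>" "half_ball y r b \<subseteq> interior K" and out: "half_ball y r (- b) \<inter> \<Omega> = {}"
    and side: "\<And>K'. K' \<in> \<T> \<Longrightarrow> half_ball y r b \<subseteq> interior K' \<or> half_ball y r b \<inter> K' = {}"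
    and b: "norm b = 1" and r: "r > 0" and y: "y \<in> K" "y \<notin> \<Omega>"
  obtains G where "G facet_of K" "y \<in> G" "G \<subseteq> frontier \<Omega>"
proof -
  have op: "open \<Omega>" using \<Omega> by (simp add: bounded_lipschitz_domain_def)
  have poly: "polytope K'" "interior K' \<noteq> {}" "closed K'" "convex K'" if "K' \<in> \<T>" for K'
    using mesh that polytope_imp_closed polytope_imp_convex by (auto simp: conforming_mesh_def)
  note int = mesh_interior_subset[OF \<Omega> mesh]
  have "y \<notin> interior K" using int(1)[OF K(1)] y(2) by auto
  then have "y \<in> K - rel_interior K"
    using y(1) rel_interior_nonempty_interior[OF poly(2)[OF K(1)]] by simp
  then obtain G where G: "G facet_of K" "y \<in> G"
    using rel_boundary_of_polyhedron[OF polytope_imp_polyhedron[OF poly(1)[OF K(1)]]] by auto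
  have "G \<subseteq> frontier \<Omega>"
  proof
    fix z0 assume z0: "z0 \<in> G"
    have GK: "G \<subseteq> K" "G face_of K" "G \<noteq> K" "convex G"
      using facet_of_imp_subset[OF G(1)] facet_of_imp_face_of[OF G(1)] G(1)
        face_of_imp_convex[OF facet_of_imp_face_of[OF G(1)]] by auto
    show "z0 \<in> frontier \<Omega>"
    proof (rule ccontr)
      assume "z0 \<notin> frontier \<Omega>"
      moreover have "z0 \<in> closure \<Omega>" using z0 GK(1) int(2)[OF K(1)] by auto
      ultimately have "z0 \<in> \<Omega>" using op by (simp add: frontier_def interior_open)
      moreover have "z0 \<in> closure (rel_interior G)"
        using z0 closure_subset convex_closure_rel_interior[OF GK(4)] by blast
      ultimately have "\<Omega> \<inter> rel_interior G \<noteq> {}"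
        using open_Int_closure_eq_empty[OF op] by blast
      then obtain z where z: "z \<in> rel_interior G" "z \<in> \<Omega>" by auto
      have zG: "z \<in> G" using z(1) rel_interior_subset by auto
      have "z \<notin> interior K" using face_of_disjoint_interior[OF GK(2,3)] zG by auto
      then have "z \<in> closure (- K)" by (simp add: closure_complement)
      then have "z \<in> closure (\<Omega> \<inter> - K)" using z(2) open_Int_closure_subset[OF op] by blast
      moreover have "closed (\<Union>(\<T> - {K}))"
        using mesh poly(3) by (intro closed_Union) (auto simp: conforming_mesh_def)
      moreover have "\<Omega> \<inter> - K \<subseteq> \<Union>(\<T> - {K})" using int(3)[OF K(1)] by auto
      ultimately have "z \<in> \<Union>(\<T> - {K})" using closure_minimal by blast
      then obtain K' where K': "K' \<in> \<T>" "K' \<noteq> K" "z \<in> K'" by auto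
      have faces: "(K \<inter> K') face_of K" "(K \<inter> K') face_of K'"
        using mesh K(1) K'(1) by (auto simp: conforming_mesh_def)
      have "G \<subseteq> K \<inter> K'"
        by (rule subset_of_face_of[OF faces(1) GK(1)]) (use z zG GK(1) K'(3) in auto)
      then have "y \<in> K'" using G(2) by auto
      then have "y \<in> closure (interior K')"
        using convex_closure_interior[OF poly(4,2)[OF K'(1)]] closure_subset by blast
      then have "ball y r \<inter> interior K' \<noteq> {}"
        using open_Int_closure_eq_empty[of "ball y r" "interior K'"] centre_in_ball[of y r] r by blast
      then obtain u where u: "u \<in> ball y r" "u \<in> interior K'" by auto
      have "u \<notin> half_ball y r (- b)" using out int(1)[OF K'(1)] u(2) by auto
      then have "(u - y) \<bullet> b \<ge> 0" using u(1) by (auto simp: half_ball_def)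
      then have "interior K' \<inter> half_ball y r b \<noteq> {}"
        by (intro open_meets_half_ball[OF _ u(2,1)] b) auto
      then have meet: "interior K' \<inter> interior K \<noteq> {}" using K(2) by auto
      have "K \<inter> K' = K"
        using face_of_disjoint_interior[OF faces(1)] meet interior_subset by blast
      moreover have "K \<inter> K' = K'"
        using face_of_disjoint_interior[OF faces(2)] meet interior_subset by blast
      ultimately show False using K'(2) by auto
    qed
  qed
  with G that show thesis by blast
qed

text \<open>At a point that lies on exactly one of the hyperplanes there are three possibilities: both
  sides belong to cells, and then the point is interior; neither side does; or one does, and then the
  domain is locally a half ball and has an outward normal.\<close>

lemma mesh_local_cases:
  fixes \<Omega> :: "'a::euclidean_space set"
  assumes \<Omega>: "bounded_lipschitz_domain \<Omega>" and mesh: "conforming_mesh \<Omega> \<T>"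
    and N: "finite N" "(a, c) \<in> N" "norm a = 1"
    and fr: "\<And>K. K \<in> \<T> \<Longrightarrow> frontier K \<subseteq> (\<Union>(a, c)\<in>N. {x. a \<bullet> x = c})"
    and y: "a \<bullet> y = c" "\<And>a' c'. (a', c') \<in> N - {(a, c)} \<Longrightarrow> a' \<bullet> y \<noteq> c'"
  obtains (inner) r K K' where "r > 0" "ball y r \<subseteq> \<Omega>" "K \<in> \<T>" "half_ball y r a \<subseteq> interior K"
      "K' \<in> \<T>" "half_ball y r (- a) \<subseteq> interior K'"
  | (outer) r where "r > 0" "half_ball y r a \<inter> \<Omega> = {}" "half_ball y r (- a) \<inter> \<Omega> = {}"
  | (boundary) r b K G where "r > 0" "b = a \<or> b = - a" "K \<in> \<T>" "half_ball y r b \<subseteq> interior K"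
      "half_ball y r (- b) \<inter> \<Omega> = {}" "outward_unit_normal \<Omega> y (- b)"
      "G facet_of K" "y \<in> G" "G \<subseteq> frontier \<Omega>"
proof -
  have op: "open \<Omega>" using \<Omega> by (simp add: bounded_lipschitz_domain_def)
  have closed: "closed K" if "K \<in> \<T>" for K
    using mesh that polytope_imp_closed by (auto simp: conforming_mesh_def)
  have "open (\<Inter>p\<in>N - {(a, c)}. {x. fst p \<bullet> x \<noteq> snd p})"
    using N(1) by (intro open_INT ballI open_Collect_neq continuous_intros) auto
  moreover have "y \<in> (\<Inter>p\<in>N - {(a, c)}. {x. fst p \<bullet> x \<noteq> snd p})" using y(2) by force
  ultimately obtain r where r: "r > 0" "ball y r \<subseteq> (\<Inter>p\<in>N - {(a, c)}. {x. fst p \<bullet> x \<noteq> snd p})"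
    by (rule openE)
  have off: "ball y r \<inter> {x. a' \<bullet> x = c'} = {}" if "(a', c') \<in> N - {(a, c)}" for a' c'
    using r(2) that by force
  have side: "half_ball y r b \<subseteq> interior K \<or> half_ball y r b \<inter> K = {}"
    if "K \<in> \<T>" "b = a \<or> b = - a" for K b
    by (rule half_ball_in_or_out[OF fr[OF that(1)] off that(2) y(1)])
  have sides: "(\<exists>K\<in>\<T>. half_ball y r b \<subseteq> interior K) \<or> half_ball y r b \<inter> \<Omega> = {}" if b: "b = a \<or> b = - a" for b
  proof (cases "\<T> = {}")
    case False
    then have "\<Omega> \<subseteq> \<Union>\<T>" using mesh_interior_subset(3)[OF \<Omega> mesh] by auto
    then show ?thesis using side[OF _ b] by blast
  next
    case True
    then show ?thesis using mesh closure_subset[of \<Omega>] by (auto simp: conforming_mesh_def)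
  qed
  have nb: "norm b = 1" if "b = a \<or> b = - a" for b using that N(3) by auto
  have y_in: "x \<in> K" if K: "K \<in> \<T>" "half_ball y r b \<subseteq> interior K" and b: "b = a \<or> b = - a"
    and x: "x \<in> ball y r" "(x - y) \<bullet> b \<ge> 0" for K b x
  proof (rule ccontr)
    assume "x \<notin> K"
    then have "- K \<inter> half_ball y r b \<noteq> {}"
      using closed[OF K(1)] x nb[OF b] by (intro open_meets_half_ball) auto
    then show False using K(2) interior_subset by blast
  qed
  have one: thesis if b: "b = a \<or> b = - a" and K: "K \<in> \<T>" "half_ball y r b \<subseteq> interior K"
    and out: "half_ball y r (- b) \<inter> \<Omega> = {}" for b K
  proof -
    have nout: "z \<notin> \<Omega>" if "z \<in> ball y r" "(z - y) \<bullet> b \<le> 0" for z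
      using open_meets_half_ball[OF op _ that(1), of "- b"] that(2) nb[OF b] out by auto
    have yK: "y \<in> K" by (rule y_in[OF K b]) (use r in auto)
    have "y \<notin> \<Omega>" by (rule nout) (use r in auto)
    from boundary_facet_of_cell[OF \<Omega> mesh K out side[OF _ b] nb[OF b] r(1) yK this]
    obtain G where G: "G facet_of K" "y \<in> G" "G \<subseteq> frontier \<Omega>" by blast
    have "outward_unit_normal \<Omega> y (- b)"
      unfolding outward_unit_normal_def
    proof (intro conjI exI[of _ r] ballI)
      fix z assume z: "z \<in> ball y r"
      show "z \<in> \<Omega> \<longleftrightarrow> (z - y) \<bullet> - b < 0"
      proof (cases "(z - y) \<bullet> b \<le> 0")
        case False
        then have "z \<in> half_ball y r b" using z by (simp add: half_ball_def)
        then have "z \<in> \<Omega>" using K(2) mesh_interior_subset(1)[OF \<Omega> mesh K(1)] by auto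
        with False show ?thesis by simp
      qed (use nout[OF z] in simp)
    qed (use nb[OF b] r in auto)
    from boundary[OF r(1) b K out this G] show thesis .
  qed
  show thesis
  proof (cases "\<exists>K\<in>\<T>. half_ball y r a \<subseteq> interior K")
    case True
    then obtain K where K: "K \<in> \<T>" "half_ball y r a \<subseteq> interior K" by auto
    show ?thesis
    proof (cases "\<exists>K\<in>\<T>. half_ball y r (- a) \<subseteq> interior K")
      case True
      then obtain K' where K': "K' \<in> \<T>" "half_ball y r (- a) \<subseteq> interior K'" by auto
      have "ball y r \<subseteq> closure \<Omega>"
      proof
        fix x assume x: "x \<in> ball y r"
        show "x \<in> closure \<Omega>"
        proof (cases "(x - y) \<bullet> a \<ge> 0")
          case True
          from y_in[OF K _ x True] show ?thesis using mesh_interior_subset(2)[OF \<Omega> mesh K(1)] by auto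
        next
          case False
          then have "(x - y) \<bullet> (- a) \<ge> 0" by simp
          from y_in[OF K' _ x this] show ?thesis using mesh_interior_subset(2)[OF \<Omega> mesh K'(1)] by auto
        qed
      qed
      then have "ball y r \<subseteq> interior (closure \<Omega>)" by (intro interior_maximal) auto
      then have "ball y r \<subseteq> \<Omega>" using interior_closure_lipschitz_domain[OF \<Omega>] by simp
      from inner[OF r(1) this K K'] show thesis .
    next
      case False
      then have "half_ball y r (- a) \<inter> \<Omega> = {}" using sides[of "- a"] by simp
      from one[OF _ K this] show thesis by simp
    qed
  next
    case False
    then have out: "half_ball y r a \<inter> \<Omega> = {}" using sides[of a] by simp
    show ?thesis
    proof (cases "\<exists>K\<in>\<T>. half_ball y r (- a) \<subseteq> interior K")
      case True
      then obtain K' where K': "K' \<in> \<T>" "half_ball y r (- a) \<subseteq> interior K'" by auto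
      from one[OF _ K'] out show thesis by simp
    next
      case False
      then have "half_ball y r (- a) \<inter> \<Omega> = {}" using sides[of "- a"] by simp
      from outer[OF r(1) out this] show thesis .
    qed
  qed
qed

lemma tendsto_along_ray:
  assumes "norm b = 1" "r > 0" "half_ball y r b \<subseteq> A" "(f \<longlongrightarrow> l) (at y within A)"
  shows "((\<lambda>t. f (y + t *\<^sub>R b)) \<longlongrightarrow> l) (at_right 0)"
proof (rule filterlim_compose[OF assms(4)])
  have "((\<lambda>t. y + t *\<^sub>R b) \<longlongrightarrow> y + 0 *\<^sub>R b) (at_right 0)" by (intro tendsto_intros)
  moreover have "\<forall>\<^sub>F t in at_right 0. t \<in> {0<..<r}" by (rule eventually_at_right_real[OF assms(2)])
  then have "\<forall>\<^sub>F t in at_right 0. y + t *\<^sub>R b \<in> A \<and> y + t *\<^sub>R b \<noteq> y"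
  proof eventually_elim
    fix t assume t: "t \<in> {0<..<r}"
    then have "y + t *\<^sub>R b \<in> A" using half_ball_ray[OF assms(1), of t r y] assms(3) by auto
    moreover have "b \<noteq> 0" using assms(1) by auto
    ultimately show "y + t *\<^sub>R b \<in> A \<and> y + t *\<^sub>R b \<noteq> y" using t by simp
  qed
  ultimately show "filterlim (\<lambda>t. y + t *\<^sub>R b) (at y within A) (at_right 0)"
    by (simp add: filterlim_at)
qed

text \<open>In each of the three local situations the normal component does not jump across the
  hyperplane.\<close>

lemma integral_weak_divergence_eq_0:
  fixes \<Omega> :: "'a::euclidean_space set"
  assumes \<Omega>: "bounded_lipschitz_domain \<Omega>" and mesh: "conforming_mesh \<Omega> \<T>"
    and w: "(\<lambda>x. if x \<in> \<Omega> then w x else 0) \<in> borel_measurable borel" "bounded (w ` \<Omega>)"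
    and cells: "\<And>K. K \<in> \<T> \<Longrightarrow> \<exists>p. continuous_on UNIV p \<and> (\<forall>x\<in>interior K. w x = p x)"
    and g: "integrable (lebesgue_on \<Omega>) g"
    and wd: "\<And>\<eta>. test_function \<Omega> \<eta> \<Longrightarrow> l2_inner \<Omega> w (gradient \<eta>) = - l2_inner \<Omega> g \<eta>"
    and trace: "\<And>K G. K \<in> \<T> \<Longrightarrow> G facet_of K \<Longrightarrow> G \<subseteq> frontier \<Omega> \<Longrightarrow> zero_normal_trace \<Omega> (interior K) G w"
  shows "integral\<^sup>L (lebesgue_on \<Omega>) g = 0"
proof -
  have op: "open \<Omega>" "bounded \<Omega>" using \<Omega> by (auto simp: bounded_lipschitz_domain_def)
  obtain N :: "('a \<times> real) set" where N: "finite N" "\<And>a c. (a, c) \<in> N \<Longrightarrow> norm a = 1"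
    "\<And>a c a' c'. (a, c) \<in> N \<Longrightarrow> (a', c') \<in> N \<Longrightarrow> {x. a \<bullet> x = c} = {x. a' \<bullet> x = c'} \<Longrightarrow> (a, c) = (a', c')"
    "\<And>K. K \<in> \<T> \<Longrightarrow> frontier K \<subseteq> (\<Union>(a, c)\<in>N. {x. a \<bullet> x = c})"
    using mesh_hyperplanes[OF mesh] by blast
  have fr: "frontier \<Omega> \<subseteq> (\<Union>(a, c)\<in>N. {x. a \<bullet> x = c})"
  proof
    fix x assume x: "x \<in> frontier \<Omega>"
    then have "x \<in> \<Union>\<T>" "x \<notin> \<Omega>" using mesh op by (auto simp: conforming_mesh_def frontier_def interior_open)
    then obtain K where K: "K \<in> \<T>" "x \<in> K" by auto
    then have "x \<in> frontier K"
      using mesh_interior_subset(1)[OF \<Omega> mesh K(1)] \<open>x \<notin> \<Omega>\<close> closure_subset by (auto simp: frontier_def)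
    then show "x \<in> (\<Union>(a, c)\<in>N. {x. a \<bullet> x = c})" using N(4)[OF K(1)] by blast
  qed
  show ?thesis
  proof (rule integral_divergence_eq_0_hyperplanes[OF op N(1-3) fr w g wd])
    fix a c y
    assume ac: "(a, c) \<in> N" and y: "a \<bullet> y = c" "\<And>a' c'. (a', c') \<in> N - {(a, c)} \<Longrightarrow> a' \<bullet> y \<noteq> c'"
    have a: "norm a = 1" using N(2)[OF ac] .
    let ?f = "\<lambda>x. if x \<in> \<Omega> then w x \<bullet> a else 0"
    have out0: "((\<lambda>t. ?f (y + t *\<^sub>R b)) \<longlongrightarrow> 0) (at_right 0)"
      if "r > 0" "half_ball y r b \<inter> \<Omega> = {}" "norm b = 1" for r b
    proof -
      have "\<forall>\<^sub>F t in at_right 0. t \<in> {0<..<r}" by (rule eventually_at_right_real[OF that(1)])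
      then have "\<forall>\<^sub>F t in at_right 0. 0 = ?f (y + t *\<^sub>R b)"
        by eventually_elim (use half_ball_ray[OF that(3), of _ r y] that(2) in auto)
      from Lim_transform_eventually[OF tendsto_const this] show ?thesis .
    qed
    have cell: "((\<lambda>t. ?f (y + t *\<^sub>R b)) \<longlongrightarrow> p y \<bullet> a) (at_right 0)"
      if r: "r > 0" "half_ball y r b \<subseteq> interior K" and K: "K \<in> \<T>" and b: "norm b = 1"
        and p: "continuous_on UNIV p" "\<And>x. x \<in> interior K \<Longrightarrow> w x = p x" for r b K p
    proof -
      have "(p \<longlongrightarrow> p y) (at y)" using p(1) by (simp add: continuous_on_def)
      then have "(p \<longlongrightarrow> p y) (at y within interior K)" by (rule tendsto_within_subset) simp
      then have "((\<lambda>x. p x \<bullet> a) \<longlongrightarrow> p y \<bullet> a) (at y within interior K)"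
        by (rule tendsto_inner[OF _ tendsto_const])
      from tendsto_along_ray[OF b r this]
      have 1: "((\<lambda>t. p (y + t *\<^sub>R b) \<bullet> a) \<longlongrightarrow> p y \<bullet> a) (at_right 0)" .
      have "\<forall>\<^sub>F t in at_right 0. t \<in> {0<..<r}" by (rule eventually_at_right_real[OF r(1)])
      then have "\<forall>\<^sub>F t in at_right 0. p (y + t *\<^sub>R b) \<bullet> a = ?f (y + t *\<^sub>R b)"
      proof eventually_elim
        fix t assume "t \<in> {0<..<r}"
        then have "y + t *\<^sub>R b \<in> interior K" using half_ball_ray[OF b, of t r y] r(2) by auto
        then show "p (y + t *\<^sub>R b) \<bullet> a = ?f (y + t *\<^sub>R b)"
          using p(2) mesh_interior_subset(1)[OF \<Omega> mesh K] by auto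
      qed
      from Lim_transform_eventually[OF 1 this] show ?thesis .
    qed
    have diff: "((\<lambda>t. ?f (y + t *\<^sub>R a) - ?f (y - t *\<^sub>R a)) \<longlongrightarrow> 0) (at_right 0)"
      if "((\<lambda>t. ?f (y + t *\<^sub>R a)) \<longlongrightarrow> l) (at_right 0)" "((\<lambda>t. ?f (y + t *\<^sub>R (- a))) \<longlongrightarrow> l) (at_right 0)" for l
    proof -
      have "y + t *\<^sub>R (- a) = y - t *\<^sub>R a" for t by simp
      from tendsto_diff[OF that, unfolded this] show ?thesis by simp
    qed
    show "((\<lambda>t. ?f (y + t *\<^sub>R a) - ?f (y - t *\<^sub>R a)) \<longlongrightarrow> 0) (at_right 0)"
    proof (rule mesh_local_cases[OF \<Omega> mesh N(1) ac a])
      show "frontier K \<subseteq> (\<Union>(a, c)\<in>N. {x. a \<bullet> x = c})" if "K \<in> \<T>" for K using N(4)[OF that] .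
      show "a \<bullet> y = c" by (rule y(1))
      show "a' \<bullet> y \<noteq> c'" if "(a', c') \<in> N - {(a, c)}" for a' c' using y(2)[OF that] .
    next
      fix r K K'
      assume inner: "r > 0" "ball y r \<subseteq> \<Omega>" "K \<in> \<T>" "half_ball y r a \<subseteq> interior K"
        "K' \<in> \<T>" "half_ball y r (- a) \<subseteq> interior K'"
      obtain p where p: "continuous_on UNIV p" "\<And>x. x \<in> interior K \<Longrightarrow> w x = p x"
        using cells[OF inner(3)] by blast
      obtain q where q: "continuous_on UNIV q" "\<And>x. x \<in> interior K' \<Longrightarrow> w x = q x"
        using cells[OF inner(5)] by blast
      have "p y \<bullet> a = q y \<bullet> a"
      proof (rule weak_div_normal_continuity[OF op(1) w g wd inner(1,2) a y(1) p(1) _ q(1)])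
        fix x assume x: "x \<in> ball y r"
        { assume "a \<bullet> x > c"
          then have "x \<in> half_ball y r a"
            using x y(1) by (simp add: half_ball_def inner_diff_right inner_commute[of _ a])
          then show "w x = p x" using inner(4) p(2) by auto }
        { assume "a \<bullet> x < c"
          then have "x \<in> half_ball y r (- a)"
            using x y(1) by (simp add: half_ball_def inner_diff_right inner_commute[of _ a])
          then show "w x = q x" using inner(6) q(2) by auto }
      qed
      moreover have "norm (- a) = 1" using a by simp
      note cell[OF inner(1,6,5) this q]
      ultimately have "((\<lambda>t. ?f (y + t *\<^sub>R (- a))) \<longlongrightarrow> p y \<bullet> a) (at_right 0)" by (simp only:)
      with cell[OF inner(1,4,3) a p]
      show "((\<lambda>t. ?f (y + t *\<^sub>R a) - ?f (y - t *\<^sub>R a)) \<longlongrightarrow> 0) (at_right 0)" by (rule diff)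
    next
      fix r
      assume outer: "r > 0" "half_ball y r a \<inter> \<Omega> = {}" "half_ball y r (- a) \<inter> \<Omega> = {}"
      show "((\<lambda>t. ?f (y + t *\<^sub>R a) - ?f (y - t *\<^sub>R a)) \<longlongrightarrow> 0) (at_right 0)" by (rule diff[OF out0[OF outer(1,2) a] out0[OF outer(1,3)]]) (use a in simp)
    next
      fix r b K G
      assume boundary: "r > 0" "b = a \<or> b = - a" "K \<in> \<T>" "half_ball y r b \<subseteq> interior K"
        "half_ball y r (- b) \<inter> \<Omega> = {}" "outward_unit_normal \<Omega> y (- b)"
        "G facet_of K" "y \<in> G" "G \<subseteq> frontier \<Omega>"
      have b: "norm b = 1" "norm (- b) = 1" using a boundary(2) by auto
      have "((\<lambda>x. w x \<bullet> - b) \<longlongrightarrow> 0) (at y within interior K)"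
        using trace[OF boundary(3,7,9)] boundary(6,8) unfolding zero_normal_trace_def by blast
      from tendsto_along_ray[OF b(1) boundary(1,4) this]
      have 0: "((\<lambda>t. w (y + t *\<^sub>R b) \<bullet> - b) \<longlongrightarrow> 0) (at_right 0)" .
      have 1: "((\<lambda>t. w (y + t *\<^sub>R b) \<bullet> a) \<longlongrightarrow> 0) (at_right 0)"
        using boundary(2)
      proof
        assume "b = a"
        with tendsto_minus[OF 0] show ?thesis by simp
      next
        assume "b = - a"
        with 0 show ?thesis by simp
      qed
      have "\<forall>\<^sub>F t in at_right 0. t \<in> {0<..<r}" by (rule eventually_at_right_real[OF boundary(1)])
      then have "\<forall>\<^sub>F t in at_right 0. w (y + t *\<^sub>R b) \<bullet> a = ?f (y + t *\<^sub>R b)"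
      proof eventually_elim
        fix t assume "t \<in> {0<..<r}"
        then have "y + t *\<^sub>R b \<in> interior K" using half_ball_ray[OF b(1), of t r y] boundary(4) by auto
        then show "w (y + t *\<^sub>R b) \<bullet> a = ?f (y + t *\<^sub>R b)"
          using mesh_interior_subset(1)[OF \<Omega> mesh boundary(3)] by auto
      qed
      from Lim_transform_eventually[OF 1 this]
      have 2: "((\<lambda>t. ?f (y + t *\<^sub>R b)) \<longlongrightarrow> 0) (at_right 0)" .
      have 3: "((\<lambda>t. ?f (y + t *\<^sub>R - b)) \<longlongrightarrow> 0) (at_right 0)" by (rule out0[OF boundary(1,5) b(2)])
      from boundary(2)
      show "((\<lambda>t. ?f (y + t *\<^sub>R a) - ?f (y - t *\<^sub>R a)) \<longlongrightarrow> 0) (at_right 0)"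
      proof
        assume ba: "b = a"
        show ?thesis by (rule diff[OF 2[unfolded ba] 3[unfolded ba]])
      next
        assume ba: "b = - a"
        show ?thesis by (rule diff[OF 3[unfolded ba minus_minus] 2[unfolded ba]])
      qed
    qed
  qed
qed


section \<open>Square integrable fields and classical divergences\<close>

lemma integrable_bounded_on:
  fixes f :: "'a::euclidean_space \<Rightarrow> real"
  assumes "open \<Omega>" "bounded \<Omega>" "f \<in> borel_measurable (lebesgue_on \<Omega>)" "\<And>x. x \<in> \<Omega> \<Longrightarrow> \<bar>f x\<bar> \<le> C"
  shows "integrable (lebesgue_on \<Omega>) f"
proof -
  interpret finite_measure "lebesgue_on \<Omega>"
    using assms(1,2) by (intro finite_measure_lebesgue_on lmeasurable_open) auto
  show ?thesis
    by (rule integrable_const_bound[of _ C]) (use assms(3,4) in \<open>auto intro!: AE_I2\<close>)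
qed

lemma square_integrable_bounded_on:
  fixes f :: "'a::euclidean_space \<Rightarrow> 'b::euclidean_space"
  assumes "open \<Omega>" "bounded \<Omega>" "f \<in> borel_measurable (lebesgue_on \<Omega>)" "\<And>x. x \<in> \<Omega> \<Longrightarrow> norm (f x) \<le> C"
  shows "square_integrable \<Omega> f"
  unfolding square_integrable_def
proof
  show "integrable (lebesgue_on \<Omega>) (\<lambda>x. (norm (f x))\<^sup>2)"
  proof (rule integrable_bounded_on[OF assms(1,2)])
    show "\<bar>(norm (f x))\<^sup>2\<bar> \<le> C\<^sup>2" if "x \<in> \<Omega>" for x
      using power_mono[OF assms(4)[OF that], of 2] by simp
  qed (use assms(3) in measurable)
qed (rule assms(3))

lemma square_integrable_inner:
  fixes f g :: "'a::euclidean_space \<Rightarrow> 'b::euclidean_space"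
  assumes "square_integrable \<Omega> f" "square_integrable \<Omega> g"
  shows "integrable (lebesgue_on \<Omega>) (\<lambda>x. f x \<bullet> g x)"
proof (rule Bochner_Integration.integrable_bound)
  show "integrable (lebesgue_on \<Omega>) (\<lambda>x. (norm (f x))\<^sup>2 + (norm (g x))\<^sup>2)"
    using assms by (auto simp: square_integrable_def)
  show "(\<lambda>x. f x \<bullet> g x) \<in> borel_measurable (lebesgue_on \<Omega>)"
    using assms by (auto simp: square_integrable_def)
  show "AE x in lebesgue_on \<Omega>. norm (f x \<bullet> g x) \<le> norm ((norm (f x))\<^sup>2 + (norm (g x))\<^sup>2)"
  proof (intro AE_I2)
    fix x
    have "2 * (norm (f x) * norm (g x)) \<le> (norm (f x))\<^sup>2 + (norm (g x))\<^sup>2"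
      using sum_squares_bound[of "norm (f x)" "norm (g x)"] by (simp add: mult_ac)
    moreover have "0 \<le> norm (f x) * norm (g x)" by simp
    ultimately show "norm (f x \<bullet> g x) \<le> norm ((norm (f x))\<^sup>2 + (norm (g x))\<^sup>2)"
      using Cauchy_Schwarz_ineq2[of "f x" "g x"] by simp
  qed
qed

text \<open>For a test function \<open>\<eta>\<close> the products of \<open>\<eta>\<close> with the components of \<open>w\<close> are continuously
  differentiable on the whole space and have compact support, so their derivatives have integral
  zero.\<close>

lemma classical_divergence_weak:
  fixes w :: "'a::euclidean_space \<Rightarrow> 'a"
  assumes \<Omega>: "open \<Omega>" and w: "\<And>x. x \<in> \<Omega> \<Longrightarrow> w differentiable (at x)"
    and w': "\<And>v. continuous_on \<Omega> (\<lambda>x. frechet_derivative w (at x) v)"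
    and \<eta>: "test_function \<Omega> \<eta>"
  shows "l2_inner \<Omega> w (gradient \<eta>) = - l2_inner \<Omega> (divergence w) \<eta>"
proof -
  obtain C where C: "compact C" "C \<subseteq> \<Omega>" "\<And>x. x \<notin> C \<Longrightarrow> \<eta> x = 0"
    using \<eta> unfolding test_function_def by blast
  have \<eta>d: "(\<eta> has_derivative (\<lambda>h. gradient \<eta> x \<bullet> h)) (at x)" for x
    using \<eta> by (auto simp: test_function_def intro: has_derivative_gradient)
  have \<eta>0: "gradient \<eta> x = 0" if "x \<notin> C" for x
    using gradient_eq_0_off_support(2)[of C \<eta> x] C that by auto
  have c\<eta>: "continuous_on A \<eta>" for A
    using has_derivative_continuous[OF \<eta>d] by (simp add: continuous_at_imp_continuous_on)
  have c\<eta>': "continuous_on A (gradient \<eta>)" for A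
    using \<eta> continuous_on_subset by (auto simp: test_function_def)
  have cw: "continuous_on \<Omega> w"
    using w by (simp add: continuous_at_imp_continuous_on differentiable_imp_continuous_within)
  have cdiv: "continuous_on \<Omega> (divergence w)"
    unfolding divergence_def[abs_def] by (intro continuous_intros w')
  define F where "F b x = \<eta> x * (w x \<bullet> b)" for b x
  define G where "G b x = (w x \<bullet> b) *\<^sub>R gradient \<eta> x
      + \<eta> x *\<^sub>R (\<Sum>c\<in>Basis. (frechet_derivative w (at x) c \<bullet> b) *\<^sub>R c)" for b x
  have FD: "(F b has_derivative (\<lambda>h. G b x \<bullet> h)) (at x)" if x: "x \<in> \<Omega>" for b x
  proof -
    have 1: "(w has_derivative frechet_derivative w (at x)) (at x)"
      using w[OF x] by (simp add: frechet_derivative_works[symmetric])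
    have "linear (frechet_derivative w (at x))" using w[OF x] by (rule linear_frechet_derivative)
    then have 2: "frechet_derivative w (at x) h \<bullet> b
        = (\<Sum>c\<in>Basis. (frechet_derivative w (at x) c \<bullet> b) *\<^sub>R c) \<bullet> h" for h
    proof -
      assume l: "linear (frechet_derivative w (at x))"
      have "frechet_derivative w (at x) h = frechet_derivative w (at x) (\<Sum>c\<in>Basis. (h \<bullet> c) *\<^sub>R c)"
        by (simp add: euclidean_representation)
      also have "\<dots> = (\<Sum>c\<in>Basis. (h \<bullet> c) *\<^sub>R frechet_derivative w (at x) c)"
        using l by (simp add: linear_sum linear_cmul)
      finally show ?thesis
        by (simp add: inner_sum_left inner_commute[of _ h] inner_sum_right mult.commute)
    qed
    from has_derivative_mult[OF \<eta>d has_derivative_inner_left[OF 1, of b]] show ?thesis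
      unfolding F_def[abs_def] G_def inner_add_left inner_scaleR_left 2[symmetric]
      by (simp add: mult_ac add_ac)
  qed
  have Gc: "continuous_on \<Omega> (G b)" for b
    unfolding G_def by (intro continuous_intros cw c\<eta> c\<eta>' w')
  have F0: "F b x = 0" if "x \<notin> C" for b x using C(3)[OF that] by (simp add: F_def)
  have FG: "gradient (F b) x = G b x" if "x \<in> \<Omega>" for b x
    using test_functionI(2)[of \<Omega> "F b" "G b" C] FD Gc \<Omega> C(1,2) F0 that by blast
  have FT: "(F b has_derivative (\<lambda>h. gradient (F b) x \<bullet> h)) (at x)" "continuous_on UNIV (gradient (F b))" for b x
    using test_functionI(3,4)[of \<Omega> "F b" "G b" C] FD Gc \<Omega> C(1,2) F0 by blast+
  have int0: "(\<integral>x. gradient (F b) x \<bullet> b \<partial>lborel) = 0" for b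
    using integral_derivative_eq_0[of "F b" "gradient (F b)" C b] FT C(1) F0 by blast
  have supp: "continuous_on UNIV f" if "continuous_on \<Omega> f" "\<And>x. x \<notin> C \<Longrightarrow> f x = 0" for f :: "'a \<Rightarrow> real"
  proof -
    have "continuous_on (- C) f"
      by (rule continuous_on_eq[OF continuous_on_const[of _ 0]]) (simp add: that(2))
    then have "continuous_on (\<Omega> \<union> - C) f"
      by (intro continuous_on_open_Un that(1) \<Omega> open_Compl compact_imp_closed C(1))
    moreover have "\<Omega> \<union> - C = UNIV" using C(2) by auto
    ultimately show ?thesis by simp
  qed
  have integ: "integrable lborel f" if f: "continuous_on \<Omega> f" "\<And>x. x \<notin> C \<Longrightarrow> f x = 0" for f :: "'a \<Rightarrow> real"
  proof -
    note cf = supp[OF f]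
    obtain M where M: "\<And>x. norm (f x) \<le> M"
      using continuous_compact_support_bounded[OF cf C(1) f(2)] by blast
    obtain R where R: "\<And>x. x \<in> C \<Longrightarrow> norm x \<le> R"
      using compact_imp_bounded[OF C(1)] by (auto simp: bounded_iff)
    show ?thesis
      by (rule integrable_bounded_support[OF borel_measurable_continuous_onI[OF cf], of M R])
         (use M f(2) R in \<open>fastforce simp: not_le[symmetric]\<close>)+
  qed
  let ?p = "\<lambda>x. if x \<in> \<Omega> then w x \<bullet> gradient \<eta> x else 0"
  let ?q = "\<lambda>x. if x \<in> \<Omega> then divergence w x \<bullet> \<eta> x else 0"
  have cp: "continuous_on \<Omega> ?p"
    by (rule continuous_on_eq[of _ "\<lambda>x. w x \<bullet> gradient \<eta> x"]) (auto intro!: continuous_intros cw c\<eta>')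
  have cq: "continuous_on \<Omega> ?q"
    by (rule continuous_on_eq[of _ "\<lambda>x. divergence w x \<bullet> \<eta> x"]) (auto intro!: continuous_intros cdiv c\<eta>)
  have p0: "?p x = 0" and q0: "?q x = 0" if "x \<notin> C" for x using that C(3) \<eta>0 by auto
  have sum: "(\<Sum>b\<in>Basis. gradient (F b) x \<bullet> b) = ?p x + ?q x" for x
  proof (cases "x \<in> \<Omega>")
    case True
    have "(\<Sum>b\<in>Basis. gradient (F b) x \<bullet> b)
        = (\<Sum>b\<in>Basis. (w x \<bullet> b) * (gradient \<eta> x \<bullet> b) + \<eta> x * (frechet_derivative w (at x) b \<bullet> b))"
      using FG[OF True] by (intro sum.cong) (auto simp: G_def inner_add_left inner_sum_left inner_Basis if_distrib cong: if_cong)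
    also have "\<dots> = w x \<bullet> gradient \<eta> x + divergence w x * \<eta> x"
      by (simp add: sum.distrib sum_distrib_left[symmetric] divergence_def euclidean_inner[symmetric] mult.commute)
    finally show ?thesis using True by simp
  next
    case False
    then have "x \<notin> C" using C(2) by auto
    then have "gradient (F b) x = 0" for b
      using gradient_eq_0_off_support(2)[of C "F b" x] C(1) F0 by auto
    then show ?thesis using False by simp
  qed
  have bint: "integrable lborel (\<lambda>x. gradient (F b) x \<bullet> b)" for b
  proof (rule integ)
    show "continuous_on \<Omega> (\<lambda>x. gradient (F b) x \<bullet> b)"
      by (intro continuous_intros continuous_on_subset[OF FT(2)]) simp
    show "gradient (F b) x \<bullet> b = 0" if "x \<notin> C" for x
      using gradient_eq_0_off_support(2)[of C "F b" x] C(1) F0 that by auto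
  qed
  have mp: "?p \<in> borel_measurable borel"
    by (rule borel_measurable_continuous_onI, rule supp[OF cp p0])
  have mq: "?q \<in> borel_measurable borel"
    by (rule borel_measurable_continuous_onI, rule supp[OF cq q0])
  have "0 = (\<Sum>b\<in>Basis. \<integral>x. gradient (F b) x \<bullet> b \<partial>lborel)" by (simp add: int0)
  also have "\<dots> = (\<integral>x. (\<Sum>b\<in>Basis. gradient (F b) x \<bullet> b) \<partial>lborel)"
    using bint by (intro Bochner_Integration.integral_sum[symmetric]) auto
  also have "\<dots> = (\<integral>x. ?p x \<partial>lborel) + (\<integral>x. ?q x \<partial>lborel)"
    unfolding sum by (rule Bochner_Integration.integral_add[OF integ[OF cp p0] integ[OF cq q0]])
  also have "\<dots> = l2_inner \<Omega> w (gradient \<eta>) + l2_inner \<Omega> (divergence w) \<eta>"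
    unfolding l2_inner_def
    by (simp only: integral_lebesgue_on_eq_lborel[OF \<Omega> mp] integral_lebesgue_on_eq_lborel[OF \<Omega> mq])
  finally show ?thesis by simp
qed


section \<open>Differentiation under the integral sign\<close>

text \<open>A pointwise derivative at \<open>t\<close> with difference quotients that are bounded uniformly in space.
  Unlike plain differentiability under the integral sign, this notion is stable under products, and
  the energy density is a polynomial in quantities that have the property.\<close>

definition dominated_derivative ::
    "real set \<Rightarrow> real \<Rightarrow> 'a::euclidean_space set \<Rightarrow> (real \<Rightarrow> 'a \<Rightarrow> real) \<Rightarrow> ('a \<Rightarrow> real) \<Rightarrow> bool" where
  "dominated_derivative I t \<Omega> h h' \<longleftrightarrow>
     (\<forall>x\<in>\<Omega>. ((\<lambda>s. h s x) has_real_derivative h' x) (at t within I)) \<and>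
     (\<exists>L. \<forall>\<^sub>F s in at t within I. \<forall>x\<in>\<Omega>. \<bar>h s x - h t x\<bar> \<le> L * \<bar>s - t\<bar>) \<and>
     bounded (h t ` \<Omega>) \<and> (\<forall>s\<in>I. h s \<in> borel_measurable (lebesgue_on \<Omega>))"

lemma dominated_derivative_space_const:
  assumes "(u has_real_derivative u') (at t within I)"
  shows "dominated_derivative I t \<Omega> (\<lambda>s x. u s) (\<lambda>x. u')"
proof -
  have "((\<lambda>s. (u s - u t) / (s - t)) \<longlongrightarrow> u') (at t within I)"
    using assms by (simp add: has_field_derivative_iff)
  then have "\<forall>\<^sub>F s in at t within I. dist ((u s - u t) / (s - t)) u' < 1" by (rule tendstoD) simp
  then have "\<forall>\<^sub>F s in at t within I. \<bar>u s - u t\<bar> \<le> (\<bar>u'\<bar> + 1) * \<bar>s - t\<bar>"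
    using eventually_neq_at_within[of t t I]
  proof eventually_elim
    fix s assume "dist ((u s - u t) / (s - t)) u' < 1" "s \<noteq> t"
    then have "\<bar>(u s - u t) / (s - t)\<bar> \<le> \<bar>u'\<bar> + 1" unfolding dist_real_def by linarith
    then have "\<bar>(u s - u t) / (s - t)\<bar> * \<bar>s - t\<bar> \<le> (\<bar>u'\<bar> + 1) * \<bar>s - t\<bar>" by (rule mult_right_mono) simp
    then show "\<bar>u s - u t\<bar> \<le> (\<bar>u'\<bar> + 1) * \<bar>s - t\<bar>" using \<open>s \<noteq> t\<close> by (simp add: abs_divide)
  qed
  then have "\<exists>L. \<forall>\<^sub>F s in at t within I. \<forall>x\<in>\<Omega>. \<bar>u s - u t\<bar> \<le> L * \<bar>s - t\<bar>"
    by (intro exI[of _ "\<bar>u'\<bar> + 1"]) (rule eventually_mono, auto)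
  then show ?thesis using assms by (auto simp: dominated_derivative_def bounded_iff)
qed

lemma dominated_derivative_time_const:
  assumes "e \<in> borel_measurable (lebesgue_on \<Omega>)" "bounded (e ` \<Omega>)"
  shows "dominated_derivative I t \<Omega> (\<lambda>s. e) (\<lambda>x. 0)"
  using assms by (auto simp: dominated_derivative_def intro!: exI[of _ 0])

lemma dominated_derivative_add:
  assumes "dominated_derivative I t \<Omega> h h'" "dominated_derivative I t \<Omega> k k'"
  shows "dominated_derivative I t \<Omega> (\<lambda>s x. h s x + k s x) (\<lambda>x. h' x + k' x)"
proof -
  obtain L M where "\<forall>\<^sub>F s in at t within I. \<forall>x\<in>\<Omega>. \<bar>h s x - h t x\<bar> \<le> L * \<bar>s - t\<bar>"
    "\<forall>\<^sub>F s in at t within I. \<forall>x\<in>\<Omega>. \<bar>k s x - k t x\<bar> \<le> M * \<bar>s - t\<bar>"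
    using assms unfolding dominated_derivative_def by blast
  then have "\<forall>\<^sub>F s in at t within I. \<forall>x\<in>\<Omega>. \<bar>(h s x + k s x) - (h t x + k t x)\<bar> \<le> (L + M) * \<bar>s - t\<bar>"
  proof eventually_elim
    fix s assume 1: "\<forall>x\<in>\<Omega>. \<bar>h s x - h t x\<bar> \<le> L * \<bar>s - t\<bar>" "\<forall>x\<in>\<Omega>. \<bar>k s x - k t x\<bar> \<le> M * \<bar>s - t\<bar>"
    show "\<forall>x\<in>\<Omega>. \<bar>(h s x + k s x) - (h t x + k t x)\<bar> \<le> (L + M) * \<bar>s - t\<bar>"
    proof
      fix x assume "x \<in> \<Omega>"
      with 1 have "\<bar>h s x - h t x\<bar> \<le> L * \<bar>s - t\<bar>" "\<bar>k s x - k t x\<bar> \<le> M * \<bar>s - t\<bar>" by auto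
      then show "\<bar>(h s x + k s x) - (h t x + k t x)\<bar> \<le> (L + M) * \<bar>s - t\<bar>"
        unfolding distrib_right by linarith
    qed
  qed
  moreover have "bounded ((\<lambda>x. h t x + k t x) ` \<Omega>)"
    using assms by (intro bounded_plus_comp) (auto simp: dominated_derivative_def)
  ultimately show ?thesis
    using assms unfolding dominated_derivative_def by (auto intro!: DERIV_add borel_measurable_add)
qed

lemma dominated_derivative_mult:
  assumes "dominated_derivative I t \<Omega> h h'" "dominated_derivative I t \<Omega> k k'"
  shows "dominated_derivative I t \<Omega> (\<lambda>s x. h s x * k s x) (\<lambda>x. h' x * k t x + h t x * k' x)"
proof -
  obtain L M where LM: "\<forall>\<^sub>F s in at t within I. \<forall>x\<in>\<Omega>. \<bar>h s x - h t x\<bar> \<le> L * \<bar>s - t\<bar>"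
    "\<forall>\<^sub>F s in at t within I. \<forall>x\<in>\<Omega>. \<bar>k s x - k t x\<bar> \<le> M * \<bar>s - t\<bar>"
    using assms unfolding dominated_derivative_def by blast
  obtain H where H: "\<And>x. x \<in> \<Omega> \<Longrightarrow> \<bar>h t x\<bar> \<le> H"
    using assms(1) by (auto simp: dominated_derivative_def bounded_iff)
  obtain K where K: "\<And>x. x \<in> \<Omega> \<Longrightarrow> \<bar>k t x\<bar> \<le> K"
    using assms(2) by (auto simp: dominated_derivative_def bounded_iff)
  have "\<forall>\<^sub>F s in at t within I. dist s t < 1"
    unfolding eventually_at by (rule exI[of _ 1]) simp
  with LM have "\<forall>\<^sub>F s in at t within I. \<forall>x\<in>\<Omega>. \<bar>h s x * k s x - h t x * k t x\<bar> \<le> ((\<bar>H\<bar> + \<bar>L\<bar>) * \<bar>M\<bar> + \<bar>K\<bar> * \<bar>L\<bar>) * \<bar>s - t\<bar>"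
  proof eventually_elim
    fix s assume 1: "\<forall>x\<in>\<Omega>. \<bar>h s x - h t x\<bar> \<le> L * \<bar>s - t\<bar>" "\<forall>x\<in>\<Omega>. \<bar>k s x - k t x\<bar> \<le> M * \<bar>s - t\<bar>"
      and s1: "dist s t < 1"
    show "\<forall>x\<in>\<Omega>. \<bar>h s x * k s x - h t x * k t x\<bar> \<le> ((\<bar>H\<bar> + \<bar>L\<bar>) * \<bar>M\<bar> + \<bar>K\<bar> * \<bar>L\<bar>) * \<bar>s - t\<bar>"
    proof
      fix x assume x: "x \<in> \<Omega>"
      have st: "\<bar>s - t\<bar> \<le> 1" using s1 by (simp add: dist_real_def)
      have hd: "\<bar>h s x - h t x\<bar> \<le> \<bar>L\<bar> * \<bar>s - t\<bar>"
        by (rule order_trans[OF bspec[OF 1(1) x]]) (simp add: mult_right_mono)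
      have kd: "\<bar>k s x - k t x\<bar> \<le> \<bar>M\<bar> * \<bar>s - t\<bar>"
        by (rule order_trans[OF bspec[OF 1(2) x]]) (simp add: mult_right_mono)
      have "\<bar>L\<bar> * \<bar>s - t\<bar> \<le> \<bar>L\<bar>" using st mult_left_mono[of "\<bar>s - t\<bar>" 1 "\<bar>L\<bar>"] by simp
      then have hs: "\<bar>h s x\<bar> \<le> \<bar>H\<bar> + \<bar>L\<bar>" using hd H[OF x] by linarith
      have kt: "\<bar>k t x\<bar> \<le> \<bar>K\<bar>" using K[OF x] by linarith
      have "h s x * k s x - h t x * k t x = h s x * (k s x - k t x) + k t x * (h s x - h t x)"
        by (simp add: algebra_simps)
      then have "\<bar>h s x * k s x - h t x * k t x\<bar> \<le> \<bar>h s x\<bar> * \<bar>k s x - k t x\<bar> + \<bar>k t x\<bar> * \<bar>h s x - h t x\<bar>"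
        using abs_triangle_ineq[of "h s x * (k s x - k t x)" "k t x * (h s x - h t x)"] by (simp add: abs_mult)
      also have "\<dots> \<le> (\<bar>H\<bar> + \<bar>L\<bar>) * (\<bar>M\<bar> * \<bar>s - t\<bar>) + \<bar>K\<bar> * (\<bar>L\<bar> * \<bar>s - t\<bar>)"
        using hs kd kt hd by (intro add_mono mult_mono) auto
      finally show "\<bar>h s x * k s x - h t x * k t x\<bar> \<le> ((\<bar>H\<bar> + \<bar>L\<bar>) * \<bar>M\<bar> + \<bar>K\<bar> * \<bar>L\<bar>) * \<bar>s - t\<bar>"
        by (simp add: algebra_simps)
    qed
  qed
  moreover have "bounded ((\<lambda>x. h t x * k t x) ` \<Omega>)"
  proof -
    have "\<bar>h t x * k t x\<bar> \<le> \<bar>H\<bar> * \<bar>K\<bar>" if "x \<in> \<Omega>" for x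
      unfolding abs_mult using H[OF that] K[OF that] by (intro mult_mono) auto
    then show ?thesis by (auto simp: bounded_iff)
  qed
  moreover have "((\<lambda>s. h s x * k s x) has_real_derivative h' x * k t x + h t x * k' x) (at t within I)" if "x \<in> \<Omega>" for x
  proof -
    have "((\<lambda>s. h s x) has_real_derivative h' x) (at t within I)" "((\<lambda>s. k s x) has_real_derivative k' x) (at t within I)"
      using assms that by (auto simp: dominated_derivative_def)
    from DERIV_mult[OF this] show ?thesis by (simp add: algebra_simps)
  qed
  moreover have "(\<lambda>x. h s x * k s x) \<in> borel_measurable (lebesgue_on \<Omega>)" if "s \<in> I" for s
    using assms that by (intro borel_measurable_times) (auto simp: dominated_derivative_def)
  ultimately show ?thesis unfolding dominated_derivative_def by blast
qed

lemma dominated_derivative_cong: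
  assumes h: "dominated_derivative I t \<Omega> h h'" and t: "t \<in> I"
    and k: "\<And>s x. s \<in> I \<Longrightarrow> x \<in> \<Omega> \<Longrightarrow> k s x = h s x" "\<And>x. x \<in> \<Omega> \<Longrightarrow> k' x = h' x"
  shows "dominated_derivative I t \<Omega> k k'"
proof -
  obtain L where "\<forall>\<^sub>F s in at t within I. \<forall>x\<in>\<Omega>. \<bar>h s x - h t x\<bar> \<le> L * \<bar>s - t\<bar>"
    using h unfolding dominated_derivative_def by blast
  moreover have "\<forall>\<^sub>F s in at t within I. s \<in> I" by (simp add: eventually_at_filter)
  ultimately have "\<forall>\<^sub>F s in at t within I. \<forall>x\<in>\<Omega>. \<bar>k s x - k t x\<bar> \<le> L * \<bar>s - t\<bar>"
    by eventually_elim (use k t in simp)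
  moreover have "((\<lambda>s. k s x) has_real_derivative k' x) (at t within I)" if "x \<in> \<Omega>" for x
  proof -
    have "((\<lambda>s. h s x) has_real_derivative k' x) (at t within I)"
      using h that k(2) by (auto simp: dominated_derivative_def)
    then show ?thesis
      by (rule has_field_derivative_transform_within[where d = 1]) (use k t that in auto)
  qed
  moreover have "bounded (k t ` \<Omega>)"
    using h k(1)[OF t] by (simp add: dominated_derivative_def cong: image_cong)
  moreover have "k s \<in> borel_measurable (lebesgue_on \<Omega>)" if "s \<in> I" for s
  proof -
    have "h s \<in> borel_measurable (lebesgue_on \<Omega>)" using h that by (auto simp: dominated_derivative_def)
    then show ?thesis by (rule measurable_cong[THEN iffD1, rotated]) (simp add: k(1)[OF that])
  qed
  ultimately show ?thesis unfolding dominated_derivative_def by blast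
qed

lemma dominated_derivative_sum:
  assumes "finite A" "\<And>i. i \<in> A \<Longrightarrow> dominated_derivative I t \<Omega> (h i) (h' i)"
  shows "dominated_derivative I t \<Omega> (\<lambda>s x. \<Sum>i\<in>A. h i s x) (\<lambda>x. \<Sum>i\<in>A. h' i x)"
  using assms
proof (induction A rule: finite_induct)
  case empty
  show ?case using dominated_derivative_space_const[of "\<lambda>_. 0" 0 t I \<Omega>] by simp
next
  case (insert i A)
  then have "dominated_derivative I t \<Omega> (\<lambda>s x. h i s x + (\<Sum>i\<in>A. h i s x)) (\<lambda>x. h' i x + (\<Sum>i\<in>A. h' i x))"
    by (intro dominated_derivative_add) auto
  with insert show ?case by simp
qed

text \<open>Dominated convergence along any sequence of times; the bound on the difference quotients holds
  on a tail of the sequence only.\<close>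

lemma dominated_derivative_integral:
  assumes \<Omega>: "open \<Omega>" "bounded \<Omega>" and t: "t \<in> I" and h: "dominated_derivative I t \<Omega> h h'"
  shows "((\<lambda>s. integral\<^sup>L (lebesgue_on \<Omega>) (h s)) has_real_derivative integral\<^sup>L (lebesgue_on \<Omega>) h') (at t within I)"
  unfolding has_field_derivative_iff tendsto_at_iff_sequentially
proof (intro allI impI)
  fix X assume X: "\<forall>i. X i \<in> I - {t}" "X \<longlonglongrightarrow> t"
  obtain L where L: "\<forall>\<^sub>F s in at t within I. \<forall>x\<in>\<Omega>. \<bar>h s x - h t x\<bar> \<le> L * \<bar>s - t\<bar>"
    using h unfolding dominated_derivative_def by blast
  obtain H where H: "\<And>x. x \<in> \<Omega> \<Longrightarrow> \<bar>h t x\<bar> \<le> H"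
    using h by (auto simp: dominated_derivative_def bounded_iff)
  have meas: "h s \<in> borel_measurable (lebesgue_on \<Omega>)" if "s \<in> I" for s
    using h that by (auto simp: dominated_derivative_def)
  have "filterlim X (at t within I) sequentially"
    using X by (auto simp: filterlim_at)
  from eventually_compose_filterlim[OF L this]
  obtain N where N: "\<And>n x. n \<ge> N \<Longrightarrow> x \<in> \<Omega> \<Longrightarrow> \<bar>h (X n) x - h t x\<bar> \<le> L * \<bar>X n - t\<bar>"
    by (auto simp: eventually_sequentially)
  define Y where "Y n = X (n + N)" for n
  have Y: "Y n \<in> I" "Y n \<noteq> t" "Y \<longlonglongrightarrow> t" for n
    using X LIMSEQ_ignore_initial_segment[OF X(2), of N] by (auto simp: Y_def[abs_def])
  have YL: "\<bar>h (Y n) x - h t x\<bar> \<le> L * \<bar>Y n - t\<bar>" if "x \<in> \<Omega>" for n x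
    using N[of "n + N" x] that by (simp add: Y_def)
  have int_t: "integrable (lebesgue_on \<Omega>) (h t)"
    by (rule integrable_bounded_on[OF \<Omega> meas[OF t] H])
  have int_Y: "integrable (lebesgue_on \<Omega>) (h (Y n))" for n
  proof (rule integrable_bounded_on[OF \<Omega> meas[OF Y(1)]])
    show "\<bar>h (Y n) x\<bar> \<le> H + L * \<bar>Y n - t\<bar>" if "x \<in> \<Omega>" for x
      using YL[OF that, of n] H[OF that] by linarith
  qed
  define q where "q n x = (h (Y n) x - h t x) / (Y n - t)" for n x
  have q_lim: "(\<lambda>n. q n x) \<longlonglongrightarrow> h' x" if "x \<in> \<Omega>" for x
  proof -
    have "((\<lambda>s. (h s x - h t x) / (s - t)) \<longlongrightarrow> h' x) (at t within I)"
      using h that by (auto simp: dominated_derivative_def has_field_derivative_iff)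
    moreover have "filterlim Y (at t within I) sequentially" using Y by (auto simp: filterlim_at)
    ultimately show ?thesis unfolding q_def by (rule filterlim_compose)
  qed
  have q_meas: "q n \<in> borel_measurable (lebesgue_on \<Omega>)" for n
    unfolding q_def using meas[OF t] meas[OF Y(1)] by measurable
  have "(\<lambda>n. integral\<^sup>L (lebesgue_on \<Omega>) (q n)) \<longlonglongrightarrow> integral\<^sup>L (lebesgue_on \<Omega>) h'"
  proof (rule integral_dominated_convergence)
    show "h' \<in> borel_measurable (lebesgue_on \<Omega>)"
      by (rule borel_measurable_LIMSEQ_real[where u = q, OF _ q_meas]) (simp add: q_lim)
    show "integrable (lebesgue_on \<Omega>) (\<lambda>x. L)" by (rule integrable_bounded_on[OF \<Omega>, of _ "\<bar>L\<bar>"]) auto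
    show "AE x in lebesgue_on \<Omega>. (\<lambda>n. q n x) \<longlonglongrightarrow> h' x" by (intro AE_I2) (simp add: q_lim)
    show "AE x in lebesgue_on \<Omega>. norm (q n x) \<le> L" for n
      by (intro AE_I2) (use YL Y(2) in \<open>simp add: q_def abs_divide divide_le_eq\<close>)
  qed (rule q_meas)
  moreover have "integral\<^sup>L (lebesgue_on \<Omega>) (q n)
      = (integral\<^sup>L (lebesgue_on \<Omega>) (h (Y n)) - integral\<^sup>L (lebesgue_on \<Omega>) (h t)) / (Y n - t)" for n
    unfolding q_def using int_t int_Y by simp
  ultimately have "(\<lambda>n. (integral\<^sup>L (lebesgue_on \<Omega>) (h (X (n + N))) - integral\<^sup>L (lebesgue_on \<Omega>) (h t)) / (X (n + N) - t))
      \<longlonglongrightarrow> integral\<^sup>L (lebesgue_on \<Omega>) h'" by (simp add: Y_def)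
  then show "((\<lambda>s. (integral\<^sup>L (lebesgue_on \<Omega>) (h s) - integral\<^sup>L (lebesgue_on \<Omega>) (h t)) / (s - t)) \<circ> X)
      \<longlonglongrightarrow> integral\<^sup>L (lebesgue_on \<Omega>) h'"
    unfolding o_def by (rule LIMSEQ_offset)
qed

lemma dominated_derivative_energy:
  assumes t: "t \<in> I" and \<phi>: "dominated_derivative I t \<Omega> \<phi> \<phi>'"
    and \<sigma>: "\<And>b. b \<in> Basis \<Longrightarrow> dominated_derivative I t \<Omega> (\<lambda>s x. \<sigma> s x \<bullet> b) (\<lambda>x. \<sigma>' x \<bullet> b)"
  shows "dominated_derivative I t \<Omega>
    (\<lambda>s x. potential (\<phi> s x) + \<epsilon>\<^sup>2 / 2 * (norm (\<sigma> s x))\<^sup>2)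
    (\<lambda>x. (\<phi> t x ^ 3 - \<phi> t x) * \<phi>' x + \<epsilon>\<^sup>2 * (\<sigma> t x \<bullet> \<sigma>' x))"
proof -
  have const: "dominated_derivative I t \<Omega> (\<lambda>s x. c) (\<lambda>x. 0)" for c
    by (rule dominated_derivative_space_const) simp
  note P = dominated_derivative_mult[OF \<phi> \<phi>]
  note Q = dominated_derivative_sum[OF finite_Basis dominated_derivative_mult[OF \<sigma> \<sigma>]]
  note E = dominated_derivative_add[OF
      dominated_derivative_add[OF const[of "1/4"] dominated_derivative_add[OF
        dominated_derivative_mult[OF const[of "-1/2"] P]
        dominated_derivative_mult[OF const[of "1/4"] dominated_derivative_mult[OF P P]]]]
      dominated_derivative_mult[OF const[of "\<epsilon>\<^sup>2 / 2"] Q]]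
  show ?thesis
  proof (rule dominated_derivative_cong[OF E t])
    fix s x
    have "(norm (\<sigma> s x))\<^sup>2 = (\<Sum>b\<in>Basis. (\<sigma> s x \<bullet> b) * (\<sigma> s x \<bullet> b))"
      unfolding power2_norm_eq_inner by (rule euclidean_inner)
    then show "potential (\<phi> s x) + \<epsilon>\<^sup>2 / 2 * (norm (\<sigma> s x))\<^sup>2
      = 1/4 + (-1/2 * (\<phi> s x * \<phi> s x) + 1/4 * ((\<phi> s x * \<phi> s x) * (\<phi> s x * \<phi> s x)))
        + \<epsilon>\<^sup>2 / 2 * (\<Sum>b\<in>Basis. (\<sigma> s x \<bullet> b) * (\<sigma> s x \<bullet> b))"
      by (simp add: potential_def power2_eq_square field_simps)
    have "(\<Sum>b\<in>Basis. (\<sigma>' x \<bullet> b) * (\<sigma> t x \<bullet> b) + (\<sigma> t x \<bullet> b) * (\<sigma>' x \<bullet> b)) = 2 * (\<sigma> t x \<bullet> \<sigma>' x)"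
      by (subst euclidean_inner[of "\<sigma> t x" "\<sigma>' x"]) (simp add: sum.distrib mult.commute sum_distrib_left)
    then show "(\<phi> t x ^ 3 - \<phi> t x) * \<phi>' x + \<epsilon>\<^sup>2 * (\<sigma> t x \<bullet> \<sigma>' x)
      = 0 + (0 * (\<phi> t x * \<phi> t x) + -1/2 * (\<phi>' x * \<phi> t x + \<phi> t x * \<phi>' x)
          + (0 * ((\<phi> t x * \<phi> t x) * (\<phi> t x * \<phi> t x))
            + 1/4 * ((\<phi>' x * \<phi> t x + \<phi> t x * \<phi>' x) * (\<phi> t x * \<phi> t x)
              + (\<phi> t x * \<phi> t x) * (\<phi>' x * \<phi> t x + \<phi> t x * \<phi>' x))))
        + (0 * (\<Sum>b\<in>Basis. (\<sigma> t x \<bullet> b) * (\<sigma> t x \<bullet> b))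
          + \<epsilon>\<^sup>2 / 2 * (\<Sum>b\<in>Basis. (\<sigma>' x \<bullet> b) * (\<sigma> t x \<bullet> b) + (\<sigma> t x \<bullet> b) * (\<sigma>' x \<bullet> b)))"
      by (simp add: power3_eq_cube field_simps)
  qed
qed


section \<open>Finite-dimensional spaces of piecewise polynomials\<close>

lemma piecewise_polynomial_regular:
  fixes f :: "'a::euclidean_space \<Rightarrow> 'b::euclidean_space"
  assumes mesh: "conforming_mesh \<Omega> \<T>" and f: "piecewise_polynomial \<T> f"
  shows "\<And>K. K \<in> \<T> \<Longrightarrow> \<exists>p. continuous_on UNIV p \<and> (\<forall>x\<in>interior K. f x = p x)"
    and "f \<in> borel_measurable borel" and "bounded (range f)"
proof -
  have "\<forall>K\<in>\<T>. \<exists>p. continuous_on UNIV p \<and> (\<forall>x\<in>interior K. f x = p x)"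
    using f continuous_on_polymonial_function unfolding piecewise_polynomial_def by blast
  then show 1: "\<And>K. K \<in> \<T> \<Longrightarrow> \<exists>p. continuous_on UNIV p \<and> (\<forall>x\<in>interior K. f x = p x)" by blast
  from \<open>\<forall>K\<in>\<T>. \<exists>p. _\<close> obtain P where P: "\<And>K. K \<in> \<T> \<Longrightarrow> continuous_on UNIV (P K)"
    "\<And>K x. K \<in> \<T> \<Longrightarrow> x \<in> interior K \<Longrightarrow> f x = P K x" by metis
  let ?U = "\<Union>K\<in>\<T>. interior K"
  have off: "f x = 0" if "x \<notin> ?U" for x using f that by (simp add: piecewise_polynomial_def)
  have "continuous_on (interior K) f" if "K \<in> \<T>" for K
    by (rule continuous_on_eq[OF continuous_on_subset[OF P(1)[OF that]]]) (use P(2)[OF that] in auto)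
  then have "continuous_on ?U f" by (intro continuous_on_open_UN) auto
  then have "(\<lambda>x. indicator ?U x *\<^sub>R f x) \<in> borel_measurable borel"
    by (intro borel_measurable_continuous_on_indicator borel_open open_UN) auto
  moreover have "indicator ?U x *\<^sub>R f x = f x" for x using off[of x] by (simp add: indicator_def)
  ultimately show "f \<in> borel_measurable borel" by simp
  have "bounded (P K ` K)" if "K \<in> \<T>" for K
  proof -
    have "compact K" using mesh that polytope_imp_compact by (auto simp: conforming_mesh_def)
    then show ?thesis
      by (intro compact_imp_bounded compact_continuous_image continuous_on_subset[OF P(1)[OF that]]) auto
  qed
  then have "bounded ({0} \<union> (\<Union>K\<in>\<T>. P K ` K))"
    using mesh by (intro bounded_Un[THEN iffD2] conjI bounded_UN) (auto simp: conforming_mesh_def)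
  moreover have "range f \<subseteq> {0} \<union> (\<Union>K\<in>\<T>. P K ` K)"
    using off P(2) interior_subset by fastforce
  ultimately show "bounded (range f)" by (rule bounded_subset)
qed

lemma piecewise_polynomial_square_integrable:
  fixes f :: "'a::euclidean_space \<Rightarrow> 'b::euclidean_space"
  assumes \<Omega>: "bounded_lipschitz_domain \<Omega>" and mesh: "conforming_mesh \<Omega> \<T>" and f: "piecewise_polynomial \<T> f"
  shows "f \<in> borel_measurable (lebesgue_on \<Omega>)" "square_integrable \<Omega> f"
proof -
  show 1: "f \<in> borel_measurable (lebesgue_on \<Omega>)"
    using piecewise_polynomial_regular(2)[OF mesh f] by (simp add: measurable_completion measurable_restrict_space1)
  obtain C where "\<And>x. norm (f x) \<le> C" using piecewise_polynomial_regular(3)[OF mesh f] by (auto simp: bounded_iff)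
  then show "square_integrable \<Omega> f"
    using \<Omega> by (intro square_integrable_bounded_on[OF _ _ 1]) (auto simp: bounded_lipschitz_domain_def)
qed

lemma AE_in_cell_interiors:
  assumes \<Omega>: "bounded_lipschitz_domain \<Omega>" and mesh: "conforming_mesh \<Omega> \<T>"
  shows "AE x in lebesgue_on \<Omega>. x \<in> (\<Union>K\<in>\<T>. interior K)"
proof -
  have "negligible (\<Union>(frontier ` \<T>))"
    using mesh by (intro negligible_Union) (auto simp: conforming_mesh_def polytope_imp_convex intro!: negligible_convex_frontier)
  then have "AE x in lebesgue. x \<notin> \<Union>(frontier ` \<T>)"
    by (intro AE_I'[of "\<Union>(frontier ` \<T>)"]) (auto simp: negligible_iff_null_sets)
  then have "AE x in lebesgue. x \<in> \<Omega> \<longrightarrow> x \<in> (\<Union>K\<in>\<T>. interior K)"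
  proof (rule AE_mp, intro AE_I2 impI)
    fix x assume x: "x \<notin> \<Union>(frontier ` \<T>)" "x \<in> \<Omega>"
    have "x \<in> \<Union>\<T>" using mesh x(2) closure_subset by (auto simp: conforming_mesh_def)
    then show "x \<in> (\<Union>K\<in>\<T>. interior K)" using x(1) closure_subset by (fastforce simp: frontier_def)
  qed
  then show ?thesis
    using \<Omega> by (simp add: AE_restrict_space_iff bounded_lipschitz_domain_def)
qed

text \<open>Continuity in the cells turns a function that vanishes almost everywhere into one that vanishes
  in all cell interiors; outside of them it is zero by the choice of representatives.\<close>

lemma piecewise_polynomial_eq_0:
  fixes f :: "'a::euclidean_space \<Rightarrow> 'b::euclidean_space"
  assumes \<Omega>: "bounded_lipschitz_domain \<Omega>" and mesh: "conforming_mesh \<Omega> \<T>" and f: "piecewise_polynomial \<T> f"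
    and 0: "l2_inner \<Omega> f f = 0"
  shows "f = (\<lambda>x. 0)"
proof
  fix x
  have op: "open \<Omega>" using \<Omega> by (simp add: bounded_lipschitz_domain_def)
  show "f x = 0"
  proof (cases "x \<in> (\<Union>K\<in>\<T>. interior K)")
    case True
    then obtain K where K: "K \<in> \<T>" "x \<in> interior K" by auto
    obtain p where p: "continuous_on UNIV p" "\<And>x. x \<in> interior K \<Longrightarrow> f x = p x"
      using piecewise_polynomial_regular(1)[OF mesh f K(1)] by blast
    note sq = piecewise_polynomial_square_integrable(2)[OF \<Omega> mesh f]
    have "AE x in lebesgue_on \<Omega>. f x \<bullet> f x = 0"
      using integral_nonneg_eq_0_iff_AE[OF square_integrable_inner[OF sq sq]] 0 by (simp add: l2_inner_def)
    then have "AE x in lebesgue. x \<in> \<Omega> \<longrightarrow> f x = 0" using op by (simp add: AE_restrict_space_iff)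
    then obtain Z where Z: "Z \<in> null_sets lebesgue" "{x \<in> space lebesgue. \<not> (x \<in> \<Omega> \<longrightarrow> f x = 0)} \<subseteq> Z"
      unfolding eventually_ae_filter by blast
    have "negligible Z" using Z(1) by (simp add: negligible_iff_null_sets)
    moreover have "{x \<in> interior K. p x \<noteq> 0} \<subseteq> Z"
      using p(2) mesh_interior_subset(1)[OF \<Omega> mesh K(1)] Z(2) by auto
    ultimately have "negligible {x \<in> interior K. p x \<noteq> 0}" by (rule negligible_subset)
    moreover have "open {x \<in> interior K. p x \<noteq> 0}"
    proof -
      have "{x \<in> interior K. p x \<noteq> 0} = interior K \<inter> {x. p x \<noteq> 0}" by auto
      then show ?thesis using p(1) by (auto intro!: open_Int open_Collect_neq continuous_intros)
    qed
    ultimately have "{x \<in> interior K. p x \<noteq> 0} = {}" using open_not_negligible by blast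
    then show ?thesis using K p(2) by auto
  qed (use f in \<open>simp add: piecewise_polynomial_def\<close>)
qed

text \<open>Functionals that separate the points of a subspace \<open>W\<close> of a finite-dimensional function space
  contain a dual system of a basis of \<open>W\<close>.  With point evaluations this gives nodal bases, with inner
  products it replaces the Riesz representation.  In the induction step, subtract from a new
  element of \<open>W\<close> its expansion in the old basis; a functional that is nonzero on the remainder is the
  new one, and the old basis elements are corrected so that this functional vanishes on them.\<close>

lemma dual_basis:
  fixes B :: "('x \<Rightarrow> 'b::real_vector) set" and W :: "('x \<Rightarrow> 'b) set"
    and \<Lambda> :: "(('x \<Rightarrow> 'b) \<Rightarrow> real) set"
  assumes "finite B" "W \<subseteq> range (\<lambda>c x. \<Sum>b\<in>B. c b *\<^sub>R b x)"
    and "(\<lambda>x. 0) \<in> W" "\<And>f g c. f \<in> W \<Longrightarrow> g \<in> W \<Longrightarrow> (\<lambda>x. f x + c *\<^sub>R g x) \<in> W"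
    and "\<And>l f g c. l \<in> \<Lambda> \<Longrightarrow> f \<in> W \<Longrightarrow> g \<in> W \<Longrightarrow> l (\<lambda>x. f x + c *\<^sub>R g x) = l f + c * l g"
    and "\<And>f. f \<in> W \<Longrightarrow> f \<noteq> (\<lambda>x. 0) \<Longrightarrow> \<exists>l\<in>\<Lambda>. l f \<noteq> 0"
  shows "\<exists>(n::nat) l e. (\<forall>i<n. l i \<in> \<Lambda> \<and> e i \<in> W) \<and> (\<forall>i<n. \<forall>j<n. l i (e j) = (if i = j then 1 else 0)) \<and>
      (\<forall>f\<in>W. \<forall>x. f x = (\<Sum>i<n. l i f *\<^sub>R e i x))"
  using assms
proof (induction B arbitrary: W rule: finite_induct)
  case empty
  then have "W \<subseteq> {\<lambda>x. 0}" by auto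
  then show ?case by (intro exI[of _ 0]) auto
next
  case (insert b0 B)
  let ?S = "range (\<lambda>c x. \<Sum>b\<in>B. c b *\<^sub>R b x)"
  note W0 = insert.prems(2) and Wadd = insert.prems(3) and lin = insert.prems(4) and sep = insert.prems(5)
  have SI: "(\<lambda>x. \<Sum>b\<in>B. c b *\<^sub>R b x) \<in> ?S" for c
    using rangeI[of "\<lambda>c x. \<Sum>b\<in>B. c b *\<^sub>R b x" c] .
  have S_add: "(\<lambda>x. f x + c *\<^sub>R g x) \<in> ?S" if "f \<in> ?S" "g \<in> ?S" for f g c
  proof -
    obtain \<alpha> \<beta> where "f = (\<lambda>x. \<Sum>b\<in>B. \<alpha> b *\<^sub>R b x)" "g = (\<lambda>x. \<Sum>b\<in>B. \<beta> b *\<^sub>R b x)" using \<open>f \<in> ?S\<close> \<open>g \<in> ?S\<close> by auto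
    then have "(\<lambda>x. f x + c *\<^sub>R g x) = (\<lambda>x. \<Sum>b\<in>B. (\<alpha> b + c * \<beta> b) *\<^sub>R b x)"
      by (simp add: scaleR_add_left sum.distrib scaleR_sum_right)
    then show ?thesis using SI by simp
  qed
  have S0: "(\<lambda>x. 0) \<in> ?S" by (rule image_eqI[of _ _ "\<lambda>_. 0"]) auto
  have comb: "(\<lambda>x. f x + (\<Sum>i<n. c i *\<^sub>R e i x)) \<in> V"
    if "f \<in> V" "\<forall>i<n. e i \<in> V" "\<And>f g c. f \<in> V \<Longrightarrow> g \<in> V \<Longrightarrow> (\<lambda>x. f x + c *\<^sub>R g x) \<in> V"
    for f V and n :: nat and c e
    using that(2)
  proof (induction n)
    case 0 show ?case using that(1) by simp
  next
    case (Suc n)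
    then have "(\<lambda>x. f x + (\<Sum>i<n. c i *\<^sub>R e i x)) \<in> V" "e n \<in> V" by auto
    from that(3)[OF this, of "c n"] show ?case by (simp add: add.assoc)
  qed
  have lcomb: "l (\<lambda>x. f x + (\<Sum>i<n. c i *\<^sub>R e i x)) = l f + (\<Sum>i<n. c i * l (e i))"
    if "l \<in> \<Lambda>" "f \<in> W" "\<forall>i<n. e i \<in> W" for l f and n :: nat and c e
    using that(3)
  proof (induction n)
    case (Suc n)
    have "(\<lambda>x. f x + (\<Sum>i<n. c i *\<^sub>R e i x)) \<in> W" using comb[of f W n e c] Suc.prems that(2) Wadd by simp
    from lin[OF that(1) this, of "e n" "c n"] Suc show ?case by (simp add: add.assoc)
  qed simp
  define W' where "W' = W \<inter> ?S"
  have "\<exists>(n::nat) l e. (\<forall>i<n. l i \<in> \<Lambda> \<and> e i \<in> W') \<and> (\<forall>i<n. \<forall>j<n. l i (e j) = (if i = j then 1 else 0)) \<and>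
      (\<forall>f\<in>W'. \<forall>x. f x = (\<Sum>i<n. l i f *\<^sub>R e i x))"
  proof (rule insert.IH)
    show "W' \<subseteq> ?S" by (simp add: W'_def)
    show "(\<lambda>x. 0) \<in> W'" using W0 S0 by (simp add: W'_def)
    show "(\<lambda>x. f x + c *\<^sub>R g x) \<in> W'" if "f \<in> W'" "g \<in> W'" for f g c
      using that Wadd[of f g c] S_add[of f g c] unfolding W'_def by blast
    show "l (\<lambda>x. f x + c *\<^sub>R g x) = l f + c * l g" if "l \<in> \<Lambda>" "f \<in> W'" "g \<in> W'" for l f g c
      using lin[OF that(1)] that unfolding W'_def by blast
    show "\<exists>l\<in>\<Lambda>. l f \<noteq> 0" if "f \<in> W'" "f \<noteq> (\<lambda>x. 0)" for f
      using sep[OF _ that(2)] that unfolding W'_def by blast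
  qed
  then obtain n :: nat and l e where IH1: "\<And>i. i < n \<Longrightarrow> l i \<in> \<Lambda>" "\<And>i. i < n \<Longrightarrow> e i \<in> W'"
    and IH2: "\<And>i j. i < n \<Longrightarrow> j < n \<Longrightarrow> l i (e j) = (if i = j then 1 else 0)"
    and IH3: "\<And>f x. f \<in> W' \<Longrightarrow> f x = (\<Sum>i<n. l i f *\<^sub>R e i x)" by blast
  have eW: "e i \<in> W" "e i \<in> ?S" if "i < n" for i using IH1(2)[OF that] by (auto simp: W'_def)
  show ?case
  proof (cases "W \<subseteq> ?S")
    case True
    then have "W' = W" by (auto simp: W'_def)
    then show ?thesis using IH1 IH2 IH3 by blast
  next
    case False
    then obtain w0 where w0: "w0 \<in> W" "w0 \<notin> ?S" by blast
    \<comment> \<open>The remainder is annihilated by all old functionals, but it is not in the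
      span of \<open>B\<close>.\<close>
    define r where "r = (\<lambda>x. w0 x + (\<Sum>i<n. (- l i w0) *\<^sub>R e i x))"
    have rW: "r \<in> W" unfolding r_def by (rule comb) (use w0 eW Wadd in auto)
    have lr: "l j r = 0" if "j < n" for j
    proof -
      have "l j r = l j w0 + (\<Sum>i<n. (- l i w0) * l j (e i))"
        unfolding r_def by (rule lcomb) (use IH1 eW w0 that in auto)
      also have "(\<Sum>i<n. (- l i w0) * l j (e i)) = (\<Sum>i<n. if i = j then - l j w0 else 0)"
        using IH2[OF that] by (intro sum.cong) auto
      finally show ?thesis using that by simp
    qed
    have "r \<notin> ?S"
    proof
      assume "r \<in> ?S"
      then have "(\<lambda>x. r x + (\<Sum>i<n. l i w0 *\<^sub>R e i x)) \<in> ?S"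
        using eW S_add by (intro comb) auto
      moreover have "(\<lambda>x. r x + (\<Sum>i<n. l i w0 *\<^sub>R e i x)) = w0"
        by (simp add: r_def sum_negf)
      ultimately show False using w0(2) by simp
    qed
    then have "r \<noteq> (\<lambda>x. 0)" using S0 by auto
    then obtain l0 where l0: "l0 \<in> \<Lambda>" "l0 r \<noteq> 0" using sep[OF rW] by blast
    have l_scale: "(\<lambda>x. c *\<^sub>R f x) \<in> W" "k \<in> \<Lambda> \<Longrightarrow> k (\<lambda>x. c *\<^sub>R f x) = c * k f" if "f \<in> W" for k c f
    proof -
      show "(\<lambda>x. c *\<^sub>R f x) \<in> W" using Wadd[OF W0 that, of c] by simp
      assume k: "k \<in> \<Lambda>"
      have "k (\<lambda>x. 0) = 0" using lin[OF k W0 W0, of 1] by simp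
      then show "k (\<lambda>x. c *\<^sub>R f x) = c * k f" using lin[OF k W0 that, of c] by simp
    qed
    define en where "en = (\<lambda>x. (1 / l0 r) *\<^sub>R r x)"
    have enW: "en \<in> W" unfolding en_def by (rule l_scale(1)[OF rW])
    have l0en: "l0 en = 1" unfolding en_def using l_scale(2)[OF rW l0(1)] l0(2) by simp
    have len: "l j en = 0" if "j < n" for j
      unfolding en_def using l_scale(2)[OF rW IH1(1)[OF that]] lr[OF that] by simp
    define e' where "e' i = (if i < n then (\<lambda>x. e i x + (- l0 (e i)) *\<^sub>R en x) else en)" for i
    define l' where "l' i = (if i < n then l i else l0)" for i
    have e'W: "e' i \<in> W" for i
    proof (cases "i < n")
      case True
      then show ?thesis using Wadd[OF eW(1)[OF True] enW, of "- l0 (e i)"] by (simp only: e'_def if_True)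
    qed (use enW in \<open>simp add: e'_def\<close>)
    have l'\<Lambda>: "l' i \<in> \<Lambda>" for i using IH1(1) l0(1) by (simp add: l'_def)
    have le: "k (e' i) = k (e i) - l0 (e i) * k en" if "i < n" "k \<in> \<Lambda>" for i k
      using lin[OF that(2) eW(1)[OF that(1)] enW, of "- l0 (e i)"] that(1) by (simp add: e'_def)
    have dual: "l' i (e' j) = (if i = j then 1 else 0)" if "i < Suc n" "j < Suc n" for i j
    proof (cases "j < n")
      case True
      then show ?thesis
        using le[OF True l'\<Lambda>[of i]] that IH2[of i j] len[of i] l0en by (auto simp: l'_def)
    next
      case False
      then show ?thesis using that len[of i] l0en by (auto simp: e'_def l'_def)
    qed
    have expand: "f x = (\<Sum>i<Suc n. l' i f *\<^sub>R e' i x)" if f: "f \<in> W" for f x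
    proof -
      obtain \<alpha> where \<alpha>: "w0 = (\<lambda>x. \<Sum>b\<in>insert b0 B. \<alpha> b *\<^sub>R b x)" using insert.prems(1) w0(1) by blast
      obtain \<beta> where \<beta>: "f = (\<lambda>x. \<Sum>b\<in>insert b0 B. \<beta> b *\<^sub>R b x)" using insert.prems(1) f by blast
      have \<alpha>0: "\<alpha> b0 \<noteq> 0"
      proof
        assume "\<alpha> b0 = 0"
        then have "w0 = (\<lambda>x. \<Sum>b\<in>B. \<alpha> b *\<^sub>R b x)" using \<alpha> insert.hyps by simp
        then show False using w0(2) SI[of \<alpha>] by simp
      qed
      \<comment> \<open>Chosen so that \<open>b0\<close> drops out of
        \<open>f - \<kappa> r\<close>.\<close>
      define \<kappa> where "\<kappa> = \<beta> b0 / \<alpha> b0"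
      define f' where "f' = (\<lambda>x. f x + (- \<kappa>) *\<^sub>R r x)"
      have f'W: "f' \<in> W" unfolding f'_def by (rule Wadd[OF f rW])
      have "(\<lambda>x. (\<Sum>b\<in>B. (\<beta> b - \<kappa> * \<alpha> b) *\<^sub>R b x) + (\<Sum>i<n. (\<kappa> * l i w0) *\<^sub>R e i x)) \<in> ?S"
        using eW(2) S_add SI by (intro comb) auto
      moreover have "(\<lambda>x. (\<Sum>b\<in>B. (\<beta> b - \<kappa> * \<alpha> b) *\<^sub>R b x) + (\<Sum>i<n. (\<kappa> * l i w0) *\<^sub>R e i x)) = f'"
      proof
        fix x
        have "\<kappa> *\<^sub>R w0 x = \<beta> b0 *\<^sub>R b0 x + (\<Sum>b\<in>B. (\<kappa> * \<alpha> b) *\<^sub>R b x)"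
          using insert.hyps \<alpha>0 by (simp add: \<alpha> scaleR_add_right scaleR_sum_right \<kappa>_def)
        moreover have "f x = \<beta> b0 *\<^sub>R b0 x + (\<Sum>b\<in>B. \<beta> b *\<^sub>R b x)" using insert.hyps by (simp add: \<beta>)
        ultimately show "(\<Sum>b\<in>B. (\<beta> b - \<kappa> * \<alpha> b) *\<^sub>R b x) + (\<Sum>i<n. (\<kappa> * l i w0) *\<^sub>R e i x) = f' x"
          unfolding f'_def r_def by (simp add: scaleR_diff_left scaleR_diff_right sum_subtractf scaleR_add_right scaleR_sum_right sum_negf)
      qed
      ultimately have "f' \<in> W'" using f'W by (simp add: W'_def)
      from IH3[OF this, of x] have f'x: "f' x = (\<Sum>i<n. l i f' *\<^sub>R e i x)" .
      have lf': "l i f' = l i f" if "i < n" for i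
        using lin[OF IH1(1)[OF that] f rW, of "- \<kappa>"] lr[OF that] by (simp add: f'_def)
      have fx: "f y = (\<kappa> * l0 r) *\<^sub>R en y + (\<Sum>i<n. l i f *\<^sub>R e i y)" for y
      proof -
        have "f y = \<kappa> *\<^sub>R r y + f' y" by (simp add: f'_def)
        also have "f' y = (\<Sum>i<n. l i f *\<^sub>R e i y)" using IH3[OF \<open>f' \<in> W'\<close>, of y] lf' by simp
        finally show ?thesis using l0(2) by (simp add: en_def)
      qed
      have "l0 f = \<kappa> * l0 r + (\<Sum>i<n. l i f * l0 (e i))"
      proof -
        have "(\<lambda>y. (\<kappa> * l0 r) *\<^sub>R en y) \<in> W" by (rule l_scale(1)[OF enW])
        from lcomb[OF l0(1) this, of n e "\<lambda>i. l i f"]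
        have "l0 (\<lambda>y. (\<kappa> * l0 r) *\<^sub>R en y + (\<Sum>i<n. l i f *\<^sub>R e i y))
            = l0 (\<lambda>y. (\<kappa> * l0 r) *\<^sub>R en y) + (\<Sum>i<n. l i f * l0 (e i))" using eW by blast
        moreover have "(\<lambda>y. (\<kappa> * l0 r) *\<^sub>R en y + (\<Sum>i<n. l i f *\<^sub>R e i y)) = f" using fx by auto
        ultimately show ?thesis using l_scale(2)[OF enW l0(1), of "\<kappa> * l0 r"] l0en by simp
      qed
      then have "l0 f *\<^sub>R en x = (\<kappa> * l0 r) *\<^sub>R en x + (\<Sum>i<n. (l i f * l0 (e i)) *\<^sub>R en x)"
        by (simp add: scaleR_add_left scaleR_sum_left)
      then show ?thesis
        using fx[of x] by (simp add: l'_def e'_def scaleR_diff_right sum_subtractf)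
    qed
    show ?thesis
      by (rule exI[of _ "Suc n"], rule exI[of _ l'], rule exI[of _ e'])
         (use l'\<Lambda> e'W dual expand in blast)
  qed
qed


section \<open>The semi-discrete equations\<close>

lemma l2_inner_commute: "l2_inner \<Omega> f g = l2_inner \<Omega> g f"
  by (simp add: l2_inner_def inner_commute)

lemma l2_inner_sum_right:
  assumes "square_integrable \<Omega> v" "\<And>i. i < n \<Longrightarrow> square_integrable \<Omega> (e i)"
  shows "l2_inner \<Omega> v (\<lambda>x. \<Sum>i<(n::nat). c i *\<^sub>R e i x) = (\<Sum>i<n. c i * l2_inner \<Omega> v (e i))"
proof -
  have "l2_inner \<Omega> v (\<lambda>x. \<Sum>i<n. c i *\<^sub>R e i x) = (\<integral>x. (\<Sum>i<n. c i * (v x \<bullet> e i x)) \<partial>lebesgue_on \<Omega>)"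
    by (simp add: l2_inner_def inner_sum_right)
  also have "\<dots> = (\<Sum>i<n. \<integral>x. c i * (v x \<bullet> e i x) \<partial>lebesgue_on \<Omega>)"
    using square_integrable_inner[OF assms(1) assms(2)]
    by (intro Bochner_Integration.integral_sum integrable_mult_right) auto
  finally show ?thesis by (simp add: l2_inner_def)
qed

lemma l2_inner_add_scaled:
  assumes "square_integrable \<Omega> v" "square_integrable \<Omega> f" "square_integrable \<Omega> g"
  shows "l2_inner \<Omega> (\<lambda>x. f x + c *\<^sub>R g x) v = l2_inner \<Omega> f v + c * l2_inner \<Omega> g v"
  using square_integrable_inner[OF assms(2,1)] square_integrable_inner[OF assms(3,1)]
  by (simp add: l2_inner_def inner_add_left)

lemma l2_norm_square: "(l2_norm \<Omega> f)\<^sup>2 = l2_inner \<Omega> f f"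
  unfolding l2_norm_def l2_inner_def by (rule real_sqrt_pow2) (simp add: integral_nonneg_AE)

lemma fin_dim_function_space_closed:
  assumes "fin_dim_function_space V"
  shows "(\<lambda>x. 0) \<in> V" "f \<in> V \<Longrightarrow> g \<in> V \<Longrightarrow> (\<lambda>x. f x + c *\<^sub>R g x) \<in> V"
proof -
  obtain B where V: "V = range (\<lambda>c x. \<Sum>b\<in>B. c b *\<^sub>R b x)"
    using assms by (auto simp: fin_dim_function_space_def)
  have I: "(\<lambda>x. \<Sum>b\<in>B. c b *\<^sub>R b x) \<in> V" for c
    unfolding V using rangeI[of "\<lambda>c x. \<Sum>b\<in>B. c b *\<^sub>R b x" c] .
  show "(\<lambda>x. 0) \<in> V" using I[of "\<lambda>_. 0"] by simp
  assume "f \<in> V" "g \<in> V"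
  then obtain \<alpha> \<beta> where "f = (\<lambda>x. \<Sum>b\<in>B. \<alpha> b *\<^sub>R b x)" "g = (\<lambda>x. \<Sum>b\<in>B. \<beta> b *\<^sub>R b x)"
    unfolding V by auto
  then have "(\<lambda>x. f x + c *\<^sub>R g x) = (\<lambda>x. \<Sum>b\<in>B. (\<alpha> b + c * \<beta> b) *\<^sub>R b x)"
    by (simp add: scaleR_add_left sum.distrib scaleR_sum_right)
  with I show "(\<lambda>x. f x + c *\<^sub>R g x) \<in> V" by simp
qed

lemma fin_dim_function_space_sum:
  assumes "fin_dim_function_space V" "\<And>i. i < n \<Longrightarrow> e i \<in> V"
  shows "(\<lambda>x. \<Sum>i<(n::nat). c i *\<^sub>R e i x) \<in> V"
  using assms(2)
proof (induction n)
  case 0 show ?case using fin_dim_function_space_closed(1)[OF assms(1)] by simp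
next
  case (Suc n)
  from fin_dim_function_space_closed(2)[OF assms(1) Suc.IH Suc.prems, of n "c n"] Suc.prems
  show ?case by simp
qed

lemma Vdiv0_closed:
  assumes V: "fin_dim_function_space V_div"
  shows "(\<lambda>x. 0) \<in> Vdiv0 \<Omega> \<T> V_div"
    "f \<in> Vdiv0 \<Omega> \<T> V_div \<Longrightarrow> g \<in> Vdiv0 \<Omega> \<T> V_div \<Longrightarrow> (\<lambda>x. f x + c *\<^sub>R g x) \<in> Vdiv0 \<Omega> \<T> V_div"
proof -
  show "(\<lambda>x. 0) \<in> Vdiv0 \<Omega> \<T> V_div"
    using fin_dim_function_space_closed(1)[OF V] by (simp add: Vdiv0_def zero_normal_trace_def)
  assume f: "f \<in> Vdiv0 \<Omega> \<T> V_div" and g: "g \<in> Vdiv0 \<Omega> \<T> V_div"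
  have add: "zero_normal_trace \<Omega> A G (\<lambda>x. f x + c *\<^sub>R g x)"
    if "zero_normal_trace \<Omega> A G f" "zero_normal_trace \<Omega> A G g" for A G
    unfolding zero_normal_trace_def
  proof (intro ballI allI impI)
    fix x \<nu> assume "x \<in> G" "outward_unit_normal \<Omega> x \<nu>"
    with that have "((\<lambda>y. f y \<bullet> \<nu>) \<longlongrightarrow> 0) (at x within A)" "((\<lambda>y. g y \<bullet> \<nu>) \<longlongrightarrow> 0) (at x within A)"
      unfolding zero_normal_trace_def by blast+
    from tendsto_add[OF this(1) tendsto_mult_right_zero[OF this(2), of c]]
    show "((\<lambda>y. (f y + c *\<^sub>R g y) \<bullet> \<nu>) \<longlongrightarrow> 0) (at x within A)" by (simp add: inner_add_left)
  qed
  have "(\<lambda>x. f x + c *\<^sub>R g x) \<in> V_div"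
    using fin_dim_function_space_closed(2)[OF V] f g by (simp add: Vdiv0_def)
  then show "(\<lambda>x. f x + c *\<^sub>R g x) \<in> Vdiv0 \<Omega> \<T> V_div"
    using f g add unfolding Vdiv0_def by blast
qed

lemma interval_limit_point:
  fixes I :: "real set"
  assumes "is_interval I" "interior I \<noteq> {}" "t \<in> I"
  shows "at t within I \<noteq> bot"
proof -
  have "connected I" using assms(1) by (rule is_interval_connected)
  moreover have "\<nexists>a. I = {a}" using assms(2) by auto
  ultimately have "t islimpt I" using connected_imp_perfect assms(3) by blast
  then show ?thesis by (simp add: trivial_limit_within)
qed

lemma weak_div_compatible:
  assumes "compatible_fe_spaces \<Omega> \<T> V_DG V_div" "v \<in> V_div"
  shows "has_weak_div \<Omega> v (weak_div \<Omega> v)"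
  using assms unfolding compatible_fe_spaces_def weak_div_def by (metis someI_ex)

lemma integral_weak_div_Vdiv0:
  assumes \<Omega>: "bounded_lipschitz_domain \<Omega>" and mesh: "conforming_mesh \<Omega> \<T>"
    and fe: "compatible_fe_spaces \<Omega> \<T> V_DG V_div" and v: "v \<in> Vdiv0 \<Omega> \<T> V_div"
  shows "integral\<^sup>L (lebesgue_on \<Omega>) (weak_div \<Omega> v) = 0"
proof (rule integral_weak_divergence_eq_0[OF \<Omega> mesh])
  have op: "open \<Omega>" "bounded \<Omega>" using \<Omega> by (auto simp: bounded_lipschitz_domain_def)
  have vV: "v \<in> V_div" using v by (simp add: Vdiv0_def)
  have pp: "piecewise_polynomial \<T> v" using fe vV by (simp add: compatible_fe_spaces_def)
  note reg = piecewise_polynomial_regular[OF mesh pp]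
  note wd = weak_div_compatible[OF fe vV]
  show "(\<lambda>x. if x \<in> \<Omega> then v x else 0) \<in> borel_measurable borel"
    using reg(2) op by (intro measurable_If_set) auto
  show "bounded (v ` \<Omega>)" using reg(3) by (rule bounded_subset) auto
  show "\<exists>p. continuous_on UNIV p \<and> (\<forall>x\<in>interior K. v x = p x)" if "K \<in> \<T>" for K using reg(1)[OF that] .
  have "square_integrable \<Omega> (\<lambda>x. 1::real)"
    by (rule square_integrable_bounded_on[OF op, of _ 1]) auto
  from square_integrable_inner[OF _ this, of "weak_div \<Omega> v"] wd
  show "integrable (lebesgue_on \<Omega>) (weak_div \<Omega> v)" by (simp add: has_weak_div_def)
  show "l2_inner \<Omega> v (gradient \<eta>) = - l2_inner \<Omega> (weak_div \<Omega> v) \<eta>" if "test_function \<Omega> \<eta>" for \<eta>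
    using wd that by (simp add: has_weak_div_def)
  show "zero_normal_trace \<Omega> (interior K) G v" if "K \<in> \<T>" "G facet_of K" "G \<subseteq> frontier \<Omega>" for K G
    using v that by (simp add: Vdiv0_def)
qed

text \<open>The difference of two candidates is an admissible test function, hence orthogonal to itself.\<close>

lemma weak_gradient_unique:
  assumes \<Omega>: "bounded_lipschitz_domain \<Omega>" and mesh: "conforming_mesh \<Omega> \<T>"
    and fe: "compatible_fe_spaces \<Omega> \<T> V_DG V_div"
    and \<sigma>: "\<sigma> \<in> Vdiv0 \<Omega> \<T> V_div" "\<And>v. v \<in> Vdiv0 \<Omega> \<T> V_div \<Longrightarrow> l2_inner \<Omega> v \<sigma> = - l2_inner \<Omega> (weak_div \<Omega> v) \<psi>"
  shows "weak_gradient \<Omega> \<T> V_div \<psi> = \<sigma>"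
  unfolding weak_gradient_def
proof (rule the_equality)
  show "\<sigma> \<in> Vdiv0 \<Omega> \<T> V_div \<and> (\<forall>v\<in>Vdiv0 \<Omega> \<T> V_div. l2_inner \<Omega> v \<sigma> = - l2_inner \<Omega> (weak_div \<Omega> v) \<psi>)"
    using \<sigma> by blast
  fix \<tau> assume \<tau>: "\<tau> \<in> Vdiv0 \<Omega> \<T> V_div \<and> (\<forall>v\<in>Vdiv0 \<Omega> \<T> V_div. l2_inner \<Omega> v \<tau> = - l2_inner \<Omega> (weak_div \<Omega> v) \<psi>)"
  define \<delta> where "\<delta> = (\<lambda>x. \<tau> x + (-1) *\<^sub>R \<sigma> x)"
  have V: "fin_dim_function_space V_div" using fe by (simp add: compatible_fe_spaces_def)
  have pp: "piecewise_polynomial \<T> v" if "v \<in> Vdiv0 \<Omega> \<T> V_div" for v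
    using fe that by (simp add: compatible_fe_spaces_def Vdiv0_def)
  note sq = piecewise_polynomial_square_integrable(2)[OF \<Omega> mesh pp]
  have \<delta>: "\<delta> \<in> Vdiv0 \<Omega> \<T> V_div" unfolding \<delta>_def using Vdiv0_closed(2)[OF V] \<tau> \<sigma>(1) by blast
  have "l2_inner \<Omega> \<delta> \<delta> = l2_inner \<Omega> \<tau> \<delta> + (-1) * l2_inner \<Omega> \<sigma> \<delta>"
    using l2_inner_add_scaled[of \<Omega> \<delta> \<tau> \<sigma> "-1"] sq \<delta> \<tau> \<sigma>(1) unfolding \<delta>_def by blast
  also have "\<dots> = 0" using \<tau> \<sigma>(2)[OF \<delta>] \<delta> by (simp add: l2_inner_commute[of \<Omega> _ \<delta>])
  finally have "\<delta> = (\<lambda>x. 0)" using piecewise_polynomial_eq_0[OF \<Omega> mesh pp[OF \<delta>]] by simp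
  then show "\<tau> = \<sigma>" unfolding \<delta>_def by (auto simp: fun_eq_iff)
qed

lemma dominated_derivative_vector_sum:
  fixes e :: "nat \<Rightarrow> 'a::euclidean_space \<Rightarrow> 'b::euclidean_space"
  assumes u: "\<And>i. i < n \<Longrightarrow> (u i has_real_derivative u' i) (at t within I)"
    and e: "\<And>i. i < n \<Longrightarrow> e i \<in> borel_measurable (lebesgue_on \<Omega>)" "\<And>i. i < n \<Longrightarrow> bounded (range (e i))"
  shows "dominated_derivative I t \<Omega> (\<lambda>s x. (\<Sum>i<n. u i s *\<^sub>R e i x) \<bullet> b) (\<lambda>x. (\<Sum>i<n. u' i *\<^sub>R e i x) \<bullet> b)"
proof -
  have "dominated_derivative I t \<Omega> (\<lambda>s x. u i s * (e i x \<bullet> b)) (\<lambda>x. u' i * (e i x \<bullet> b) + u i t * 0)" if i: "i < n" for i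
  proof (rule dominated_derivative_mult)
    show "dominated_derivative I t \<Omega> (\<lambda>s x. u i s) (\<lambda>x. u' i)"
      by (rule dominated_derivative_space_const[OF u[OF i]])
    show "dominated_derivative I t \<Omega> (\<lambda>s x. e i x \<bullet> b) (\<lambda>x. 0)"
    proof (rule dominated_derivative_time_const)
      show "(\<lambda>x. e i x \<bullet> b) \<in> borel_measurable (lebesgue_on \<Omega>)" using e(1)[OF i] by measurable
      obtain C where C: "\<And>x. norm (e i x) \<le> C" using e(2)[OF i] by (auto simp: bounded_iff)
      have "\<bar>e i x \<bullet> b\<bar> \<le> C * norm b" for x
        using Cauchy_Schwarz_ineq2[of "e i x" b] mult_right_mono[OF C[of x] norm_ge_zero[of b]] by linarith
      then show "bounded ((\<lambda>x. e i x \<bullet> b) ` \<Omega>)" by (auto simp: bounded_iff)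
    qed
  qed
  from dominated_derivative_sum[of "{..<n}", OF finite_lessThan this]
  show ?thesis by (simp add: inner_sum_left)
qed

text \<open>The coefficients in this basis are point values, so they inherit regularity in time from the
  pointwise regularity of a curve in \<open>V\<close>.\<close>

lemma nodal_basis:
  fixes V :: "('a \<Rightarrow> real) set"
  assumes "fin_dim_function_space V"
  obtains n :: nat and p e where "\<And>i. i < n \<Longrightarrow> e i \<in> V" "\<And>f x. f \<in> V \<Longrightarrow> f x = (\<Sum>i<n. f (p i) *\<^sub>R e i x)"
proof -
  obtain B where B: "finite B" "V = range (\<lambda>c x. \<Sum>b\<in>B. c b *\<^sub>R b x)"
    using assms by (auto simp: fin_dim_function_space_def)
  have "\<exists>(n::nat) l e. (\<forall>i<n. l i \<in> range (\<lambda>x f. f x) \<and> e i \<in> V) \<and> (\<forall>i<n. \<forall>j<n. l i (e j) = (if i = j then 1 else 0)) \<and>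
      (\<forall>f\<in>V. \<forall>x. f x = (\<Sum>i<n. l i f *\<^sub>R e i x))"
  proof (rule dual_basis[OF B(1)])
    show "V \<subseteq> range (\<lambda>c x. \<Sum>b\<in>B. c b *\<^sub>R b x)" using B(2) by simp
    show "(\<lambda>x. 0) \<in> V" by (rule fin_dim_function_space_closed(1)[OF assms])
    show "(\<lambda>x. f x + c *\<^sub>R g x) \<in> V" if "f \<in> V" "g \<in> V" for f g c
      by (rule fin_dim_function_space_closed(2)[OF assms that])
    show "l (\<lambda>x. f x + c *\<^sub>R g x) = l f + c * l g" if "l \<in> range (\<lambda>x f. f x)" "f \<in> V" "g \<in> V" for l f g c
      using that(1) by auto
    show "\<exists>l\<in>range (\<lambda>x f. f x). l f \<noteq> 0" if "f \<in> V" "f \<noteq> (\<lambda>x. 0)" for f :: "'a \<Rightarrow> real"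
      using that(2) by auto
  qed
  then obtain n :: nat and l e where le: "\<And>i. i < n \<Longrightarrow> l i \<in> range (\<lambda>x f. f x)" "\<And>i. i < n \<Longrightarrow> e i \<in> V"
    "\<And>f x. f \<in> V \<Longrightarrow> f x = (\<Sum>i<n. l i f *\<^sub>R e i x)" by blast
  have "\<forall>i<n. \<exists>x. l i = (\<lambda>f. f x)" using le(1) by auto
  then obtain p where p: "\<And>i. i < n \<Longrightarrow> l i = (\<lambda>f. f (p i))" by metis
  show thesis
  proof (rule that[of n e p])
    show "f x = (\<Sum>i<n. f (p i) *\<^sub>R e i x)" if "f \<in> V" for f x
      using le(3)[OF that, of x] p by simp
  qed (rule le(2))
qed

text \<open>The coefficients in this basis are inner products with elements of \<open>W\<close>.  For a weak gradient they
  are known explicitly in terms of the scalar function.\<close>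

lemma l2_coordinate_basis:
  fixes W V :: "('a::euclidean_space \<Rightarrow> 'a) set"
  assumes V: "fin_dim_function_space V" and W: "W \<subseteq> V" "(\<lambda>x. 0) \<in> W"
    "\<And>f g c. f \<in> W \<Longrightarrow> g \<in> W \<Longrightarrow> (\<lambda>x. f x + c *\<^sub>R g x) \<in> W"
    and sq: "\<And>f. f \<in> W \<Longrightarrow> square_integrable \<Omega> f"
    and pos: "\<And>f. f \<in> W \<Longrightarrow> l2_inner \<Omega> f f = 0 \<Longrightarrow> f = (\<lambda>x. 0)"
  obtains n :: nat and v b where "\<And>i. i < n \<Longrightarrow> v i \<in> W" "\<And>i. i < n \<Longrightarrow> b i \<in> W"
    "\<And>f x. f \<in> W \<Longrightarrow> f x = (\<Sum>i<n. l2_inner \<Omega> (v i) f *\<^sub>R b i x)"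
proof -
  obtain B where B: "finite B" "V = range (\<lambda>c x. \<Sum>b\<in>B. c b *\<^sub>R b x)"
    using V by (auto simp: fin_dim_function_space_def)
  let ?\<Lambda> = "(\<lambda>v f. l2_inner \<Omega> v f) ` W"
  have "\<exists>(n::nat) l e. (\<forall>i<n. l i \<in> ?\<Lambda> \<and> e i \<in> W) \<and> (\<forall>i<n. \<forall>j<n. l i (e j) = (if i = j then 1 else 0)) \<and>
      (\<forall>f\<in>W. \<forall>x. f x = (\<Sum>i<n. l i f *\<^sub>R e i x))"
  proof (rule dual_basis[OF B(1) _ W(2,3)])
    show "W \<subseteq> range (\<lambda>c x. \<Sum>b\<in>B. c b *\<^sub>R b x)" using B(2) W(1) by simp
    show "l (\<lambda>x. f x + c *\<^sub>R g x) = l f + c * l g" if l: "l \<in> ?\<Lambda>" and "f \<in> W" "g \<in> W" for l f g c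
    proof -
      obtain v where v: "v \<in> W" "l = l2_inner \<Omega> v" using l by auto
      show ?thesis
        using l2_inner_add_scaled[OF sq[OF v(1)] sq[OF \<open>f \<in> W\<close>] sq[OF \<open>g \<in> W\<close>], of c]
        by (simp add: v(2) l2_inner_commute[of \<Omega> v])
    qed
    show "\<exists>l\<in>?\<Lambda>. l f \<noteq> 0" if "f \<in> W" "f \<noteq> (\<lambda>x. 0)" for f
      using pos[OF that(1)] that by auto
  qed
  then obtain n :: nat and l e where le: "\<And>i. i < n \<Longrightarrow> l i \<in> ?\<Lambda>" "\<And>i. i < n \<Longrightarrow> e i \<in> W"
    "\<And>f x. f \<in> W \<Longrightarrow> f x = (\<Sum>i<n. l i f *\<^sub>R e i x)" by blast
  have "\<forall>i<n. \<exists>v\<in>W. l i = l2_inner \<Omega> v" using le(1) by auto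
  then obtain v where v: "\<And>i. i < n \<Longrightarrow> v i \<in> W" "\<And>i. i < n \<Longrightarrow> l i = l2_inner \<Omega> (v i)" by metis
  show thesis
  proof (rule that[of n v e])
    show "f x = (\<Sum>i<n. l2_inner \<Omega> (v i) f *\<^sub>R e i x)" if "f \<in> W" for f x
      using le(3)[OF that, of x] v(2) by simp
  qed (use le v in auto)
qed

text \<open>For the mass, the constant function is represented in the scalar space by the function that is
  one in the cell interiors, which is almost everywhere the same.\<close>

lemma dg_ch_conservation_laws:
  fixes \<Omega> :: "'a::euclidean_space set"
  assumes \<Omega>: "bounded_lipschitz_domain \<Omega>" and mesh: "conforming_mesh \<Omega> \<T>"
    and fe: "compatible_fe_spaces \<Omega> \<T> V_DG V_div"
    and I: "is_interval I" "interior I \<noteq> {}"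
    and d: "\<And>r. d r > 0"
    and S: "\<And>t. t \<in> I \<Longrightarrow> square_integrable \<Omega> (S t)"
    and sol: "dg_ch_solution I \<Omega> \<T> V_DG V_div \<epsilon> d S \<phi> j \<mu> \<sigma>"
    and t: "t \<in> I"
  shows "((\<lambda>s. integral\<^sup>L (lebesgue_on \<Omega>) (\<phi> s)) has_real_derivative integral\<^sup>L (lebesgue_on \<Omega>) (S t)) (at t within I)"
    and "((\<lambda>s. energy \<Omega> \<epsilon> (\<phi> s) (weak_gradient \<Omega> \<T> V_div (\<phi> s))) has_real_derivative
           - (l2_norm \<Omega> (\<lambda>x. (1 / sqrt (d (\<phi> t x))) *\<^sub>R j t x))\<^sup>2 + l2_inner \<Omega> (\<mu> t) (S t)) (at t within I)"
proof -
  let ?W = "Vdiv0 \<Omega> \<T> V_div"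
  have op: "open \<Omega>" "bounded \<Omega>" using \<Omega> by (auto simp: bounded_lipschitz_domain_def)
  have fin: "fin_dim_function_space V_DG" "fin_dim_function_space V_div"
    using fe by (auto simp: compatible_fe_spaces_def)
  have pp: "\<And>\<psi>. \<psi> \<in> V_DG \<Longrightarrow> piecewise_polynomial \<T> \<psi>" "\<And>v. v \<in> ?W \<Longrightarrow> piecewise_polynomial \<T> v"
    using fe by (auto simp: compatible_fe_spaces_def Vdiv0_def)
  note regD = piecewise_polynomial_regular[OF mesh pp(1)] and regW = piecewise_polynomial_regular[OF mesh pp(2)]
  note sqD = piecewise_polynomial_square_integrable[OF \<Omega> mesh pp(1)]
  note sqW = piecewise_polynomial_square_integrable[OF \<Omega> mesh pp(2)]
  have wd: "has_weak_div \<Omega> v (weak_div \<Omega> v)" "square_integrable \<Omega> (weak_div \<Omega> v)" if "v \<in> ?W" for v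
    using weak_div_compatible[OF fe, of v] that by (auto simp: Vdiv0_def has_weak_div_def)
  have mem: "\<phi> s \<in> V_DG" "j s \<in> ?W" "\<mu> s \<in> V_DG" "\<sigma> s \<in> ?W" if "s \<in> I" for s
    using sol that by (auto simp: dg_ch_solution_def)
  have eq1: "l2_inner \<Omega> \<psi> (\<lambda>x. time_deriv I \<phi> t x + weak_div \<Omega> (j t) x) = l2_inner \<Omega> \<psi> (S t)" if "\<psi> \<in> V_DG" for \<psi>
    using sol t that by (simp add: dg_ch_solution_def)
  have eq2: "l2_inner \<Omega> (\<lambda>x. (1 / d (\<phi> t x)) *\<^sub>R v x) (j t) = l2_inner \<Omega> (weak_div \<Omega> v) (\<mu> t)" if "v \<in> ?W" for v
    using sol t that by (simp add: dg_ch_solution_def)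
  have eq3: "l2_inner \<Omega> \<psi> (\<lambda>x. \<mu> t x - (\<phi> t x) ^ 3 + \<phi> t x + \<epsilon>\<^sup>2 * weak_div \<Omega> (\<sigma> t) x) = 0" if "\<psi> \<in> V_DG" for \<psi>
    using sol t that by (simp add: dg_ch_solution_def)
  have eq4: "l2_inner \<Omega> v (\<sigma> s) = - l2_inner \<Omega> (weak_div \<Omega> v) (\<phi> s)" if "v \<in> ?W" "s \<in> I" for v s
  proof -
    have "l2_inner \<Omega> v (\<sigma> s) + l2_inner \<Omega> (weak_div \<Omega> v) (\<phi> s) = 0"
      using sol that by (simp add: dg_ch_solution_def)
    then show ?thesis by linarith
  qed
  define \<phi>' where "\<phi>' = time_deriv I \<phi> t"
  have der: "((\<lambda>s. \<phi> s x) has_real_derivative \<phi>' x) (at t within I)" for x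
    using sol t unfolding dg_ch_solution_def \<phi>'_def time_deriv_def has_real_derivative_iff_has_vector_derivative
    by (auto simp: vector_derivative_works[symmetric])
  obtain n :: nat and p e where e: "\<And>i. i < n \<Longrightarrow> e i \<in> V_DG"
    "\<And>f x. f \<in> V_DG \<Longrightarrow> f x = (\<Sum>i<n. f (p i) *\<^sub>R e i x)"
    by (rule nodal_basis[OF fin(1)]) (rule that)
  have \<phi>_eq: "\<phi> s = (\<lambda>x. \<Sum>i<n. \<phi> s (p i) *\<^sub>R e i x)" if "s \<in> I" for s
    using e(2)[OF mem(1)[OF that]] by blast
  have \<phi>'_eq: "\<phi>' = (\<lambda>x. \<Sum>i<n. \<phi>' (p i) *\<^sub>R e i x)"
  proof
    fix x
    have "((\<lambda>s. \<Sum>i<n. \<phi> s (p i) *\<^sub>R e i x) has_real_derivative (\<Sum>i<n. \<phi>' (p i) *\<^sub>R e i x)) (at t within I)"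
      using der by (auto intro!: derivative_eq_intros)
    then have "((\<lambda>s. \<phi> s x) has_real_derivative (\<Sum>i<n. \<phi>' (p i) *\<^sub>R e i x)) (at t within I)"
    proof (rule has_field_derivative_transform_within[where d = 1])
      show "(\<Sum>i<n. \<phi> s (p i) *\<^sub>R e i x) = \<phi> s x" if "s \<in> I" for s
        using fun_cong[OF \<phi>_eq[OF that], of x] by simp
    qed (use t in auto)
    with der[of x] show "\<phi>' x = (\<Sum>i<n. \<phi>' (p i) *\<^sub>R e i x)"
      using vector_derivative_unique_within[OF interval_limit_point[OF I t]]
      unfolding has_real_derivative_iff_has_vector_derivative by blast
  qed
  have \<phi>'V: "\<phi>' \<in> V_DG"
    by (subst \<phi>'_eq) (rule fin_dim_function_space_sum[OF fin(1) e(1)])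
  have dd\<phi>: "dominated_derivative I t \<Omega> \<phi> \<phi>'"
  proof (rule dominated_derivative_cong[OF _ t])
    show "dominated_derivative I t \<Omega> (\<lambda>s x. (\<Sum>i<n. \<phi> s (p i) *\<^sub>R e i x) \<bullet> 1) (\<lambda>x. (\<Sum>i<n. \<phi>' (p i) *\<^sub>R e i x) \<bullet> 1)"
      using der sqD(1)[OF e(1)] regD(3)[OF e(1)] by (intro dominated_derivative_vector_sum) auto
    show "\<phi> s x = (\<Sum>i<n. \<phi> s (p i) *\<^sub>R e i x) \<bullet> 1" if "s \<in> I" for s x
      using fun_cong[OF \<phi>_eq[OF that], of x] by simp
    show "\<phi>' x = (\<Sum>i<n. \<phi>' (p i) *\<^sub>R e i x) \<bullet> 1" for x
      using fun_cong[OF \<phi>'_eq, of x] by simp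
  qed
  have mass: "l2_inner \<Omega> (\<lambda>x. if x \<in> (\<Union>K\<in>\<T>. interior K) then 1 else 0) f = integral\<^sup>L (lebesgue_on \<Omega>) f"
    if "square_integrable \<Omega> f" for f
    unfolding l2_inner_def
  proof (rule integral_cong_AE)
    have one: "(\<lambda>x. if x \<in> (\<Union>K\<in>\<T>. interior K) then 1 else (0::real)) \<in> V_DG"
      using fe by (simp add: compatible_fe_spaces_def)
    show "(\<lambda>x. (if x \<in> (\<Union>K\<in>\<T>. interior K) then 1 else 0) \<bullet> f x) \<in> borel_measurable (lebesgue_on \<Omega>)"
      using sqD(1)[OF one] that unfolding square_integrable_def by (intro borel_measurable_inner) auto
    show "f \<in> borel_measurable (lebesgue_on \<Omega>)" using that by (simp add: square_integrable_def)
    show "AE x in lebesgue_on \<Omega>. (if x \<in> (\<Union>K\<in>\<T>. interior K) then 1 else 0) \<bullet> f x = f x"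
      using AE_in_cell_interiors[OF \<Omega> mesh] by eventually_elim simp
  qed
  have sq\<phi>': "square_integrable \<Omega> \<phi>'" by (rule sqD(2)[OF \<phi>'V])
  have wj: "square_integrable \<Omega> (weak_div \<Omega> (j t))" by (rule wd(2)[OF mem(2)[OF t]])
  have w\<sigma>: "square_integrable \<Omega> (weak_div \<Omega> (\<sigma> t))" by (rule wd(2)[OF mem(4)[OF t]])
  have split1: "l2_inner \<Omega> \<psi> (\<lambda>x. \<phi>' x + weak_div \<Omega> (j t) x) = l2_inner \<Omega> \<psi> \<phi>' + l2_inner \<Omega> \<psi> (weak_div \<Omega> (j t))"
    if "\<psi> \<in> V_DG" for \<psi>
    using l2_inner_add_scaled[OF sqD(2)[OF that] sq\<phi>' wj, of 1] by (simp add: l2_inner_commute[of \<Omega> \<psi>])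
  show "((\<lambda>s. integral\<^sup>L (lebesgue_on \<Omega>) (\<phi> s)) has_real_derivative integral\<^sup>L (lebesgue_on \<Omega>) (S t)) (at t within I)"
  proof -
    have one: "(\<lambda>x. if x \<in> (\<Union>K\<in>\<T>. interior K) then 1 else (0::real)) \<in> V_DG"
      using fe by (simp add: compatible_fe_spaces_def)
    have "integral\<^sup>L (lebesgue_on \<Omega>) \<phi>' + integral\<^sup>L (lebesgue_on \<Omega>) (weak_div \<Omega> (j t)) = integral\<^sup>L (lebesgue_on \<Omega>) (S t)"
      using eq1[OF one] split1[OF one] mass[OF sq\<phi>'] mass[OF wj] mass[OF S[OF t]] by (simp add: \<phi>'_def)
    then have "integral\<^sup>L (lebesgue_on \<Omega>) (S t) = integral\<^sup>L (lebesgue_on \<Omega>) \<phi>'"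
      using integral_weak_div_Vdiv0[OF \<Omega> mesh fe mem(2)[OF t]] by simp
    then show ?thesis using dominated_derivative_integral[OF op t dd\<phi>] by simp
  qed
  obtain m :: nat and v b where vb: "\<And>i. i < m \<Longrightarrow> v i \<in> ?W" "\<And>i. i < m \<Longrightarrow> b i \<in> ?W"
    "\<And>f x. f \<in> ?W \<Longrightarrow> f x = (\<Sum>i<m. l2_inner \<Omega> (v i) f *\<^sub>R b i x)"
  proof (rule l2_coordinate_basis[OF fin(2), of ?W \<Omega>])
    show "?W \<subseteq> V_div" by (auto simp: Vdiv0_def)
    show "(\<lambda>x. 0) \<in> ?W" by (rule Vdiv0_closed(1)[OF fin(2)])
    show "(\<lambda>x. f x + c *\<^sub>R g x) \<in> ?W" if "f \<in> ?W" "g \<in> ?W" for f g c by (rule Vdiv0_closed(2)[OF fin(2) that])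
    show "square_integrable \<Omega> f" if "f \<in> ?W" for f by (rule sqW(2)[OF that])
    show "f = (\<lambda>x. 0)" if "f \<in> ?W" "l2_inner \<Omega> f f = 0" for f
      by (rule piecewise_polynomial_eq_0[OF \<Omega> mesh pp(2)[OF that(1)] that(2)])
  qed (rule that)
  have l2\<phi>: "l2_inner \<Omega> g (\<phi> s) = (\<Sum>i<n. \<phi> s (p i) * l2_inner \<Omega> g (e i))" if "square_integrable \<Omega> g" "s \<in> I" for g s
    by (subst \<phi>_eq[OF that(2)]) (rule l2_inner_sum_right[OF that(1) sqD(2)[OF e(1)]])
  have l2\<phi>_der: "((\<lambda>s. l2_inner \<Omega> g (\<phi> s)) has_real_derivative l2_inner \<Omega> g \<phi>') (at t within I)"
    if "square_integrable \<Omega> g" for g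
  proof -
    have 1: "l2_inner \<Omega> g \<phi>' = (\<Sum>i<n. \<phi>' (p i) * l2_inner \<Omega> g (e i))"
      by (subst \<phi>'_eq) (rule l2_inner_sum_right[OF that sqD(2)[OF e(1)]])
    have "((\<lambda>s. \<Sum>i<n. \<phi> s (p i) * l2_inner \<Omega> g (e i)) has_real_derivative l2_inner \<Omega> g \<phi>') (at t within I)"
      unfolding 1 using der by (auto intro!: derivative_eq_intros)
    then show ?thesis
      by (rule has_field_derivative_transform_within[where d = 1]) (use t l2\<phi>[OF that] in auto)
  qed
  \<comment> \<open>Tested with the \<open>v i\<close>, the defining equation of the weak gradient
    gives the coefficients of \<open>\<sigma> s\<close> as linear expressions in
    \<open>\<phi> s\<close>; \<open>\<sigma>'\<close> is their time derivative.\<close>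
  define \<sigma>' where "\<sigma>' = (\<lambda>x. \<Sum>i<m. (- l2_inner \<Omega> (weak_div \<Omega> (v i)) \<phi>') *\<^sub>R b i x)"
  have \<sigma>_eq: "\<sigma> s x = (\<Sum>i<m. (- l2_inner \<Omega> (weak_div \<Omega> (v i)) (\<phi> s)) *\<^sub>R b i x)" if "s \<in> I" for s x
    using vb(3)[OF mem(4)[OF that], of x] eq4[OF vb(1) that] by simp
  have coef: "((\<lambda>s. - l2_inner \<Omega> (weak_div \<Omega> (v i)) (\<phi> s)) has_real_derivative - l2_inner \<Omega> (weak_div \<Omega> (v i)) \<phi>') (at t within I)"
    if "i < m" for i
    by (rule DERIV_minus[OF l2\<phi>_der[OF wd(2)[OF vb(1)[OF that]]]])
  have dd\<sigma>: "dominated_derivative I t \<Omega> (\<lambda>s x. \<sigma> s x \<bullet> c) (\<lambda>x. \<sigma>' x \<bullet> c)" for c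
  proof (rule dominated_derivative_cong[OF _ t])
    show "dominated_derivative I t \<Omega> (\<lambda>s x. (\<Sum>i<m. (- l2_inner \<Omega> (weak_div \<Omega> (v i)) (\<phi> s)) *\<^sub>R b i x) \<bullet> c)
        (\<lambda>x. (\<Sum>i<m. (- l2_inner \<Omega> (weak_div \<Omega> (v i)) \<phi>') *\<^sub>R b i x) \<bullet> c)"
      using coef sqW(1)[OF vb(2)] regW(3)[OF vb(2)] by (intro dominated_derivative_vector_sum) auto
    show "\<sigma> s x \<bullet> c = (\<Sum>i<m. (- l2_inner \<Omega> (weak_div \<Omega> (v i)) (\<phi> s)) *\<^sub>R b i x) \<bullet> c" if "s \<in> I" for s x
      by (simp only: \<sigma>_eq[OF that])
  qed (simp add: \<sigma>'_def)
  have sq\<sigma>': "square_integrable \<Omega> \<sigma>'"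
  proof -
    have "\<sigma>' \<in> V_div" unfolding \<sigma>'_def
      using vb(2) by (intro fin_dim_function_space_sum[OF fin(2)]) (auto simp: Vdiv0_def)
    then have "piecewise_polynomial \<T> \<sigma>'" using fe by (simp add: compatible_fe_spaces_def)
    then show ?thesis by (rule piecewise_polynomial_square_integrable(2)[OF \<Omega> mesh])
  qed
  have weak_grad': "l2_inner \<Omega> w \<sigma>' = - l2_inner \<Omega> (weak_div \<Omega> w) \<phi>'" if w: "w \<in> ?W" for w
  proof -
    have lw: "l2_inner \<Omega> w (\<lambda>x. \<Sum>i<m. c i *\<^sub>R b i x) = (\<Sum>i<m. c i * l2_inner \<Omega> w (b i))" for c
      by (rule l2_inner_sum_right[OF sqW(2)[OF w] sqW(2)[OF vb(2)]])
    have "((\<lambda>s. \<Sum>i<m. (- l2_inner \<Omega> (weak_div \<Omega> (v i)) (\<phi> s)) * l2_inner \<Omega> w (b i))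
        has_real_derivative (\<Sum>i<m. (- l2_inner \<Omega> (weak_div \<Omega> (v i)) \<phi>') * l2_inner \<Omega> w (b i))) (at t within I)"
      using coef by (intro DERIV_sum DERIV_cmult_right) auto
    then have "((\<lambda>s. - l2_inner \<Omega> (weak_div \<Omega> w) (\<phi> s)) has_real_derivative l2_inner \<Omega> w \<sigma>') (at t within I)"
      unfolding \<sigma>'_def lw
    proof (rule has_field_derivative_transform_within[where d = 1])
      fix s assume s: "s \<in> I"
      have \<sigma>s: "\<sigma> s = (\<lambda>x. \<Sum>i<m. (- l2_inner \<Omega> (weak_div \<Omega> (v i)) (\<phi> s)) *\<^sub>R b i x)" using \<sigma>_eq[OF s] by blast
      show "(\<Sum>i<m. (- l2_inner \<Omega> (weak_div \<Omega> (v i)) (\<phi> s)) * l2_inner \<Omega> w (b i)) = - l2_inner \<Omega> (weak_div \<Omega> w) (\<phi> s)"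
        using eq4[OF w s] unfolding \<sigma>s lw .
    qed (use t in auto)
    moreover have "((\<lambda>s. - l2_inner \<Omega> (weak_div \<Omega> w) (\<phi> s)) has_real_derivative - l2_inner \<Omega> (weak_div \<Omega> w) \<phi>') (at t within I)"
      by (rule DERIV_minus[OF l2\<phi>_der[OF wd(2)[OF w]]])
    ultimately show ?thesis
      using vector_derivative_unique_within[OF interval_limit_point[OF I t]]
      unfolding has_real_derivative_iff_has_vector_derivative by blast
  qed
  have sq_cub: "square_integrable \<Omega> (\<lambda>x. \<phi> t x ^ 3 - \<phi> t x)"
  proof -
    obtain C where C: "\<And>x. \<bar>\<phi> t x\<bar> \<le> C" using regD(3)[OF mem(1)[OF t]] by (auto simp: bounded_iff)
    show ?thesis
    proof (rule square_integrable_bounded_on[OF op])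
      show "(\<lambda>x. \<phi> t x ^ 3 - \<phi> t x) \<in> borel_measurable (lebesgue_on \<Omega>)"
        using sqD(1)[OF mem(1)[OF t]] by measurable
      show "norm (\<phi> t x ^ 3 - \<phi> t x) \<le> C ^ 3 + C" for x
      proof -
        have "\<bar>\<phi> t x ^ 3\<bar> \<le> C ^ 3" unfolding power_abs by (rule power_mono[OF C]) simp
        then show ?thesis using C[of x] by simp
      qed
    qed
  qed
  have "((\<lambda>s. energy \<Omega> \<epsilon> (\<phi> s) (\<sigma> s)) has_real_derivative
      (\<integral>x. (\<phi> t x ^ 3 - \<phi> t x) * \<phi>' x + \<epsilon>\<^sup>2 * (\<sigma> t x \<bullet> \<sigma>' x) \<partial>lebesgue_on \<Omega>)) (at t within I)"
    unfolding energy_def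
    by (rule dominated_derivative_integral[OF op t dominated_derivative_energy[OF t dd\<phi> dd\<sigma>]])
  then have dE: "((\<lambda>s. energy \<Omega> \<epsilon> (\<phi> s) (weak_gradient \<Omega> \<T> V_div (\<phi> s))) has_real_derivative
      (\<integral>x. (\<phi> t x ^ 3 - \<phi> t x) * \<phi>' x + \<epsilon>\<^sup>2 * (\<sigma> t x \<bullet> \<sigma>' x) \<partial>lebesgue_on \<Omega>)) (at t within I)"
  proof (rule has_field_derivative_transform_within[where d = 1])
    fix s assume s: "s \<in> I"
    have "weak_gradient \<Omega> \<T> V_div (\<phi> s) = \<sigma> s"
      by (rule weak_gradient_unique[OF \<Omega> mesh fe mem(4)[OF s] eq4[OF _ s]])
    then show "energy \<Omega> \<epsilon> (\<phi> s) (\<sigma> s) = energy \<Omega> \<epsilon> (\<phi> s) (weak_gradient \<Omega> \<T> V_div (\<phi> s))" by simp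
  qed (use t in auto)
  have sq\<mu>: "square_integrable \<Omega> (\<mu> t)" by (rule sqD(2)[OF mem(3)[OF t]])
  have "(\<integral>x. (\<phi> t x ^ 3 - \<phi> t x) * \<phi>' x + \<epsilon>\<^sup>2 * (\<sigma> t x \<bullet> \<sigma>' x) \<partial>lebesgue_on \<Omega>)
      = l2_inner \<Omega> (\<lambda>x. \<phi> t x ^ 3 - \<phi> t x) \<phi>' + \<epsilon>\<^sup>2 * l2_inner \<Omega> (\<sigma> t) \<sigma>'"
    using square_integrable_inner[OF sq_cub sq\<phi>'] square_integrable_inner[OF sqW(2)[OF mem(4)[OF t]] sq\<sigma>']
    by (simp add: l2_inner_def)
  also have "\<dots> = l2_inner \<Omega> (\<lambda>x. \<phi> t x ^ 3 - \<phi> t x) \<phi>' - \<epsilon>\<^sup>2 * l2_inner \<Omega> (weak_div \<Omega> (\<sigma> t)) \<phi>'"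
    using weak_grad'[OF mem(4)[OF t]] by simp
  also have "\<dots> = l2_inner \<Omega> (\<mu> t) \<phi>'"
  proof -
    have "0 = l2_inner \<Omega> \<phi>' (\<lambda>x. \<mu> t x - \<phi> t x ^ 3 + \<phi> t x + \<epsilon>\<^sup>2 * weak_div \<Omega> (\<sigma> t) x)"
      using eq3[OF \<phi>'V] by simp
    also have "\<dots> = (\<integral>x. \<mu> t x \<bullet> \<phi>' x - (\<phi> t x ^ 3 - \<phi> t x) \<bullet> \<phi>' x + \<epsilon>\<^sup>2 * (weak_div \<Omega> (\<sigma> t) x \<bullet> \<phi>' x) \<partial>lebesgue_on \<Omega>)"
      unfolding l2_inner_def by (simp add: algebra_simps)
    also have "\<dots> = l2_inner \<Omega> (\<mu> t) \<phi>' - l2_inner \<Omega> (\<lambda>x. \<phi> t x ^ 3 - \<phi> t x) \<phi>' + \<epsilon>\<^sup>2 * l2_inner \<Omega> (weak_div \<Omega> (\<sigma> t)) \<phi>'"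
      unfolding l2_inner_def
      using square_integrable_inner[OF sq\<mu> sq\<phi>'] square_integrable_inner[OF sq_cub sq\<phi>'] square_integrable_inner[OF w\<sigma> sq\<phi>']
      by (simp del: inner_real_def)
    finally show ?thesis by linarith
  qed
  also have "\<dots> = l2_inner \<Omega> (\<mu> t) (S t) - l2_inner \<Omega> (weak_div \<Omega> (j t)) (\<mu> t)"
    using eq1[OF mem(3)[OF t]] split1[OF mem(3)[OF t]] by (simp add: \<phi>'_def l2_inner_commute[of \<Omega> "\<mu> t"])
  also have "l2_inner \<Omega> (weak_div \<Omega> (j t)) (\<mu> t) = l2_inner \<Omega> (\<lambda>x. (1 / d (\<phi> t x)) *\<^sub>R j t x) (j t)"
    using eq2[OF mem(2)[OF t]] by simp
  also have "\<dots> = (l2_norm \<Omega> (\<lambda>x. (1 / sqrt (d (\<phi> t x))) *\<^sub>R j t x))\<^sup>2"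
    by (simp add: l2_norm_square l2_inner_def real_sqrt_mult_self less_imp_le[OF d] mult.assoc[symmetric] abs_of_pos[OF d])
  finally have E: "(\<integral>x. (\<phi> t x ^ 3 - \<phi> t x) * \<phi>' x + \<epsilon>\<^sup>2 * (\<sigma> t x \<bullet> \<sigma>' x) \<partial>lebesgue_on \<Omega>)
      = l2_inner \<Omega> (\<mu> t) (S t) - (l2_norm \<Omega> (\<lambda>x. (1 / sqrt (d (\<phi> t x))) *\<^sub>R j t x))\<^sup>2" .
  show "((\<lambda>s. energy \<Omega> \<epsilon> (\<phi> s) (weak_gradient \<Omega> \<T> V_div (\<phi> s))) has_real_derivative
           - (l2_norm \<Omega> (\<lambda>x. (1 / sqrt (d (\<phi> t x))) *\<^sub>R j t x))\<^sup>2 + l2_inner \<Omega> (\<mu> t) (S t)) (at t within I)"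
    using dE unfolding E by simp
qed


section \<open>The continuous equation\<close>

text \<open>The interval of times may be open or half-open, whereas regularity in space and time is given
  on compact sets of times.\<close>

lemma compact_time_neighbourhood:
  fixes I :: "real set"
  assumes I: "is_interval I" and t: "t \<in> I"
  obtains \<alpha> \<beta> where "{\<alpha>..\<beta>} \<subseteq> I" "t \<in> {\<alpha>..\<beta>}" "\<forall>\<^sub>F s in at t within I. s \<in> {\<alpha>..\<beta>}"
proof -
  have "\<exists>\<beta>\<in>I. t \<le> \<beta> \<and> (\<beta> = t \<longrightarrow> (\<forall>s\<in>I. s \<le> t))"
    
  proof (cases "\<exists>s\<in>I. t < s")
    case True
    then obtain s where "s \<in> I" "t < s" by blast
    then show ?thesis by (intro bexI[of _ s]) auto
  qed (use t in \<open>auto simp: not_less\<close>)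
  then obtain \<beta> where \<beta>: "\<beta> \<in> I" "t \<le> \<beta>" "\<beta> = t \<Longrightarrow> \<forall>s\<in>I. s \<le> t" by auto
  have "\<exists>\<alpha>\<in>I. \<alpha> \<le> t \<and> (\<alpha> = t \<longrightarrow> (\<forall>s\<in>I. t \<le> s))"
    
  proof (cases "\<exists>s\<in>I. s < t")
    case True
    then obtain s where "s \<in> I" "s < t" by blast
    then show ?thesis by (intro bexI[of _ s]) auto
  qed (use t in \<open>auto simp: not_less\<close>)
  then obtain \<alpha> where \<alpha>: "\<alpha> \<in> I" "\<alpha> \<le> t" "\<alpha> = t \<Longrightarrow> \<forall>s\<in>I. t \<le> s" by auto
  show thesis
  proof
    show "{\<alpha>..\<beta>} \<subseteq> I" 
      using I[unfolded is_interval_1, rule_format, OF \<alpha>(1) \<beta>(1)] by auto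
    show "t \<in> {\<alpha>..\<beta>}" using \<alpha> \<beta> by simp
    have "\<forall>\<^sub>F s in at t within I. s \<in> I" by (simp add: eventually_at_filter)
    moreover have "\<forall>\<^sub>F s in at t within I. s \<in> I \<longrightarrow> s \<le> \<beta>"
    proof (cases "\<beta> = t")
      case False
      then have "\<forall>\<^sub>F s in at t within I. s < \<beta>"
        using \<beta>(2) by (intro order_tendstoD(2)[OF tendsto_ident_at]) simp
      then show ?thesis by eventually_elim simp
    qed (use \<beta>(3) in auto)
    moreover have "\<forall>\<^sub>F s in at t within I. s \<in> I \<longrightarrow> \<alpha> \<le> s"
    proof (cases "\<alpha> = t")
      case False
      then have "\<forall>\<^sub>F s in at t within I. \<alpha> < s"
        using \<alpha>(2) by (intro order_tendstoD(1)[OF tendsto_ident_at]) simp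
      then show ?thesis by eventually_elim simp
    qed (use \<alpha>(3) in auto)
    ultimately show "\<forall>\<^sub>F s in at t within I. s \<in> {\<alpha>..\<beta>}" by eventually_elim simp
  qed
qed

lemma C0_spacetime_bounded:
  assumes "C0_spacetime I \<Omega> u" "bounded \<Omega>" "{\<alpha>..\<beta>} \<subseteq> I"
  obtains C where "\<And>s x. s \<in> {\<alpha>..\<beta>} \<Longrightarrow> x \<in> \<Omega> \<Longrightarrow> norm (u s x) \<le> C"
proof -
  have "uniformly_continuous_on ({\<alpha>..\<beta>} \<times> \<Omega>) (\<lambda>(t, x). u t x)"
    using assms(1,3) by (simp add: C0_spacetime_def)
  moreover have "bounded ({\<alpha>..\<beta>} \<times> \<Omega>)" using assms(2) by (intro bounded_Times) auto
  ultimately have "bounded ((\<lambda>(t, x). u t x) ` ({\<alpha>..\<beta>} \<times> \<Omega>))" by (rule bounded_uniformly_continuous_image)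
  then obtain C where C: "\<forall>z\<in>(\<lambda>(t, x). u t x) ` ({\<alpha>..\<beta>} \<times> \<Omega>). norm z \<le> C" by (auto simp: bounded_iff)
  show thesis by (rule that[of C]) (use C in force)
qed

text \<open>The second difference of \<open>u\<close> in time and in the direction \<open>v\<close> is estimated by the mean value
  theorem, first in space for the time derivative \<open>ut\<close> and then in time.  The continuity of the
  gradient of \<open>ut\<close> makes the error small relative to the product of the increments, and the spatial
  increment is sent to zero first.\<close>

lemma gradient_time_derivative_commute:
  fixes u ut :: "real \<Rightarrow> 'a::euclidean_space \<Rightarrow> real"
  assumes \<Omega>: "open \<Omega>" and I: "is_interval I" and t: "t \<in> I" and x: "x \<in> \<Omega>"
    and u: "\<And>s x. s \<in> I \<Longrightarrow> x \<in> \<Omega> \<Longrightarrow> u s differentiable (at x)"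
    and ut: "\<And>s x. s \<in> I \<Longrightarrow> x \<in> \<Omega> \<Longrightarrow> ((\<lambda>s. u s x) has_real_derivative ut s x) (at s within I)"
    and utx: "\<And>s x. s \<in> I \<Longrightarrow> x \<in> \<Omega> \<Longrightarrow> ut s differentiable (at x)"
    and C0: "C0_spacetime I \<Omega> (\<lambda>s. gradient (ut s))"
  shows "((\<lambda>s. gradient (u s) x \<bullet> v) has_real_derivative gradient (ut t) x \<bullet> v) (at t within I)"
  unfolding has_field_derivative_def has_derivative_within_alt
proof (intro conjI allI impI)
  show "bounded_linear ((*) (gradient (ut t) x \<bullet> v))" by (rule bounded_linear_mult_right)
  fix \<epsilon> :: real assume \<epsilon>: "\<epsilon> > 0"
  define D where "D = gradient (ut t) x \<bullet> v"
  obtain \<alpha> \<beta> where J: "{\<alpha>..\<beta>} \<subseteq> I" "t \<in> {\<alpha>..\<beta>}" "\<forall>\<^sub>F s in at t within I. s \<in> {\<alpha>..\<beta>}"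
    by (rule compact_time_neighbourhood[OF I t]) (rule that)
  obtain d0 where d0: "d0 > 0" "\<And>s. s \<in> I \<Longrightarrow> s \<noteq> t \<Longrightarrow> dist s t < d0 \<Longrightarrow> s \<in> {\<alpha>..\<beta>}"
    using J(3) unfolding eventually_at by blast
  have v1: "norm v + 1 > 0" using norm_ge_zero[of v] by linarith
  have "uniformly_continuous_on ({\<alpha>..\<beta>} \<times> \<Omega>) (\<lambda>(t, x). gradient (ut t) x)"
    using C0 J(1) by (simp add: C0_spacetime_def)
  then obtain \<delta> where \<delta>: "\<delta> > 0"
    "\<And>p q. p \<in> {\<alpha>..\<beta>} \<times> \<Omega> \<Longrightarrow> q \<in> {\<alpha>..\<beta>} \<times> \<Omega> \<Longrightarrow> dist q p < \<delta> \<Longrightarrow>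
      dist ((\<lambda>(t, x). gradient (ut t) x) q) ((\<lambda>(t, x). gradient (ut t) x) p) < \<epsilon> / (norm v + 1)"
    unfolding uniformly_continuous_on_def using divide_pos_pos[OF \<epsilon> v1] by meson
  obtain \<rho>0 where \<rho>0: "\<rho>0 > 0" "ball x \<rho>0 \<subseteq> \<Omega>" using \<Omega> x by (auto elim: openE)
  define \<rho> where "\<rho> = min \<rho>0 (\<delta> / 2)"
  have \<rho>: "\<rho> > 0" "ball x \<rho> \<subseteq> \<Omega>" "\<rho> \<le> \<delta> / 2" using \<rho>0 \<delta>(1) by (auto simp: \<rho>_def)
  have near: "\<bar>gradient (ut \<tau>) z \<bullet> v - D\<bar> \<le> \<epsilon>"
    if "\<tau> \<in> {\<alpha>..\<beta>}" "\<bar>\<tau> - t\<bar> < \<delta> / 2" "z \<in> ball x \<rho>" for \<tau> z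
  proof -
    have "dist (\<tau>, z) (t, x) \<le> dist \<tau> t + dist z x"
      unfolding dist_Pair_Pair by (rule order_trans[OF sqrt_sum_squares_le_sum]) auto
    also have "\<dots> < \<delta>" using that(2,3) \<rho>(3) by (simp add: dist_real_def dist_commute)
    finally have "dist (gradient (ut \<tau>) z) (gradient (ut t) x) < \<epsilon> / (norm v + 1)"
      using \<delta>(2)[of "(t, x)" "(\<tau>, z)"] that \<rho>(2) J(2) x by auto
    then have 1: "norm (gradient (ut \<tau>) z - gradient (ut t) x) \<le> \<epsilon> / (norm v + 1)" by (simp add: dist_norm)
    have "\<bar>gradient (ut \<tau>) z \<bullet> v - D\<bar> = \<bar>(gradient (ut \<tau>) z - gradient (ut t) x) \<bullet> v\<bar>"
      by (simp add: D_def inner_diff_left)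
    also have "\<dots> \<le> norm (gradient (ut \<tau>) z - gradient (ut t) x) * norm v" by (rule Cauchy_Schwarz_ineq2)
    also have "\<dots> \<le> \<epsilon> / (norm v + 1) * (norm v + 1)" using 1 \<epsilon> by (intro mult_mono) auto
    also have "\<dots> = \<epsilon>" using v1 by simp
    finally show ?thesis .
  qed
  define h0 where "h0 = \<rho> / (norm v + 1)"
  have h0: "h0 > 0" using \<rho>(1) v1 by (simp add: h0_def)
  have in_ball: "x + r *\<^sub>R v \<in> ball x \<rho>" if "0 \<le> r" "r < h0" for r
  proof -
    have "r * norm v \<le> r * (norm v + 1)" using that by (intro mult_left_mono) auto
    also have "\<dots> < h0 * (norm v + 1)" using that v1 by (intro mult_strict_right_mono) auto
    also have "\<dots> = \<rho>" using v1 by (simp add: h0_def)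
    finally show ?thesis using that by (simp add: dist_norm)
  qed
  define d where "d = min d0 (\<delta> / 2)"
  have dpos: "d > 0" using d0(1) \<delta>(1) by (simp add: d_def)
  have main: "\<bar>(u s (x + h *\<^sub>R v) - u s x) - (u t (x + h *\<^sub>R v) - u t x) - (s - t) * (h * D)\<bar> \<le> \<epsilon> * h * \<bar>s - t\<bar>"
    if s: "s \<in> I" "\<bar>s - t\<bar> < d" and h: "0 < h" "h < h0" for s h
  proof -
    define T where "T = closed_segment t s"
    have sJ: "s \<in> {\<alpha>..\<beta>}" using d0(2)[OF s(1)] s(2) J(2) by (cases "s = t") (auto simp: d_def dist_real_def)
    have TJ: "T \<subseteq> {\<alpha>..\<beta>}" unfolding T_def using J(2) sJ by (auto simp: closed_segment_eq_real_ivl split: if_splits)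
    have TI: "T \<subseteq> I" using TJ J(1) by auto
    have Tt: "\<bar>\<tau> - t\<bar> < \<delta> / 2" if "\<tau> \<in> T" for \<tau>
      using that s(2) by (auto simp: T_def closed_segment_eq_real_ivl d_def split: if_splits)
    have q: "\<bar>ut \<tau> (x + h *\<^sub>R v) - ut \<tau> x - h * D\<bar> \<le> \<epsilon> * h" if \<tau>: "\<tau> \<in> T" for \<tau>
    proof -
      define \<theta> where "\<theta> r = ut \<tau> (x + r *\<^sub>R v) - r * D" for r
      have \<theta>d: "(\<theta> has_real_derivative gradient (ut \<tau>) (x + r *\<^sub>R v) \<bullet> v - D) (at r within {0..h})"
        if r: "r \<in> {0..h}" for r
      proof -
        have "x + r *\<^sub>R v \<in> \<Omega>" using in_ball[of r] r h \<rho>(2) by auto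
        then have 1: "(ut \<tau> has_derivative (\<lambda>k. gradient (ut \<tau>) (x + r *\<^sub>R v) \<bullet> k)) (at (x + r *\<^sub>R v))"
          using utx \<tau> TI by (intro has_derivative_gradient) auto
        have "((\<lambda>r::real. x + r *\<^sub>R v) has_derivative (\<lambda>k. k *\<^sub>R v)) (at r)"
          by (auto intro!: derivative_eq_intros)
        from diff_chain_at[OF this 1]
        have "((\<lambda>r. ut \<tau> (x + r *\<^sub>R v)) has_real_derivative gradient (ut \<tau>) (x + r *\<^sub>R v) \<bullet> v) (at r)"
          by (simp add: o_def has_field_derivative_def mult_commute_abs)
        moreover have "((\<lambda>r. r * D) has_real_derivative D) (at r)"
          by (auto intro!: derivative_eq_intros)
        ultimately have "(\<theta> has_real_derivative gradient (ut \<tau>) (x + r *\<^sub>R v) \<bullet> v - D) (at r)"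
          unfolding \<theta>_def[abs_def] by (rule DERIV_diff)
        then show ?thesis by (rule has_field_derivative_at_within)
      qed
      have \<theta>b: "norm (gradient (ut \<tau>) (x + r *\<^sub>R v) \<bullet> v - D) \<le> \<epsilon>" if "r \<in> {0..h}" for r
        unfolding real_norm_def by (rule near[OF subsetD[OF TJ \<tau>] Tt[OF \<tau>] in_ball]) (use h that in auto)
      have "norm (\<theta> h - \<theta> 0) \<le> \<epsilon> * norm (h - 0)"
      proof (rule field_differentiable_bound[where S = "{0..h}"
            and f' = "\<lambda>r. gradient (ut \<tau>) (x + r *\<^sub>R v) \<bullet> v - D"])
        fix r assume "r \<in> {0..h}"
        then show "(\<theta> has_real_derivative gradient (ut \<tau>) (x + r *\<^sub>R v) \<bullet> v - D) (at r within {0..h})"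
          "norm (gradient (ut \<tau>) (x + r *\<^sub>R v) \<bullet> v - D) \<le> \<epsilon>" by (fact \<theta>d \<theta>b)+
      qed (use h in auto)
      then show ?thesis using h by (simp add: \<theta>_def)
    qed
    \<comment> \<open>The derivative of \<open>k\<close> in time is the quantity bounded in the
      fact \<open>q\<close>.\<close>
    define k where "k \<tau> = u \<tau> (x + h *\<^sub>R v) - u \<tau> x - \<tau> * (h * D)" for \<tau>
    have xh: "x + h *\<^sub>R v \<in> \<Omega>" using in_ball[of h] h \<rho>(2) by auto
    have kd: "(k has_real_derivative ut \<tau> (x + h *\<^sub>R v) - ut \<tau> x - h * D) (at \<tau> within T)" if \<tau>: "\<tau> \<in> T" for \<tau>
    proof -
      have \<tau>I: "\<tau> \<in> I" using \<tau> TI by auto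
      have "((\<lambda>\<tau>. \<tau> * (h * D)) has_real_derivative h * D) (at \<tau> within I)"
        by (auto intro!: derivative_eq_intros)
      from DERIV_diff[OF DERIV_diff[OF ut[OF \<tau>I xh] ut[OF \<tau>I x]] this]
      show ?thesis unfolding k_def[abs_def] by (rule DERIV_subset) (rule TI)
    qed
    have "norm (k s - k t) \<le> (\<epsilon> * h) * norm (s - t)"
      by (rule field_differentiable_bound[OF _ kd]) (use q in \<open>auto simp: T_def\<close>)
    moreover have "k s - k t = (u s (x + h *\<^sub>R v) - u s x) - (u t (x + h *\<^sub>R v) - u t x) - (s - t) * (h * D)"
      by (simp add: k_def algebra_simps)
    ultimately show ?thesis by simp
  qed
  show "\<exists>d>0. \<forall>y\<in>I. norm (y - t) < d \<longrightarrow> norm (gradient (u y) x \<bullet> v - gradient (u t) x \<bullet> v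
      - gradient (ut t) x \<bullet> v * (y - t)) \<le> \<epsilon> * norm (y - t)"
  proof (intro exI[of _ d] conjI ballI impI dpos)
    fix s assume s: "s \<in> I" "norm (s - t) < d"
    have lim: "((\<lambda>h. (u s (x + h *\<^sub>R v) - u s x) / h) \<longlongrightarrow> gradient (u s) x \<bullet> v) (at_right 0)" if "s \<in> I" for s
    proof -
      have 1: "(u s has_derivative (\<lambda>k. gradient (u s) x \<bullet> k)) (at (x + 0 *\<^sub>R v))"
        using has_derivative_gradient[OF u[OF that x]] by simp
      have "((\<lambda>r::real. x + r *\<^sub>R v) has_derivative (\<lambda>k. k *\<^sub>R v)) (at 0)"
        by (auto intro!: derivative_eq_intros)
      from diff_chain_at[OF this 1]
      have "((\<lambda>r. u s (x + r *\<^sub>R v)) has_real_derivative gradient (u s) x \<bullet> v) (at 0)"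
        by (simp add: o_def has_field_derivative_def mult_commute_abs)
      then have "((\<lambda>h. (u s (x + h *\<^sub>R v) - u s x) / h) \<longlongrightarrow> gradient (u s) x \<bullet> v) (at 0)"
        by (simp add: DERIV_def)
      then show ?thesis by (rule tendsto_within_subset) simp
    qed
    have L: "((\<lambda>h. \<bar>(u s (x + h *\<^sub>R v) - u s x) / h - (u t (x + h *\<^sub>R v) - u t x) / h - (s - t) * D\<bar>)
        \<longlongrightarrow> \<bar>gradient (u s) x \<bullet> v - gradient (u t) x \<bullet> v - (s - t) * D\<bar>) (at_right 0)"
      by (intro tendsto_intros lim s t)
    have "\<forall>\<^sub>F h in at_right 0. h \<in> {0<..<h0}" by (rule eventually_at_right_real[OF h0])
    then have "\<forall>\<^sub>F h in at_right 0. \<bar>(u s (x + h *\<^sub>R v) - u s x) / h - (u t (x + h *\<^sub>R v) - u t x) / h - (s - t) * D\<bar> \<le> \<epsilon> * \<bar>s - t\<bar>"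
    proof eventually_elim
      fix h assume "h \<in> {0<..<h0}"
      then have h: "0 < h" "h < h0" by auto
      have "(u s (x + h *\<^sub>R v) - u s x) / h - (u t (x + h *\<^sub>R v) - u t x) / h - (s - t) * D
          = ((u s (x + h *\<^sub>R v) - u s x) - (u t (x + h *\<^sub>R v) - u t x) - (s - t) * (h * D)) / h"
        using h by (simp add: diff_divide_distrib)
      then have "\<bar>(u s (x + h *\<^sub>R v) - u s x) / h - (u t (x + h *\<^sub>R v) - u t x) / h - (s - t) * D\<bar>
          = \<bar>(u s (x + h *\<^sub>R v) - u s x) - (u t (x + h *\<^sub>R v) - u t x) - (s - t) * (h * D)\<bar> / h"
        using h by simp
      also have "\<dots> \<le> (\<epsilon> * h * \<bar>s - t\<bar>) / h"
        using main[OF s(1) _ h] s(2) h by (intro divide_right_mono) auto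
      also have "\<dots> = \<epsilon> * \<bar>s - t\<bar>" using h by simp
      finally show "\<bar>(u s (x + h *\<^sub>R v) - u s x) / h - (u t (x + h *\<^sub>R v) - u t x) / h - (s - t) * D\<bar> \<le> \<epsilon> * \<bar>s - t\<bar>" .
    qed
    from tendsto_upperbound[OF L this]
    show "norm (gradient (u s) x \<bullet> v - gradient (u t) x \<bullet> v - gradient (ut t) x \<bullet> v * (s - t)) \<le> \<epsilon> * norm (s - t)"
      by (simp add: D_def mult.commute)
  qed
qed

lemma dominated_derivative_spacetime:
  fixes h h' :: "real \<Rightarrow> 'a::euclidean_space \<Rightarrow> real"
  assumes \<Omega>: "open \<Omega>" "bounded \<Omega>" and I: "is_interval I" and t: "t \<in> I"
    and D: "\<And>s x. s \<in> I \<Longrightarrow> x \<in> \<Omega> \<Longrightarrow> ((\<lambda>s. h s x) has_real_derivative h' s x) (at s within I)"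
    and bnd: "\<And>\<alpha> \<beta>. {\<alpha>..\<beta>} \<subseteq> I \<Longrightarrow> \<exists>C. \<forall>s\<in>{\<alpha>..\<beta>}. \<forall>x\<in>\<Omega>. \<bar>h' s x\<bar> \<le> C"
    and h: "\<And>s. s \<in> I \<Longrightarrow> continuous_on \<Omega> (h s)" "bounded (h t ` \<Omega>)"
  shows "dominated_derivative I t \<Omega> h (h' t)"
proof -
  obtain \<alpha> \<beta> where J: "{\<alpha>..\<beta>} \<subseteq> I" "t \<in> {\<alpha>..\<beta>}" "\<forall>\<^sub>F s in at t within I. s \<in> {\<alpha>..\<beta>}"
    by (rule compact_time_neighbourhood[OF I t]) (rule that)
  obtain C where C: "\<And>s x. s \<in> {\<alpha>..\<beta>} \<Longrightarrow> x \<in> \<Omega> \<Longrightarrow> \<bar>h' s x\<bar> \<le> C" using bnd[OF J(1)] by blast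
  have lip: "\<bar>h s x - h t x\<bar> \<le> C * \<bar>s - t\<bar>" if s: "s \<in> {\<alpha>..\<beta>}" and x: "x \<in> \<Omega>" for s x
  proof -
    have "((\<lambda>s. h s x) has_real_derivative h' s x) (at s within {\<alpha>..\<beta>})" if "s \<in> {\<alpha>..\<beta>}" for s
      by (rule DERIV_subset[OF D[OF _ x] J(1)]) (use that J(1) in auto)
    from field_differentiable_bound[OF _ this, of C s t] C x s J(2) show ?thesis by simp
  qed
  from J(3) have "\<forall>\<^sub>F s in at t within I. \<forall>x\<in>\<Omega>. \<bar>h s x - h t x\<bar> \<le> C * \<bar>s - t\<bar>"
    by eventually_elim (use lip in blast)
  moreover have "h s \<in> borel_measurable (lebesgue_on \<Omega>)" if "s \<in> I" for s
    using \<Omega>(1) by (intro continuous_imp_measurable_on_sets_lebesgue h(1) that) auto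
  ultimately show ?thesis unfolding dominated_derivative_def using D[OF t] h(2) by blast
qed

lemma C1_up_to_boundary_regular:
  fixes f :: "'a::euclidean_space \<Rightarrow> 'b::euclidean_space"
  assumes \<Omega>: "open \<Omega>" "bounded \<Omega>" and f: "C1_up_to_boundary \<Omega> f"
  shows "continuous_on \<Omega> f" "bounded (f ` \<Omega>)" "square_integrable \<Omega> f"
    "\<And>x. x \<in> \<Omega> \<Longrightarrow> f differentiable (at x)" "\<And>v. continuous_on \<Omega> (\<lambda>x. frechet_derivative f (at x) v)"
proof -
  have uc: "uniformly_continuous_on \<Omega> f" using f by (simp add: C1_up_to_boundary_def)
  show 1: "continuous_on \<Omega> f" using uc by (rule uniformly_continuous_imp_continuous)
  show 2: "bounded (f ` \<Omega>)" using uc \<Omega>(2) by (rule bounded_uniformly_continuous_image)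
  then obtain C where "\<And>x. x \<in> \<Omega> \<Longrightarrow> norm (f x) \<le> C" by (auto simp: bounded_iff)
  then show "square_integrable \<Omega> f"
    using \<Omega> 1 by (intro square_integrable_bounded_on continuous_imp_measurable_on_sets_lebesgue) auto
  show "\<And>x. x \<in> \<Omega> \<Longrightarrow> f differentiable (at x)" "\<And>v. continuous_on \<Omega> (\<lambda>x. frechet_derivative f (at x) v)"
    using f uniformly_continuous_imp_continuous by (auto simp: C1_up_to_boundary_def)
qed

lemma C1_divergence_regular:
  fixes w :: "'a::euclidean_space \<Rightarrow> 'a"
  assumes \<Omega>: "open \<Omega>" "bounded \<Omega>" and w: "C1_up_to_boundary \<Omega> w"
  shows "square_integrable \<Omega> (divergence w)"
proof -
  have "bounded ((\<lambda>x. frechet_derivative w (at x) v) ` \<Omega>)" for v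
    using w \<Omega>(2) by (auto simp: C1_up_to_boundary_def intro: bounded_uniformly_continuous_image)
  then have "\<forall>v. \<exists>C. \<forall>x\<in>\<Omega>. norm (frechet_derivative w (at x) v) \<le> C" by (simp add: bounded_iff)
  then obtain C where C: "\<And>v x. x \<in> \<Omega> \<Longrightarrow> norm (frechet_derivative w (at x) v) \<le> C v" by metis
  have "norm (divergence w x) \<le> (\<Sum>b\<in>Basis. C b)" if "x \<in> \<Omega>" for x
    unfolding divergence_def
  proof (rule order_trans[OF norm_sum], rule sum_mono)
    fix b :: 'a assume "b \<in> Basis"
    then show "norm (frechet_derivative w (at x) b \<bullet> b) \<le> C b"
      using Basis_le_norm[of b "frechet_derivative w (at x) b"] C[OF that, of b] by simp
  qed
  moreover have "continuous_on \<Omega> (divergence w)"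
    unfolding divergence_def[abs_def] by (intro continuous_intros C1_up_to_boundary_regular(5)[OF \<Omega> w])
  ultimately show ?thesis
    using \<Omega> by (intro square_integrable_bounded_on continuous_imp_measurable_on_sets_lebesgue) auto
qed

lemma square_integrable_const: "open \<Omega> \<Longrightarrow> bounded \<Omega> \<Longrightarrow> square_integrable \<Omega> (\<lambda>x. c)"
  by (rule square_integrable_bounded_on[of _ _ "norm c"]) auto

lemma square_integrable_imp_integrable:
  fixes f :: "'a::euclidean_space \<Rightarrow> real"
  assumes "open \<Omega>" "bounded \<Omega>" "square_integrable \<Omega> f"
  shows "integrable (lebesgue_on \<Omega>) f"
  using square_integrable_inner[OF assms(3) square_integrable_const[OF assms(1,2), of 1]] by simp

text \<open>A uniformly continuous field extends continuously to the closure and from there, by Tietze's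
  theorem, to the whole space; so it is continuous up to the boundary of each cell.\<close>

lemma integral_divergence_C1:
  fixes w :: "'a::euclidean_space \<Rightarrow> 'a"
  assumes \<Omega>: "bounded_lipschitz_domain \<Omega>" and mesh: "conforming_mesh \<Omega> \<T>"
    and w: "C1_up_to_boundary \<Omega> w" and trace: "zero_normal_trace \<Omega> \<Omega> (frontier \<Omega>) w"
  shows "integral\<^sup>L (lebesgue_on \<Omega>) (divergence w) = 0"
proof (rule integral_weak_divergence_eq_0[OF \<Omega> mesh])
  have op: "open \<Omega>" "bounded \<Omega>" using \<Omega> by (auto simp: bounded_lipschitz_domain_def)
  note reg = C1_up_to_boundary_regular[OF op w]
  have "(\<lambda>x. indicator \<Omega> x *\<^sub>R w x) \<in> borel_measurable borel"
    using reg(1) op by (intro borel_measurable_continuous_on_indicator) auto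
  then show "(\<lambda>x. if x \<in> \<Omega> then w x else 0) \<in> borel_measurable borel"
    by (rule measurable_cong[THEN iffD1, rotated]) (simp add: indicator_def)
  show "bounded (w ` \<Omega>)" by (rule reg(2))
  have "uniformly_continuous_on \<Omega> w" using w by (simp add: C1_up_to_boundary_def)
  then obtain w1 where w1: "uniformly_continuous_on (closure \<Omega>) w1" "\<And>x. x \<in> \<Omega> \<Longrightarrow> w x = w1 x"
    using uniformly_continuous_on_extension_on_closure by metis
  obtain p where p: "continuous_on UNIV p" "\<And>x. x \<in> closure \<Omega> \<Longrightarrow> p x = w1 x"
    using Tietze_unbounded[OF uniformly_continuous_imp_continuous[OF w1(1)], of UNIV] by auto
  have wp: "w x = p x" if "x \<in> \<Omega>" for x
    using p(2)[of x] w1(2)[OF that] that closure_subset[of \<Omega>] by auto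
  show "\<exists>p. continuous_on UNIV p \<and> (\<forall>x\<in>interior K. w x = p x)" if "K \<in> \<T>" for K
    using p(1) wp mesh_interior_subset(1)[OF \<Omega> mesh that] by (intro exI[of _ p]) auto
  show "integrable (lebesgue_on \<Omega>) (divergence w)"
    by (rule square_integrable_imp_integrable[OF op C1_divergence_regular[OF op w]])
  show "l2_inner \<Omega> w (gradient \<eta>) = - l2_inner \<Omega> (divergence w) \<eta>" if "test_function \<Omega> \<eta>" for \<eta>
    by (rule classical_divergence_weak[OF op(1) reg(4,5) that])
  show "zero_normal_trace \<Omega> (interior K) G w" if "K \<in> \<T>" "G facet_of K" "G \<subseteq> frontier \<Omega>" for K G
    unfolding zero_normal_trace_def
  proof (intro ballI allI impI)
    fix x \<nu> assume "x \<in> G" "outward_unit_normal \<Omega> x \<nu>"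
    then have "((\<lambda>y. w y \<bullet> \<nu>) \<longlongrightarrow> 0) (at x within \<Omega>)"
      using trace that(3) unfolding zero_normal_trace_def by blast
    then show "((\<lambda>y. w y \<bullet> \<nu>) \<longlongrightarrow> 0) (at x within interior K)"
      by (rule tendsto_within_subset) (rule mesh_interior_subset(1)[OF \<Omega> mesh that(1)])
  qed
qed

lemma uniformly_continuous_on_transform:
  fixes f g :: "'a::metric_space \<Rightarrow> 'b::metric_space"
  assumes "uniformly_continuous_on S f" "\<And>x. x \<in> S \<Longrightarrow> f x = g x"
  shows "uniformly_continuous_on S g"
  using assms(1) unfolding uniformly_continuous_on_def by (metis assms(2))

text \<open>On a bounded set the factors extend to the compact closure, where continuity suffices.\<close>

lemma uniformly_continuous_on_scaleR_bounded:
  fixes f :: "'a::euclidean_space \<Rightarrow> real" and g :: "'a \<Rightarrow> 'b::euclidean_space"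
  assumes "bounded \<Omega>" "uniformly_continuous_on \<Omega> f" "uniformly_continuous_on \<Omega> g"
  shows "uniformly_continuous_on \<Omega> (\<lambda>x. f x *\<^sub>R g x)"
proof -
  obtain F where F: "uniformly_continuous_on (closure \<Omega>) F" "\<And>x. x \<in> \<Omega> \<Longrightarrow> f x = F x"
    using uniformly_continuous_on_extension_on_closure[OF assms(2)] by metis
  obtain G where G: "uniformly_continuous_on (closure \<Omega>) G" "\<And>x. x \<in> \<Omega> \<Longrightarrow> g x = G x"
    using uniformly_continuous_on_extension_on_closure[OF assms(3)] by metis
  have "continuous_on (closure \<Omega>) (\<lambda>x. F x *\<^sub>R G x)"
    by (intro continuous_intros uniformly_continuous_imp_continuous F(1) G(1))
  then have "uniformly_continuous_on (closure \<Omega>) (\<lambda>x. F x *\<^sub>R G x)"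
    using assms(1) by (intro compact_uniformly_continuous) (auto simp: compact_closure)
  then have "uniformly_continuous_on \<Omega> (\<lambda>x. F x *\<^sub>R G x)"
    using closure_subset[of \<Omega>] by (auto simp: uniformly_continuous_on_def) (meson subsetD)
  then show ?thesis by (rule uniformly_continuous_on_transform) (simp add: F(2) G(2))
qed

lemma zero_normal_trace_scaleR:
  assumes w: "zero_normal_trace \<Omega> \<Omega> G w" and f: "bounded (f ` \<Omega>)"
  shows "zero_normal_trace \<Omega> \<Omega> G (\<lambda>x. f x *\<^sub>R w x)"
  unfolding zero_normal_trace_def
proof (intro ballI allI impI)
  fix x \<nu> assume x: "x \<in> G" "outward_unit_normal \<Omega> x \<nu>"
  obtain C where C: "\<And>x. x \<in> \<Omega> \<Longrightarrow> norm (f x) \<le> C" using f by (auto simp: bounded_iff)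
  have 0: "((\<lambda>y. w y \<bullet> \<nu>) \<longlongrightarrow> 0) (at x within \<Omega>)" using w x unfolding zero_normal_trace_def by blast
  show "((\<lambda>y. (f y *\<^sub>R w y) \<bullet> \<nu>) \<longlongrightarrow> 0) (at x within \<Omega>)"
  proof (rule Lim_null_comparison)
    have "\<forall>\<^sub>F y in at x within \<Omega>. y \<in> \<Omega>" by (simp add: eventually_at_filter)
    then show "\<forall>\<^sub>F y in at x within \<Omega>. norm ((f y *\<^sub>R w y) \<bullet> \<nu>) \<le> C * \<bar>w y \<bullet> \<nu>\<bar>"
      by eventually_elim (use C in \<open>auto simp: abs_mult intro: mult_right_mono\<close>)
    show "((\<lambda>y. C * \<bar>w y \<bullet> \<nu>\<bar>) \<longlongrightarrow> 0) (at x within \<Omega>)"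
      by (rule tendsto_mult_right_zero[OF tendsto_rabs_zero[OF 0]])
  qed
qed

text \<open>The divergence theorem for the product \<open>\<psi> w\<close>, whose normal trace vanishes with that of \<open>w\<close>.\<close>

lemma green_identity:
  fixes w :: "'a::euclidean_space \<Rightarrow> 'a"
  assumes \<Omega>: "bounded_lipschitz_domain \<Omega>" and mesh: "conforming_mesh \<Omega> \<T>"
    and \<psi>: "C1_up_to_boundary \<Omega> \<psi>" "square_integrable \<Omega> (gradient \<psi>)"
    and w: "C1_up_to_boundary \<Omega> w" and trace: "zero_normal_trace \<Omega> \<Omega> (frontier \<Omega>) w"
  shows "l2_inner \<Omega> \<psi> (divergence w) = - l2_inner \<Omega> (gradient \<psi>) w"
proof -
  have op: "open \<Omega>" "bounded \<Omega>" using \<Omega> by (auto simp: bounded_lipschitz_domain_def)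
  note reg\<psi> = C1_up_to_boundary_regular[OF op \<psi>(1)] and regw = C1_up_to_boundary_regular[OF op w]
  define u where "u = (\<lambda>x. \<psi> x *\<^sub>R w x)"
  have ud: "(u has_derivative (\<lambda>h. frechet_derivative \<psi> (at x) h *\<^sub>R w x + \<psi> x *\<^sub>R frechet_derivative w (at x) h)) (at x)"
    if "x \<in> \<Omega>" for x
  proof -
    have "(\<psi> has_derivative frechet_derivative \<psi> (at x)) (at x)" "(w has_derivative frechet_derivative w (at x)) (at x)"
      using reg\<psi>(4)[OF that] regw(4)[OF that] by (simp_all add: frechet_derivative_works[symmetric])
    from has_derivative_scaleR[OF this] show ?thesis unfolding u_def by (simp add: add.commute)
  qed
  have uf: "frechet_derivative u (at x) h = frechet_derivative \<psi> (at x) h *\<^sub>R w x + \<psi> x *\<^sub>R frechet_derivative w (at x) h"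
    if "x \<in> \<Omega>" for x h
    using fun_cong[OF frechet_derivative_at[OF ud[OF that]], of h] by simp
  have C1: "C1_up_to_boundary \<Omega> u"
    unfolding C1_up_to_boundary_def
  proof (intro conjI ballI allI)
    show "u differentiable (at x)" if "x \<in> \<Omega>" for x using ud[OF that] by (rule differentiableI)
    show "uniformly_continuous_on \<Omega> u"
      unfolding u_def using \<psi>(1) w op
      by (intro uniformly_continuous_on_scaleR_bounded) (auto simp: C1_up_to_boundary_def)
    have "uniformly_continuous_on \<Omega> (\<lambda>x. frechet_derivative \<psi> (at x) v *\<^sub>R w x + \<psi> x *\<^sub>R frechet_derivative w (at x) v)" for v
      using \<psi>(1) w op
      by (intro uniformly_continuous_on_add uniformly_continuous_on_scaleR_bounded) (auto simp: C1_up_to_boundary_def)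
    then show "uniformly_continuous_on \<Omega> (\<lambda>x. frechet_derivative u (at x) v)" for v
      by (rule uniformly_continuous_on_transform) (simp add: uf)
  qed
  have div: "divergence u x = gradient \<psi> x \<bullet> w x + \<psi> x \<bullet> divergence w x" if "x \<in> \<Omega>" for x
  proof -
    have "divergence u x = (\<Sum>b\<in>Basis. (gradient \<psi> x \<bullet> b) * (w x \<bullet> b) + \<psi> x * (frechet_derivative w (at x) b \<bullet> b))"
      unfolding divergence_def by (simp add: uf[OF that] inner_add_left inner_gradient[OF reg\<psi>(4)[OF that]])
    also have "\<dots> = gradient \<psi> x \<bullet> w x + \<psi> x * divergence w x"
      by (subst euclidean_inner[of "gradient \<psi> x" "w x"])
         (simp add: sum.distrib sum_distrib_left divergence_def)
    finally show ?thesis by simp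
  qed
  have "0 = integral\<^sup>L (lebesgue_on \<Omega>) (divergence u)"
    using integral_divergence_C1[OF \<Omega> mesh C1] zero_normal_trace_scaleR[OF trace reg\<psi>(2)] by (simp add: u_def)
  also have "\<dots> = (\<integral>x. gradient \<psi> x \<bullet> w x + \<psi> x \<bullet> divergence w x \<partial>lebesgue_on \<Omega>)"
    by (rule Bochner_Integration.integral_cong) (simp_all add: div)
  also have "\<dots> = l2_inner \<Omega> (gradient \<psi>) w + l2_inner \<Omega> \<psi> (divergence w)"
    unfolding l2_inner_def
    by (rule Bochner_Integration.integral_add[OF square_integrable_inner[OF \<psi>(2) regw(3)]
          square_integrable_inner[OF reg\<psi>(3) C1_divergence_regular[OF op w]]])
  finally show ?thesis by simp
qed

lemma gradient_C1_square_integrable: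
  assumes \<Omega>: "open \<Omega>" "bounded \<Omega>" and f: "C1_up_to_boundary \<Omega> f"
  shows "square_integrable \<Omega> (gradient f)"
proof -
  have "uniformly_continuous_on \<Omega> (gradient f)"
    unfolding gradient_def[abs_def] using f \<Omega>(2)
    by (intro uniformly_continuous_on_sum uniformly_continuous_on_scaleR_bounded uniformly_continuous_on_const)
       (auto simp: C1_up_to_boundary_def)
  then have 1: "continuous_on \<Omega> (gradient f)" "bounded (gradient f ` \<Omega>)"
    using \<Omega>(2) by (auto intro: uniformly_continuous_imp_continuous bounded_uniformly_continuous_image)
  then obtain C where "\<And>x. x \<in> \<Omega> \<Longrightarrow> norm (gradient f x) \<le> C" by (auto simp: bounded_iff)
  then show ?thesis
    using \<Omega> 1(1) by (intro square_integrable_bounded_on continuous_imp_measurable_on_sets_lebesgue) auto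
qed

lemma deriv_potential: "deriv potential r = r ^ 3 - r"
proof (rule DERIV_imp_deriv)
  show "(potential has_real_derivative r ^ 3 - r) (at r)"
    unfolding potential_def[abs_def]
    by (auto intro!: derivative_eq_intros simp: power2_eq_square power3_eq_cube field_simps)
qed

text \<open>Green's identity is used twice: for \<open>\<phi>'\<close> with \<open>\<nabla>\<phi>\<close>, and for \<open>\<mu>\<close> with the flux \<open>d(\<phi>) \<nabla>\<mu>\<close>, whose normal
  trace vanishes because \<open>d(\<phi>)\<close> is bounded.\<close>

lemma ch_energy_law:
  fixes \<Omega> :: "'a::euclidean_space set"
  assumes \<Omega>: "bounded_lipschitz_domain \<Omega>" and mesh: "conforming_mesh \<Omega> \<T>"
    and I: "is_interval I"
    and d: "continuous_on UNIV d" "\<And>r. d r > 0"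
    and S: "\<And>t. t \<in> I \<Longrightarrow> square_integrable \<Omega> (S t)"
    and smooth: "ch_smooth I \<Omega> d \<phi> \<mu>" and sol: "ch_solution I \<Omega> \<epsilon> d S \<phi> \<mu>"
  shows "energy_law I \<Omega> \<epsilon> d S \<phi> (\<lambda>t x. - d (\<phi> t x) *\<^sub>R gradient (\<mu> t) x) \<mu> (\<lambda>t. gradient (\<phi> t))"
  unfolding energy_law_def
proof
  fix t assume t: "t \<in> I"
  have op: "open \<Omega>" "bounded \<Omega>" using \<Omega> by (auto simp: bounded_lipschitz_domain_def)
  define \<phi>' where "\<phi>' = time_deriv I \<phi> t"
  define F where "F = (\<lambda>x. d (\<phi> t x) *\<^sub>R gradient (\<mu> t) x)"
  have C1: "C1_up_to_boundary \<Omega> (\<phi> s)" "C1_up_to_boundary \<Omega> (gradient (\<phi> s))" "C1_up_to_boundary \<Omega> (\<mu> s)"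
    "C1_up_to_boundary \<Omega> (time_deriv I \<phi> s)" if "s \<in> I" for s
    using smooth that by (auto simp: ch_smooth_def)
  have C1F: "C1_up_to_boundary \<Omega> F" using smooth t by (simp add: ch_smooth_def F_def)
  note reg = C1_up_to_boundary_regular[OF op]
  have der: "((\<lambda>s. \<phi> s x) has_real_derivative time_deriv I \<phi> s x) (at s within I)" if "s \<in> I" "x \<in> \<Omega>" for s x
    using smooth that unfolding ch_smooth_def time_deriv_def has_real_derivative_iff_has_vector_derivative
    by (auto simp: vector_derivative_works[symmetric])
  have C0: "C0_spacetime I \<Omega> (time_deriv I \<phi>)" "C0_spacetime I \<Omega> (\<lambda>t. gradient (time_deriv I \<phi> t))"
    using smooth by (auto simp: ch_smooth_def)
  have dd\<phi>: "dominated_derivative I t \<Omega> \<phi> \<phi>'"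
    unfolding \<phi>'_def
  proof (rule dominated_derivative_spacetime[OF op I t der])
    show "\<exists>C. \<forall>s\<in>{\<alpha>..\<beta>}. \<forall>x\<in>\<Omega>. \<bar>time_deriv I \<phi> s x\<bar> \<le> C" if J: "{\<alpha>..\<beta>} \<subseteq> I" for \<alpha> \<beta>
      using C0_spacetime_bounded[OF C0(1) op(2) J] by (metis real_norm_def)
  qed (use reg(1)[OF C1(1)] reg(2)[OF C1(1)[OF t]] in auto)
  have dd\<sigma>: "dominated_derivative I t \<Omega> (\<lambda>s x. gradient (\<phi> s) x \<bullet> b) (\<lambda>x. gradient \<phi>' x \<bullet> b)" if b: "b \<in> Basis" for b
    unfolding \<phi>'_def
  proof (rule dominated_derivative_spacetime[OF op I t])
    show "((\<lambda>s. gradient (\<phi> s) x \<bullet> b) has_real_derivative gradient (time_deriv I \<phi> s) x \<bullet> b) (at s within I)"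
      if "s \<in> I" "x \<in> \<Omega>" for s x
      by (rule gradient_time_derivative_commute[OF op(1) I that reg(4)[OF C1(1)] der reg(4)[OF C1(4)] C0(2)])
    show "\<exists>C. \<forall>s\<in>{\<alpha>..\<beta>}. \<forall>x\<in>\<Omega>. \<bar>gradient (time_deriv I \<phi> s) x \<bullet> b\<bar> \<le> C" if J: "{\<alpha>..\<beta>} \<subseteq> I" for \<alpha> \<beta>
    proof -
      obtain C where C: "\<And>s x. s \<in> {\<alpha>..\<beta>} \<Longrightarrow> x \<in> \<Omega> \<Longrightarrow> norm (gradient (time_deriv I \<phi> s) x) \<le> C"
        by (rule C0_spacetime_bounded[OF C0(2) op(2) J]) (rule that)
      show ?thesis using C Basis_le_norm[OF b] order_trans by (intro exI[of _ C]) blast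
    qed
    show "continuous_on \<Omega> (\<lambda>x. gradient (\<phi> s) x \<bullet> b)" if "s \<in> I" for s
      by (intro continuous_intros reg(1)[OF C1(2)[OF that]])
    have "bounded (gradient (\<phi> t) ` \<Omega>)" by (rule reg(2)[OF C1(2)[OF t]])
    then show "bounded ((\<lambda>x. gradient (\<phi> t) x \<bullet> b) ` \<Omega>)"
      using Basis_le_norm[OF b] order_trans unfolding bounded_iff by (auto; blast)
  qed
  have C1\<phi>': "C1_up_to_boundary \<Omega> \<phi>'" using C1(4)[OF t] by (simp add: \<phi>'_def)
  have sq: "square_integrable \<Omega> \<phi>'" "square_integrable \<Omega> (gradient \<phi>')" "square_integrable \<Omega> (\<mu> t)"
    "square_integrable \<Omega> (gradient (\<phi> t))" "square_integrable \<Omega> (gradient (\<mu> t))"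
    "square_integrable \<Omega> (divergence F)" "square_integrable \<Omega> (laplacian (\<phi> t))"
    using reg(3)[OF C1\<phi>'] gradient_C1_square_integrable[OF op C1\<phi>'] reg(3)[OF C1(3)[OF t]] reg(3)[OF C1(2)[OF t]]
      gradient_C1_square_integrable[OF op C1(3)[OF t]] C1_divergence_regular[OF op C1F]
      C1_divergence_regular[OF op C1(2)[OF t]] by (simp_all add: laplacian_def)
  have trace: "zero_normal_trace \<Omega> \<Omega> (frontier \<Omega>) (gradient (\<phi> t))" "zero_normal_trace \<Omega> \<Omega> (frontier \<Omega>) (gradient (\<mu> t))"
    using sol t by (auto simp: ch_solution_def)
  have "bounded ((\<lambda>x. d (\<phi> t x)) ` \<Omega>)"
  proof -
    have "compact (closure (\<phi> t ` \<Omega>))" using reg(2)[OF C1(1)[OF t]] by (simp add: compact_closure)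
    then have "compact (d ` closure (\<phi> t ` \<Omega>))"
      by (intro compact_continuous_image continuous_on_subset[OF d(1)]) auto
    then have "bounded (d ` closure (\<phi> t ` \<Omega>))" by (rule compact_imp_bounded)
    then show ?thesis by (rule bounded_subset) (use closure_subset[of "\<phi> t ` \<Omega>"] in auto)
  qed
  then have traceF: "zero_normal_trace \<Omega> \<Omega> (frontier \<Omega>) F"
    unfolding F_def by (rule zero_normal_trace_scaleR[OF trace(2)])
  have \<mu>_eq: "\<mu> t x = (\<phi> t x ^ 3 - \<phi> t x) - \<epsilon>\<^sup>2 * laplacian (\<phi> t) x" if "x \<in> \<Omega>" for x
    using sol t that by (simp add: ch_solution_def deriv_potential)
  have "((\<lambda>s. energy \<Omega> \<epsilon> (\<phi> s) (gradient (\<phi> s))) has_real_derivative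
      (\<integral>x. (\<phi> t x ^ 3 - \<phi> t x) * \<phi>' x + \<epsilon>\<^sup>2 * (gradient (\<phi> t) x \<bullet> gradient \<phi>' x) \<partial>lebesgue_on \<Omega>)) (at t within I)"
    unfolding energy_def
    by (rule dominated_derivative_integral[OF op t dominated_derivative_energy[OF t dd\<phi> dd\<sigma>]])
  moreover have "(\<integral>x. (\<phi> t x ^ 3 - \<phi> t x) * \<phi>' x + \<epsilon>\<^sup>2 * (gradient (\<phi> t) x \<bullet> gradient \<phi>' x) \<partial>lebesgue_on \<Omega>)
      = - (l2_norm \<Omega> (\<lambda>x. (1 / sqrt (d (\<phi> t x))) *\<^sub>R - d (\<phi> t x) *\<^sub>R gradient (\<mu> t) x))\<^sup>2 + l2_inner \<Omega> (\<mu> t) (S t)"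
  proof -
    have "(\<integral>x. (\<phi> t x ^ 3 - \<phi> t x) * \<phi>' x + \<epsilon>\<^sup>2 * (gradient (\<phi> t) x \<bullet> gradient \<phi>' x) \<partial>lebesgue_on \<Omega>)
        = (\<integral>x. \<mu> t x \<bullet> \<phi>' x + \<epsilon>\<^sup>2 * (\<phi>' x \<bullet> laplacian (\<phi> t) x) + \<epsilon>\<^sup>2 * (gradient \<phi>' x \<bullet> gradient (\<phi> t) x) \<partial>lebesgue_on \<Omega>)"
      by (rule Bochner_Integration.integral_cong) (simp_all add: \<mu>_eq inner_commute algebra_simps)
    also have "\<dots> = l2_inner \<Omega> (\<mu> t) \<phi>' + \<epsilon>\<^sup>2 * l2_inner \<Omega> \<phi>' (laplacian (\<phi> t)) + \<epsilon>\<^sup>2 * l2_inner \<Omega> (gradient \<phi>') (gradient (\<phi> t))"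
      unfolding l2_inner_def
      using square_integrable_inner[OF sq(3,1)] square_integrable_inner[OF sq(1,7)] square_integrable_inner[OF sq(2,4)]
      by (simp del: inner_real_def)
    also have "l2_inner \<Omega> \<phi>' (laplacian (\<phi> t)) = - l2_inner \<Omega> (gradient \<phi>') (gradient (\<phi> t))"
      unfolding laplacian_def by (rule green_identity[OF \<Omega> mesh C1\<phi>' sq(2) C1(2)[OF t] trace(1)])
    also have "l2_inner \<Omega> (\<mu> t) \<phi>' = l2_inner \<Omega> (\<mu> t) (S t) + l2_inner \<Omega> (\<mu> t) (divergence F)"
    proof -
      have "AE x in lebesgue_on \<Omega>. \<phi>' x - divergence F x = S t x"
        using sol t by (simp add: ch_solution_def \<phi>'_def F_def)
      then have "l2_inner \<Omega> (\<mu> t) \<phi>' = (\<integral>x. \<mu> t x \<bullet> S t x + \<mu> t x \<bullet> divergence F x \<partial>lebesgue_on \<Omega>)"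
        unfolding l2_inner_def
      proof (intro integral_cong_AE)
        assume ae: "AE x in lebesgue_on \<Omega>. \<phi>' x - divergence F x = S t x"
        show "AE x in lebesgue_on \<Omega>. \<mu> t x \<bullet> \<phi>' x = \<mu> t x \<bullet> S t x + \<mu> t x \<bullet> divergence F x"
          using ae by eventually_elim (simp add: algebra_simps)
        show "(\<lambda>x. \<mu> t x \<bullet> \<phi>' x) \<in> borel_measurable (lebesgue_on \<Omega>)"
          using square_integrable_inner[OF sq(3,1)] by (rule borel_measurable_integrable)
        show "(\<lambda>x. \<mu> t x \<bullet> S t x + \<mu> t x \<bullet> divergence F x) \<in> borel_measurable (lebesgue_on \<Omega>)"
          using square_integrable_inner[OF sq(3) S[OF t]] square_integrable_inner[OF sq(3,6)]
          by (intro borel_measurable_add borel_measurable_integrable)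
      qed
      also have "\<dots> = l2_inner \<Omega> (\<mu> t) (S t) + l2_inner \<Omega> (\<mu> t) (divergence F)"
        unfolding l2_inner_def
        by (rule Bochner_Integration.integral_add[OF square_integrable_inner[OF sq(3) S[OF t]] square_integrable_inner[OF sq(3,6)]])
      finally show ?thesis .
    qed
    also have "l2_inner \<Omega> (\<mu> t) (divergence F) = - l2_inner \<Omega> (gradient (\<mu> t)) F"
      by (rule green_identity[OF \<Omega> mesh C1(3)[OF t] sq(5) C1F traceF])
    also have "l2_inner \<Omega> (gradient (\<mu> t)) F = (l2_norm \<Omega> (\<lambda>x. (1 / sqrt (d (\<phi> t x))) *\<^sub>R - d (\<phi> t x) *\<^sub>R gradient (\<mu> t) x))\<^sup>2"
    proof -
      have "gradient (\<mu> t) x \<bullet> F x = ((1 / sqrt (d (\<phi> t x))) *\<^sub>R - d (\<phi> t x) *\<^sub>R gradient (\<mu> t) x)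
          \<bullet> ((1 / sqrt (d (\<phi> t x))) *\<^sub>R - d (\<phi> t x) *\<^sub>R gradient (\<mu> t) x)" for x
      proof -
        have "sqrt (d (\<phi> t x)) * sqrt (d (\<phi> t x)) = d (\<phi> t x)" using d(2)[of "\<phi> t x"] by simp
        then show ?thesis using d(2)[of "\<phi> t x"] by (simp add: F_def field_simps)
      qed
      then show ?thesis unfolding l2_norm_square by (simp only: l2_inner_def)
    qed
    finally show ?thesis by simp
  qed
  ultimately show "((\<lambda>s. energy \<Omega> \<epsilon> (\<phi> s) (gradient (\<phi> s))) has_real_derivative
      - (l2_norm \<Omega> (\<lambda>x. (1 / sqrt (d (\<phi> t x))) *\<^sub>R - d (\<phi> t x) *\<^sub>R gradient (\<mu> t) x))\<^sup>2 + l2_inner \<Omega> (\<mu> t) (S t)) (at t within I)"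
    by simp
qed


section \<open>Mass conservation and consistent energy evolution\<close>

theorem proposition3p1:
  fixes \<Omega> :: "'a::euclidean_space set" and \<T> :: "'a set set"
    and V_DG :: "('a \<Rightarrow> real) set" and V_div :: "('a \<Rightarrow> 'a) set"
    and I :: "real set" and \<epsilon> :: real and d :: "real \<Rightarrow> real" and S :: "real \<Rightarrow> 'a \<Rightarrow> real"
    and \<phi>\<^sub>h \<mu>\<^sub>h :: "real \<Rightarrow> 'a \<Rightarrow> real" and j\<^sub>h \<sigma>\<^sub>h :: "real \<Rightarrow> 'a \<Rightarrow> 'a"
  assumes "bounded_lipschitz_domain \<Omega>"
    and "conforming_mesh \<Omega> \<T>"
    and "compatible_fe_spaces \<Omega> \<T> V_DG V_div"
    and "is_interval I" and "interior I \<noteq> {}"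
    and "\<epsilon> > 0"
    and "continuous_on UNIV d" and "\<And>r. d r > 0"
    and "\<And>t. t \<in> I \<Longrightarrow> square_integrable \<Omega> (S t)"
    and "dg_ch_solution I \<Omega> \<T> V_DG V_div \<epsilon> d S \<phi>\<^sub>h j\<^sub>h \<mu>\<^sub>h \<sigma>\<^sub>h"
  shows "(\<forall>t\<in>I. ((\<lambda>s. integral\<^sup>L (lebesgue_on \<Omega>) (\<phi>\<^sub>h s)) has_real_derivative
                    integral\<^sup>L (lebesgue_on \<Omega>) (S t)) (at t within I)) \<and>
         energy_law I \<Omega> \<epsilon> d S \<phi>\<^sub>h j\<^sub>h \<mu>\<^sub>h (\<lambda>t. weak_gradient \<Omega> \<T> V_div (\<phi>\<^sub>h t)) \<and>
         (\<forall>\<phi> \<mu>. ch_smooth I \<Omega> d \<phi> \<mu> \<and> ch_solution I \<Omega> \<epsilon> d S \<phi> \<mu> \<longrightarrow>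
            energy_law I \<Omega> \<epsilon> d S \<phi> (\<lambda>t x. - d (\<phi> t x) *\<^sub>R gradient (\<mu> t) x) \<mu>
              (\<lambda>t. gradient (\<phi> t)))"
proof (intro conjI)
  note discrete = dg_ch_conservation_laws[OF assms(1-5) assms(8,9,10)]
  show "\<forall>t\<in>I. ((\<lambda>s. integral\<^sup>L (lebesgue_on \<Omega>) (\<phi>\<^sub>h s)) has_real_derivative
                    integral\<^sup>L (lebesgue_on \<Omega>) (S t)) (at t within I)"
    using discrete(1) by blast
  show "energy_law I \<Omega> \<epsilon> d S \<phi>\<^sub>h j\<^sub>h \<mu>\<^sub>h (\<lambda>t. weak_gradient \<Omega> \<T> V_div (\<phi>\<^sub>h t))"
    unfolding energy_law_def using discrete(2) by blast
  show "\<forall>\<phi> \<mu>. ch_smooth I \<Omega> d \<phi> \<mu> \<and> ch_solution I \<Omega> \<epsilon> d S \<phi> \<mu> \<longrightarrow>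
            energy_law I \<Omega> \<epsilon> d S \<phi> (\<lambda>t x. - d (\<phi> t x) *\<^sub>R gradient (\<mu> t) x) \<mu>
              (\<lambda>t. gradient (\<phi> t))"
  proof (intro allI impI, elim conjE)
    fix \<phi> \<mu> assume "ch_smooth I \<Omega> d \<phi> \<mu>" "ch_solution I \<Omega> \<epsilon> d S \<phi> \<mu>"
    then show "energy_law I \<Omega> \<epsilon> d S \<phi> (\<lambda>t x. - d (\<phi> t x) *\<^sub>R gradient (\<mu> t) x) \<mu> (\<lambda>t. gradient (\<phi> t))"
      using ch_energy_law[of \<Omega> \<T> I d S \<phi> \<mu> \<epsilon>] assms(1,2,4,7,8,9) by blast
  qed
qed

end
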